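(* Let $(X,\mu)$ be an $m$-coloured stationary uniformly discrete ergodic point process and $w=(w_1,\dots,w_m)\in\mathbb R^m$ a system of weights. Suppose that the weights $w_i$, $i=1,\dots,m$, are all different from one another and that none of them is equal to $0$. Then the algebra $\Theta^w$ generated by $\theta^w(\mathbb S)$ and the identity function $1_X$ (the constant function $1$ on $X$) is dense in $L^2(X,\mu)$.
   Context: Fix $d,m\ge1$ and let $\mathbb E=\mathbb R^d\times\{1,\dots,m\}$ (second factor discrete), with $t+(x,i):=(t+x,i)$ for $t\in\mathbb R^d$. $C_R$ is the open cube of edge length $R$ centred at $0$ in $\mathbb R^d$; $\ell$ is Lebesgue measure. $M_p$ is the set of positive Radon measures $\lambda$ on $\mathbb E$ with $\lambda(A)\in\{0,1,2,\dots\}$ for every relatively compact Borel set $A$, with the vague topology ($\lambda_n\to\lambda$ iff $\lambda_n(f)\to\lambda(f)$ for all $f\in C_c(\mathbb E)$) and its Borel $\sigma$-algebra; $\mathbb R^d$ acts by $(T_t\lambda)(A)=\lambda(-t+A)$. For $r>0$, $M_p(C_r^{(m)},1)$ is the (compact) set of $\lambda\in M_p$ with $\lambda((a+C_r)\times\{1,\dots,m\})\le1$ for all $a\in\mathbb R^d$. An $m$-coloured uniformly discrete stationary ergodic point process $(X,\mu)$ is a Borel probability measure $\mu$ on $M_p$, invariant and ergodic under all $T_t$, whose support $X$ is a closed subset of $M_p(C_r^{(m)},1)$ for some $r>0$. For $\lambda\in X$ let $\lambda^i$ be the measure on $\mathbb R^d$ given by $\lambda^i(A)=\lambda(A\times\{i\})$;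 it is assumed throughout that for each $i$ the constant $I^{(i)}$ with $\int_X\lambda^i(A)\,d\mu(\lambda)=I^{(i)}\ell(A)$ is positive. For a system of weights $w\in\mathbb R^m$ put $\lambda^w=\sum_i w_i\lambda^i$. The $w$-weighted Palm measure $\dot\mu^w$ is the finite signed measure on $X$ given by $\dot\mu^w(D)=\frac1{\ell(B)}\int_X\sum_{x\in B}\lambda^w(\{x\})\mathbf 1_D(T_{-x}\lambda)\,d\mu(\lambda)$, independent of the choice of bounded Borel $B\subset\mathbb R^d$ with $\ell(B)>0$. $\mathbb S$ is the space of ($\mathbb C$-valued) rapidly decreasing functions on $\mathbb R^d$. For $f\in C_c(\mathbb R^d)$ or $f\in\mathbb S$, $N^w_f:X\to\mathbb C$ is the bounded function $N^w_f(\lambda)=\lambda^w(f)=\sum_{x\in\mathbb R^d}\lambda^w(\{x\})f(x)$. The weighted first moment of $\dot\mu^w$ is the measure $\dot\mu^w_1$ on $\mathbb R^d$ with $\dot\mu^w_1(f)=\dot\mu^w(N^w_f)$, $f\in C_c(\mathbb R^d)$; its Fourier transform $\widehat{\dot\mu^w_1}$ is a positive translation bounded measure. $\theta^w:L^2(\mathbb R^d,\widehat{\dot\mu^w_1})\to L^2(X,\mu)$ is the unique isometric embedding with $\theta^w(\hat f)=N^w_f$ for all $f\in\mathbb S$, where $\hat f(y)=\int e^{-2\pi i x\cdot y}f(x)\,dx$; in particular $\theta^w(\mathbb S)=\{N^w_f: f\in\mathbb S\}$. The algebra is formed with complex scalars and pointwise multiplication of functions on $X$. *)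

theory Defs
  imports "HOL-Probability.Probability"
begin

section \<open>Coloured point configurations\<close>

text \<open>
  The colours are the natural numbers \<open>1, \<dots>, m\<close>. Since \<open>nat\<close> carries the discrete topology, the
  coloured space below is a closed and open subset of \<open>(real ^ 'd) \<times> nat\<close> whose subspace topology is
  the product of the Euclidean and the discrete topology.
\<close>

definition coloured_space :: "nat \<Rightarrow> ((real ^ 'd) \<times> nat) set" where
  "coloured_space m = UNIV \<times> {1..m}"

definition Cc :: "'a::topological_space set \<Rightarrow> ('a \<Rightarrow> complex) set" where
  "Cc S = {f. continuous_on S f \<and> (\<exists>K. compact K \<and> K \<subseteq> S \<and> (\<forall>x\<in>S - K. f x = 0))}"

definition radon_measure_on :: "'a::topological_space set \<Rightarrow> 'a measure \<Rightarrow> bool" where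
  "radon_measure_on S l \<longleftrightarrow>
     sets l = sets (restrict_space borel S) \<and>
     (\<forall>K. compact K \<and> K \<subseteq> S \<longrightarrow> emeasure l K < \<infinity>) \<and>
     (\<forall>A\<in>sets l. emeasure l A = (SUP K\<in>{K. compact K \<and> K \<subseteq> A}. emeasure l K))"

text \<open>
  As the coloured space is closed in \<open>(real ^ 'd) \<times> nat\<close>, closures (hence relative compactness) may be
  computed in the ambient type.
\<close>

definition point_measures :: "nat \<Rightarrow> ((real ^ 'd) \<times> nat) measure set" where
  "point_measures m =
     {l. radon_measure_on (coloured_space m) l \<and>
         (\<forall>A\<in>sets l. compact (closure A) \<longrightarrow> (\<exists>k::nat. emeasure l A = of_nat k))}"

text \<open>The initial topology with respect to the maps \<open>l \<mapsto> l(f)\<close>.\<close>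

definition vague_topology :: "nat \<Rightarrow> ((real ^ 'd) \<times> nat) measure topology" where
  "vague_topology m = topology_generated_by
     {{l \<in> point_measures m. integral\<^sup>L l f \<in> U} | f U. f \<in> Cc (coloured_space m) \<and> open U}"

definition borel_of_topology :: "'a topology \<Rightarrow> 'a measure" where
  "borel_of_topology T = sigma (topspace T) {U. openin T U}"

definition shift :: "real ^ 'd \<Rightarrow> ((real ^ 'd) \<times> nat) measure \<Rightarrow> ((real ^ 'd) \<times> nat) measure" where
  "shift t l = distr l l (\<lambda>(x, i). (t + x, i))"

definition cube :: "real \<Rightarrow> (real ^ 'd) set" where
  "cube R = {x. \<forall>j. \<bar>x $ j\<bar> < R / 2}"

definition separated_point_measures :: "nat \<Rightarrow> real \<Rightarrow> ((real ^ 'd) \<times> nat) measure set" where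
  "separated_point_measures m r =
     {l \<in> point_measures m. \<forall>a. emeasure l ((+) a ` cube r \<times> {1..m}) \<le> 1}"

section \<open>Point processes\<close>

definition support_of :: "'a topology \<Rightarrow> 'a measure \<Rightarrow> 'a set" where
  "support_of T M = {x \<in> topspace T. \<forall>U. openin T U \<and> x \<in> U \<longrightarrow> emeasure M U > 0}"

definition process_support ::
    "nat \<Rightarrow> ((real ^ 'd) \<times> nat) measure measure \<Rightarrow> ((real ^ 'd) \<times> nat) measure set" where
  "process_support m \<mu> = support_of (vague_topology m) \<mu>"

definition on_support ::
    "nat \<Rightarrow> ((real ^ 'd) \<times> nat) measure measure \<Rightarrow> ((real ^ 'd) \<times> nat) measure measure" where
  "on_support m \<mu> = restrict_space \<mu> (process_support m \<mu>)"

definition ud_ergodic_point_process :: "nat \<Rightarrow> ((real ^ 'd) \<times> nat) measure measure \<Rightarrow> bool" where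
  "ud_ergodic_point_process m \<mu> \<longleftrightarrow>
     prob_space \<mu> \<and>
     sets \<mu> = sets (borel_of_topology (vague_topology m)) \<and>
     (\<forall>t. distr \<mu> \<mu> (shift t) = \<mu>) \<and>
     (\<forall>D\<in>sets \<mu>. (\<forall>t. shift t -` D \<inter> space \<mu> = D) \<longrightarrow> measure \<mu> D = 0 \<or> measure \<mu> D = 1) \<and>
     (\<exists>r>0. closedin (vague_topology m) (process_support m \<mu>) \<and>
            process_support m \<mu> \<subseteq> separated_point_measures m r)"

definition colour_part :: "nat \<Rightarrow> ((real ^ 'd) \<times> nat) measure \<Rightarrow> (real ^ 'd) measure" where
  "colour_part i l = distr (restrict_space l (UNIV \<times> {i})) borel fst"

definition positive_intensities :: "nat \<Rightarrow> ((real ^ 'd) \<times> nat) measure measure \<Rightarrow> bool" where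
  "positive_intensities m \<mu> \<longleftrightarrow>
     (\<forall>i\<in>{1..m}. \<exists>I::real. I > 0 \<and>
        (\<forall>A\<in>sets borel. (\<integral>\<^sup>+l. emeasure (colour_part i l) A \<partial>on_support m \<mu>)
                         = ennreal I * emeasure lborel A))"

section \<open>Weights, Palm measure and first moment\<close>

text \<open>
  \<open>\<lambda>\<^sup>w\<close> is a signed measure, in general unbounded. It is given by its values on bounded Borel sets and
  by the corresponding integral.
\<close>

definition weighted_measure ::
    "nat \<Rightarrow> (nat \<Rightarrow> real) \<Rightarrow> ((real ^ 'd) \<times> nat) measure \<Rightarrow> (real ^ 'd) set \<Rightarrow> real" where
  "weighted_measure m w l A = (\<Sum>i=1..m. w i * measure (colour_part i l) A)"

definition N_fun ::
    "nat \<Rightarrow> (nat \<Rightarrow> real) \<Rightarrow> (real ^ 'd \<Rightarrow> complex) \<Rightarrow> ((real ^ 'd) \<times> nat) measure \<Rightarrow> complex" where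
  "N_fun m w f l = (\<Sum>i=1..m. of_real (w i) * integral\<^sup>L (colour_part i l) f)"

text \<open>The sum over \<open>B\<close> has only finitely many nonzero terms if \<open>B\<close> is bounded.\<close>

definition palm ::
    "nat \<Rightarrow> ((real ^ 'd) \<times> nat) measure measure \<Rightarrow> (nat \<Rightarrow> real) \<Rightarrow> (real ^ 'd) set \<Rightarrow>
     ((real ^ 'd) \<times> nat) measure set \<Rightarrow> real" where
  "palm m \<mu> w B D =
     1 / measure lborel B *
     (\<integral>l. (\<Sum>\<^sub>\<infinity>x\<in>B. weighted_measure m w l {x} * indicator D (shift (- x) l)) \<partial>on_support m \<mu>)"

text \<open>
  Integration against a finite signed measure \<open>s\<close> on the \<open>\<sigma>\<close>-algebra of \<open>M\<close>, by means of the Jordan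
  decomposition; the numbers \<open>s B < 0\<close> are truncated to \<open>0\<close> by \<open>ennreal\<close>, and \<open>B = {}\<close> always
  contributes the value \<open>0\<close>.
\<close>

definition positive_variation :: "'a measure \<Rightarrow> ('a set \<Rightarrow> real) \<Rightarrow> 'a measure" where
  "positive_variation M s =
     measure_of (space M) (sets M) (\<lambda>A. SUP B\<in>{B \<in> sets M. B \<subseteq> A}. ennreal (s B))"

definition signed_integral :: "'a measure \<Rightarrow> ('a set \<Rightarrow> real) \<Rightarrow> ('a \<Rightarrow> complex) \<Rightarrow> complex" where
  "signed_integral M s F =
     integral\<^sup>L (positive_variation M s) F - integral\<^sup>L (positive_variation M (\<lambda>A. - s A)) F"

text \<open>
  The first moment as a linear functional \<open>f \<mapsto> \<mu>\<^sub>1(f)\<close>. The formula describes the integral of \<open>f\<close> against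
  the first moment measure for compactly supported continuous \<open>f\<close> as well as (by dominated
  convergence) for rapidly decreasing \<open>f\<close>. The Palm measure does not depend on the averaging set;
  the unit cube is used.
\<close>

definition first_moment ::
    "nat \<Rightarrow> ((real ^ 'd) \<times> nat) measure measure \<Rightarrow> (nat \<Rightarrow> real) \<Rightarrow> (real ^ 'd \<Rightarrow> complex) \<Rightarrow> complex" where
  "first_moment m \<mu> w f = signed_integral (on_support m \<mu>) (palm m \<mu> w (cube 1)) (N_fun m w f)"

section \<open>Rapidly decreasing functions and the Fourier transform\<close>

definition partial_deriv :: "'d::finite \<Rightarrow> (real ^ 'd \<Rightarrow> complex) \<Rightarrow> real ^ 'd \<Rightarrow> complex" where
  "partial_deriv j f x = frechet_derivative f (at x) (axis j 1)"

definition iter_partial_deriv ::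
    "'d::finite list \<Rightarrow> (real ^ 'd \<Rightarrow> complex) \<Rightarrow> real ^ 'd \<Rightarrow> complex" where
  "iter_partial_deriv js f = foldr partial_deriv js f"

definition schwartz :: "(real ^ 'd \<Rightarrow> complex) set" where
  "schwartz = {f. \<forall>js.
     (\<forall>x. iter_partial_deriv js f differentiable (at x)) \<and>
     (\<forall>k::nat. \<exists>C. \<forall>x. norm x ^ k * norm (iter_partial_deriv js f x) \<le> C)}"

definition fourier :: "(real ^ 'd \<Rightarrow> complex) \<Rightarrow> real ^ 'd \<Rightarrow> complex" where
  "fourier f y = (\<integral>x. exp (- 2 * of_real pi * \<i> * of_real (x \<bullet> y)) * f x \<partial>lborel)"

definition translation_bounded :: "(real ^ 'd) measure \<Rightarrow> bool" where
  "translation_bounded \<nu> \<longleftrightarrow> (\<forall>K. compact K \<longrightarrow> (SUP a. emeasure \<nu> ((+) a ` K)) < \<infinity>)"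

text \<open>
  \<open>\<nu>\<close> is the Fourier transform of the weighted first moment, in the sense of tempered distributions.
\<close>

definition diffraction_measure ::
    "nat \<Rightarrow> ((real ^ 'd) \<times> nat) measure measure \<Rightarrow> (nat \<Rightarrow> real) \<Rightarrow> (real ^ 'd) measure \<Rightarrow> bool" where
  "diffraction_measure m \<mu> w \<nu> \<longleftrightarrow>
     sets \<nu> = sets borel \<and> translation_bounded \<nu> \<and>
     (\<forall>f\<in>schwartz. integral\<^sup>L \<nu> f = first_moment m \<mu> w (fourier f))"

section \<open>Square integrable functions\<close>

text \<open>Elements of \<open>L\<^sup>2\<close> are represented by functions; equality in \<open>L\<^sup>2\<close> is equality almost everywhere.\<close>

definition L2 :: "'a measure \<Rightarrow> ('a \<Rightarrow> complex) set" where
  "L2 M = {f \<in> borel_measurable M. integrable M (\<lambda>x. (norm (f x))\<^sup>2)}"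

definition L2_norm :: "'a measure \<Rightarrow> ('a \<Rightarrow> complex) \<Rightarrow> real" where
  "L2_norm M f = sqrt (\<integral>x. (norm (f x))\<^sup>2 \<partial>M)"

definition L2_dense :: "'a measure \<Rightarrow> ('a \<Rightarrow> complex) set \<Rightarrow> bool" where
  "L2_dense M A \<longleftrightarrow>
     A \<subseteq> L2 M \<and> (\<forall>h\<in>L2 M. \<forall>e>0. \<exists>a\<in>A. L2_norm M (\<lambda>x. h x - a x) < e)"

text \<open>
  Linear isometries between \<open>L\<^sup>2\<close> spaces. Compatibility with equality almost everywhere follows from
  linearity and the preservation of norms.
\<close>

definition L2_isometric_embedding ::
    "'a measure \<Rightarrow> 'b measure \<Rightarrow> (('a \<Rightarrow> complex) \<Rightarrow> ('b \<Rightarrow> complex)) \<Rightarrow> bool" where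
  "L2_isometric_embedding M N T \<longleftrightarrow>
     (\<forall>f\<in>L2 M. T f \<in> L2 N \<and> L2_norm N (T f) = L2_norm M f) \<and>
     (\<forall>f\<in>L2 M. \<forall>g\<in>L2 M. AE y in N. T (\<lambda>x. f x + g x) y = T f y + T g y) \<and>
     (\<forall>c. \<forall>f\<in>L2 M. AE y in N. T (\<lambda>x. c * f x) y = c * T f y)"

definition diffraction_embedding ::
    "nat \<Rightarrow> ((real ^ 'd) \<times> nat) measure measure \<Rightarrow> (nat \<Rightarrow> real) \<Rightarrow> (real ^ 'd) measure \<Rightarrow>
     ((real ^ 'd \<Rightarrow> complex) \<Rightarrow> ((real ^ 'd) \<times> nat) measure \<Rightarrow> complex) \<Rightarrow> bool" where
  "diffraction_embedding m \<mu> w \<nu> \<theta> \<longleftrightarrow>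
     L2_isometric_embedding \<nu> (on_support m \<mu>) \<theta> \<and>
     (\<forall>f\<in>schwartz. AE l in on_support m \<mu>. \<theta> (fourier f) l = N_fun m w f l)"

inductive_set generated_algebra :: "('a \<Rightarrow> complex) set \<Rightarrow> ('a \<Rightarrow> complex) set"
  for G :: "('a \<Rightarrow> complex) set" where
  gen: "g \<in> G \<Longrightarrow> g \<in> generated_algebra G"
| add: "\<lbrakk>f \<in> generated_algebra G; g \<in> generated_algebra G\<rbrakk> \<Longrightarrow> (\<lambda>x. f x + g x) \<in> generated_algebra G"
| scale: "f \<in> generated_algebra G \<Longrightarrow> (\<lambda>x. c * f x) \<in> generated_algebra G"
| mult: "\<lbrakk>f \<in> generated_algebra G; g \<in> generated_algebra G\<rbrakk> \<Longrightarrow> (\<lambda>x. f x * g x) \<in> generated_algebra G"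

end

(*
  Everything reduces to the linear functionals N_f, f Schwartz: up to null sets they are the generators
  theta(g), because the Fourier transform maps the Schwartz space onto itself (surjectivity gives that each
  theta(g) is essentially bounded, so that the L2-closure of the algebra is stable under multiplication by
  its bounded elements).  On configurations with at most one point per small cell, N_f obeys dominated
  convergence in f, so the closure contains N_f for f the indicator of a small half-open cell.  This
  function only takes the values 0, w_1, ..., w_m, which are distinct; Lagrange interpolation therefore puts
  the indicator of the event "the cell contains a point of colour i" into the closure.  The sets whose
  indicator lies in the closure form a sigma-algebra.  Since the vague topology on uniformly discrete
  configurations is generated by the occupation patterns of finer and finer finite families of cells, every
  open set is a countable union of such patterns, and all indicators of Borel sets lie in the closure.
*)

theory Submission
  imports Defs
begin

section \<open>Square-mean closure of an algebra of functions\<close>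

text \<open>An L2 limit of products need not be the product of the L2 limits, and the generators
  \<open>\<theta> g\<close> are known only up to null sets, so arguments in the supremum norm do not
  apply directly. Hence essential boundedness is tracked throughout, and every product formed in the
  closure has a bounded factor. Indicators of half-open cells are far from Schwartz functions and
  are reached by two successive pointwise limits: exponentials of negated sums of even powers tend
  to indicators of open cubes, and open cubes with a moving lower corner shrink to a half-open cell.
  Both limits keep a bound \<open>(1 + norm x) ^ (CARD('d) + 2) * norm (f x) \<le> D\<close> with a
  fixed \<open>D\<close>. Two powers beyond the volume growth make this summable against any
  configuration, with a constant depending only on \<open>r\<close> and the dimension. Cells are
  half-open because they then tile the space: every point of a configuration lies in exactly one
  cell, and no boundary has to be treated as an exception. Fourier inversion enters only up to a
  nonzero factor.\<close>

definition sqdist :: "'a measure \<Rightarrow> ('a \<Rightarrow> complex) \<Rightarrow> ('a \<Rightarrow> complex) \<Rightarrow> ennreal" where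
  "sqdist M f g = (\<integral>\<^sup>+x. ennreal ((norm (f x - g x))\<^sup>2) \<partial>M)"

lemma twice_add_less_ennreal:
  assumes "x < ennreal a" "y < ennreal b"
  shows "2 * x + 2 * y < ennreal (2 * a + 2 * b)"
proof -
  have "a > 0" "b > 0" using assms not_less_zero by (metis ennreal_neg linorder_not_le)+
  then show ?thesis
    using assms by (cases x; cases y)
      (auto simp: ennreal_less_iff simp flip: ennreal_plus ennreal_numeral ennreal_mult)
qed

text \<open>From (a + b)^2 <= 2 a^2 + 2 b^2. Squared distances in \<open>ennreal\<close> cost the
  factors 2 but free the closure arguments from integrability side conditions.\<close>

lemma sqdist_triangle:
  assumes [measurable]: "f \<in> borel_measurable M" "g \<in> borel_measurable M" "h \<in> borel_measurable M"
  shows "sqdist M f h \<le> 2 * sqdist M f g + 2 * sqdist M g h"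
proof -
  have "(norm (f x - h x))\<^sup>2 \<le> 2 * (norm (f x - g x))\<^sup>2 + 2 * (norm (g x - h x))\<^sup>2" for x
  proof -
    have "norm (f x - h x) \<le> norm (f x - g x) + norm (g x - h x)"
      using norm_triangle_ineq[of "f x - g x" "g x - h x"] by simp
    then have "(norm (f x - h x))\<^sup>2 \<le> (norm (f x - g x) + norm (g x - h x))\<^sup>2"
      by (simp add: power_mono)
    also have "\<dots> \<le> 2 * (norm (f x - g x))\<^sup>2 + 2 * (norm (g x - h x))\<^sup>2"
      using sum_squares_bound[of "norm (f x - g x)" "norm (g x - h x)"]
      by (simp add: power2_sum)
    finally show ?thesis .
  qed
  then have "sqdist M f h \<le> (\<integral>\<^sup>+x. ennreal (2 * (norm (f x - g x))\<^sup>2 + 2 * (norm (g x - h x))\<^sup>2) \<partial>M)"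
    unfolding sqdist_def by (intro nn_integral_mono ennreal_leI)
  also have "\<dots> = 2 * sqdist M f g + 2 * sqdist M g h"
    unfolding sqdist_def
    by (simp add: nn_integral_add nn_integral_cmult ennreal_mult')
  finally show ?thesis .
qed

lemma sqdist_mult_le:
  assumes "AE x in M. norm (b x) \<le> B" and [measurable]: "f \<in> borel_measurable M" "g \<in> borel_measurable M"
    "b \<in> borel_measurable M"
  shows "sqdist M (\<lambda>x. f x * b x) (\<lambda>x. g x * b x) \<le> ennreal (B\<^sup>2) * sqdist M f g"
proof -
  have "sqdist M (\<lambda>x. f x * b x) (\<lambda>x. g x * b x) \<le> (\<integral>\<^sup>+x. ennreal (B\<^sup>2) * ennreal ((norm (f x - g x))\<^sup>2) \<partial>M)"
    unfolding sqdist_def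
  proof (rule nn_integral_mono_AE)
    show "AE x in M. ennreal ((norm (f x * b x - g x * b x))\<^sup>2) \<le> ennreal (B\<^sup>2) * ennreal ((norm (f x - g x))\<^sup>2)"
      using assms(1)
    proof eventually_elim
      case (elim x)
      have "(norm (f x * b x - g x * b x))\<^sup>2 = (norm (b x))\<^sup>2 * (norm (f x - g x))\<^sup>2"
        by (metis left_diff_distrib mult.commute norm_mult power_mult_distrib)
      also have "\<dots> \<le> B\<^sup>2 * (norm (f x - g x))\<^sup>2"
        using elim by (intro mult_right_mono power_mono) auto
      finally show ?case by (simp add: ennreal_mult'[symmetric] ennreal_leI)
    qed
  qed
  also have "\<dots> = ennreal (B\<^sup>2) * sqdist M f g"
    unfolding sqdist_def by (simp add: nn_integral_cmult)
  finally show ?thesis .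
qed

text \<open>Members are only required to be measurable: over a finite measure and an essentially
  bounded \<open>A\<close>, closeness to \<open>A\<close> already forces square
  integrability.\<close>

definition sq_closure :: "'a measure \<Rightarrow> ('a \<Rightarrow> complex) set \<Rightarrow> ('a \<Rightarrow> complex) set" where
  "sq_closure M A = {f \<in> borel_measurable M. \<forall>e>0. \<exists>a\<in>A. sqdist M f a < ennreal e}"

text \<open>Boundedness is only almost everywhere, because an isometric embedding into L2 determines
  its values merely up to null sets. It makes multiplication by a member of \<open>A\<close>
  continuous for \<open>sqdist\<close>.\<close>

locale function_algebra = finite_measure M for M :: "'a measure" +
  fixes A :: "('a \<Rightarrow> complex) set"
  assumes add: "f \<in> A \<Longrightarrow> g \<in> A \<Longrightarrow> (\<lambda>x. f x + g x) \<in> A"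
    and scale: "f \<in> A \<Longrightarrow> (\<lambda>x. c * f x) \<in> A"
    and mult: "f \<in> A \<Longrightarrow> g \<in> A \<Longrightarrow> (\<lambda>x. f x * g x) \<in> A"
    and one: "(\<lambda>_. 1) \<in> A"
    and meas: "f \<in> A \<Longrightarrow> f \<in> borel_measurable M"
    and ess_bounded: "f \<in> A \<Longrightarrow> \<exists>B. AE x in M. norm (f x) \<le> B"
begin

lemma closure_meas: "f \<in> sq_closure M A \<Longrightarrow> f \<in> borel_measurable M"
  by (simp add: sq_closure_def)

lemma closure_closed:
  assumes f: "f \<in> borel_measurable M"
    and "\<And>e. e > 0 \<Longrightarrow> \<exists>g\<in>sq_closure M A. sqdist M f g < ennreal e"
  shows "f \<in> sq_closure M A"
proof -
  have "\<exists>a\<in>A. sqdist M f a < ennreal e" if e: "e > 0" for e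
  proof -
    \<comment> \<open>\<open>e / 4\<close>, since \<open>sqdist_triangle\<close> doubles each of the
      two errors.\<close>
    obtain g where g: "g \<in> sq_closure M A" "sqdist M f g < ennreal (e / 4)"
      using assms(2)[of "e / 4"] e by auto
    then obtain a where a: "a \<in> A" "sqdist M g a < ennreal (e / 4)"
      using e by (auto simp: sq_closure_def dest!: spec[of _ "e / 4"])
    have "sqdist M f a \<le> 2 * sqdist M f g + 2 * sqdist M g a"
      using f g a meas closure_meas by (intro sqdist_triangle) auto
    also have "\<dots> < ennreal (2 * (e / 4) + 2 * (e / 4))"
      using g(2) a(2) by (rule twice_add_less_ennreal)
    finally show ?thesis using a e by auto
  qed
  then show ?thesis using f by (simp add: sq_closure_def)
qed

lemma closure_limit:
  assumes "f \<in> borel_measurable M" "\<And>n. F n \<in> sq_closure M A" "(\<lambda>n. sqdist M f (F n)) \<longlonglongrightarrow> 0"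
  shows "f \<in> sq_closure M A"
proof (rule closure_closed[OF assms(1)])
  fix e :: real assume "e > 0"
  then have "eventually (\<lambda>n. sqdist M f (F n) < ennreal e) sequentially"
    using order_tendstoD(2)[OF assms(3), of "ennreal e"] by simp
  then show "\<exists>g\<in>sq_closure M A. sqdist M f g < ennreal e"
    using assms(2) eventually_happens'[OF sequentially_bot] by fastforce
qed

text \<open>Bounded convergence: over a finite measure the constant \<open>(2 * B)\<^sup>2\<close>
  is an integrable majorant. With a constant sequence it also says that, for bounded functions,
  membership depends only on the values on \<open>space M\<close>.\<close>

lemma closure_bounded_limit:
  assumes F: "\<And>n. F n \<in> sq_closure M A" and lim: "\<And>x. x \<in> space M \<Longrightarrow> (\<lambda>n. F n x) \<longlonglongrightarrow> f x"
    and bd: "\<And>n x. x \<in> space M \<Longrightarrow> norm (F n x) \<le> B"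
  shows "f \<in> sq_closure M A"
proof -
  have Fm[measurable]: "F n \<in> borel_measurable M" for n using F closure_meas by auto
  have fm[measurable]: "f \<in> borel_measurable M"
    using lim by (rule borel_measurable_LIMSEQ_metric[OF Fm])
  have fb: "norm (f x) \<le> B" if "x \<in> space M" for x
    using lim[OF that] bd[OF that] by (metis LIMSEQ_le_const2 tendsto_norm)
  have "(\<lambda>n. sqdist M f (F n)) \<longlonglongrightarrow> (\<integral>\<^sup>+x. 0 \<partial>M)"
    unfolding sqdist_def
  proof (rule nn_integral_dominated_convergence[where w = "\<lambda>_. ennreal ((2 * B)\<^sup>2)"])
    show "AE x in M. ennreal ((norm (f x - F n x))\<^sup>2) \<le> ennreal ((2 * B)\<^sup>2)" for n
    proof (rule AE_I2)
      fix x assume "x \<in> space M"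
      then have "norm (f x - F n x) \<le> 2 * B"
        using norm_triangle_ineq4[of "f x" "F n x"] fb[of x] bd[of x n] by linarith
      then show "ennreal ((norm (f x - F n x))\<^sup>2) \<le> ennreal ((2 * B)\<^sup>2)"
        by (intro ennreal_leI power_mono) auto
    qed
    show "AE x in M. (\<lambda>n. ennreal ((norm (f x - F n x))\<^sup>2)) \<longlonglongrightarrow> 0"
    proof (rule AE_I2)
      fix x assume "x \<in> space M"
      then have "(\<lambda>n. (norm (f x - F n x))\<^sup>2) \<longlonglongrightarrow> (norm (f x - f x))\<^sup>2"
        by (intro tendsto_intros lim)
      then show "(\<lambda>n. ennreal ((norm (f x - F n x))\<^sup>2)) \<longlonglongrightarrow> 0"
        using tendsto_ennrealI by fastforce
    qed
    show "(\<integral>\<^sup>+ x. ennreal ((2 * B)\<^sup>2) \<partial>M) < \<infinity>"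
      by (simp add: ennreal_mult_eq_top_iff less_top[symmetric])
  qed measurable
  then show ?thesis using F fm by (intro closure_limit[of f F]) auto
qed

lemma closure_incl: "a \<in> A \<Longrightarrow> a \<in> sq_closure M A"
  using meas by (auto simp: sq_closure_def sqdist_def intro!: bexI[of _ a])

lemma closure_AE_eq:
  assumes "f \<in> borel_measurable M" "a \<in> A" "AE x in M. a x = f x"
  shows "f \<in> sq_closure M A"
proof -
  have "sqdist M f a = (\<integral>\<^sup>+x. 0 \<partial>M)"
    unfolding sqdist_def using assms(3) by (intro nn_integral_cong_AE) auto
  then show ?thesis using assms by (auto simp: sq_closure_def intro!: bexI[of _ a])
qed

lemma mult_alg_closure:
  assumes f: "f \<in> sq_closure M A" and b: "b \<in> A"
  shows "(\<lambda>x. f x * b x) \<in> sq_closure M A"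
proof (rule closure_closed)
  have fm[measurable]: "f \<in> borel_measurable M" using f closure_meas by auto
  have bm[measurable]: "b \<in> borel_measurable M" using b meas by auto
  show "(\<lambda>x. f x * b x) \<in> borel_measurable M" by measurable
  fix e :: real assume e: "e > 0"
  obtain B' where B': "AE x in M. norm (b x) \<le> B'" using ess_bounded[OF b] by auto
  \<comment> \<open>The maximum makes the bound positive, so that the tolerance can be divided by
    its square.\<close>
  define B where "B = max B' 1"
  have B: "B > 0" "AE x in M. norm (b x) \<le> B" using B' by (auto simp: B_def)
  have "e / B\<^sup>2 > 0" using e B by simp
  then obtain a where a: "a \<in> A" "sqdist M f a < ennreal (e / B\<^sup>2)" using f unfolding sq_closure_def by blast
  have "sqdist M (\<lambda>x. f x * b x) (\<lambda>x. a x * b x) \<le> ennreal (B\<^sup>2) * sqdist M f a"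
    using a meas B by (intro sqdist_mult_le) auto
  also have "\<dots> < ennreal (B\<^sup>2) * ennreal (e / B\<^sup>2)"
    using a(2) B by (intro ennreal_mult_strict_left_mono) auto
  also have "\<dots> = ennreal e"
    using B e by (simp flip: ennreal_mult')
  finally show "\<exists>g\<in>sq_closure M A. sqdist M (\<lambda>x. f x * b x) g < ennreal e"
    using closure_incl[OF mult[OF a(1) b]] by blast
qed

text \<open>One bounded factor is enough: approximate \<open>f\<close> by \<open>a\<close> in
  \<open>A\<close>; then the product of \<open>a\<close> and \<open>g\<close> lies in the closure by
  \<open>mult_alg_closure\<close> with the roles exchanged, and the bound of \<open>g\<close>
  controls the error.\<close>

lemma mult_closure:
  assumes f: "f \<in> sq_closure M A" and g: "g \<in> sq_closure M A"
    and gb: "\<And>x. x \<in> space M \<Longrightarrow> norm (g x) \<le> B"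
  shows "(\<lambda>x. f x * g x) \<in> sq_closure M A"
proof (rule closure_closed)
  have fm[measurable]: "f \<in> borel_measurable M" and gm[measurable]: "g \<in> borel_measurable M"
    using f g closure_meas by auto
  show "(\<lambda>x. f x * g x) \<in> borel_measurable M" by measurable
  fix e :: real assume e: "e > 0"
  define B' where "B' = max B 1"
  have B': "B' > 0" "AE x in M. norm (g x) \<le> B'" using gb by (auto simp: B'_def le_max_iff_disj)
  have "e / B'\<^sup>2 > 0" using e B' by simp
  then obtain a where a: "a \<in> A" "sqdist M f a < ennreal (e / B'\<^sup>2)" using f unfolding sq_closure_def by blast
  have "sqdist M (\<lambda>x. f x * g x) (\<lambda>x. a x * g x) \<le> ennreal (B'\<^sup>2) * sqdist M f a"
    using a meas B' by (intro sqdist_mult_le) auto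
  also have "\<dots> < ennreal (B'\<^sup>2) * ennreal (e / B'\<^sup>2)"
    using a(2) B' by (intro ennreal_mult_strict_left_mono) auto
  also have "\<dots> = ennreal e"
    using B' e by (simp flip: ennreal_mult')
  finally show "\<exists>h\<in>sq_closure M A. sqdist M (\<lambda>x. f x * g x) h < ennreal e"
    using mult_alg_closure[OF g a(1)] by (auto simp: mult.commute intro!: bexI[of _ "\<lambda>x. a x * g x"])
qed

lemma one_closure: "(\<lambda>_. 1) \<in> sq_closure M A"
  using one closure_incl by auto

lemma scale_closure: "f \<in> sq_closure M A \<Longrightarrow> (\<lambda>x. c * f x) \<in> sq_closure M A"
  using mult_alg_closure[OF _ scale[OF one, of c]] by (simp add: mult.commute)

lemma add_closure:
  assumes f: "f \<in> sq_closure M A" and g: "g \<in> sq_closure M A"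
  shows "(\<lambda>x. f x + g x) \<in> sq_closure M A"
proof (rule closure_closed)
  have [measurable]: "f \<in> borel_measurable M" "g \<in> borel_measurable M"
    using f g closure_meas by auto
  show "(\<lambda>x. f x + g x) \<in> borel_measurable M" by measurable
  fix e :: real assume e: "e > 0"
  obtain a where a: "a \<in> A" "sqdist M f a < ennreal (e / 4)"
    using f e by (auto simp: sq_closure_def dest!: spec[of _ "e / 4"])
  obtain b where b: "b \<in> A" "sqdist M g b < ennreal (e / 4)"
    using g e by (auto simp: sq_closure_def dest!: spec[of _ "e / 4"])
  have [measurable]: "a \<in> borel_measurable M" "b \<in> borel_measurable M" using a b meas by auto
  have "sqdist M (\<lambda>x. f x + g x) (\<lambda>x. a x + b x)
      \<le> 2 * sqdist M (\<lambda>x. f x + g x) (\<lambda>x. a x + g x) + 2 * sqdist M (\<lambda>x. a x + g x) (\<lambda>x. a x + b x)"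
    by (intro sqdist_triangle) auto
  also have "\<dots> = 2 * sqdist M f a + 2 * sqdist M g b"
    by (simp add: sqdist_def)
  also have "\<dots> < ennreal (2 * (e / 4) + 2 * (e / 4))"
    using a(2) b(2) by (rule twice_add_less_ennreal)
  finally show "\<exists>h\<in>sq_closure M A. sqdist M (\<lambda>x. f x + g x) h < ennreal e"
    using closure_incl[OF add[OF a(1) b(1)]] by (auto intro!: bexI[of _ "\<lambda>x. a x + b x"])
qed

lemma sum_closure:
  "finite I \<Longrightarrow> (\<And>i. i \<in> I \<Longrightarrow> f i \<in> sq_closure M A) \<Longrightarrow> (\<lambda>x. \<Sum>i\<in>I. f i x) \<in> sq_closure M A"
proof (induction rule: finite_induct)
  case empty
  then show ?case using scale_closure[OF one_closure, of 0] by simp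
next
  case (insert i I)
  then show ?case using add_closure[of "f i" "\<lambda>x. \<Sum>i\<in>I. f i x"] by simp
qed

lemma prod_closure:
  "finite I \<Longrightarrow> (\<And>i. i \<in> I \<Longrightarrow> f i \<in> sq_closure M A) \<Longrightarrow>
   (\<And>i x. i \<in> I \<Longrightarrow> x \<in> space M \<Longrightarrow> norm (f i x) \<le> B i) \<Longrightarrow>
   (\<lambda>x. \<Prod>i\<in>I. f i x) \<in> sq_closure M A"
proof (induction rule: finite_induct)
  case empty
  then show ?case using one_closure by simp
next
  case (insert i I)
  then have "(\<lambda>x. (\<Prod>i\<in>I. f i x) * f i x) \<in> sq_closure M A"
    by (intro mult_closure[where B = "B i"]) auto
  then show ?case using insert by (simp add: mult.commute)
qed

section \<open>From the closure of functions to a sigma-algebra of sets\<close>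

definition approximable_sets :: "'a set set" where
  "approximable_sets = {D \<in> sets M. indicator D \<in> sq_closure M A}"

lemma approximable_Int:
  assumes "D \<in> approximable_sets" "E \<in> approximable_sets"
  shows "D \<inter> E \<in> approximable_sets"
proof -
  have "(\<lambda>x. indicator D x * indicator E x) \<in> sq_closure M A"
    using assms by (intro mult_closure[where B = 1]) (auto simp: approximable_sets_def split: split_indicator)
  then show ?thesis using assms
    by (auto simp: approximable_sets_def indicator_inter_arith[abs_def])
qed

lemma approximable_compl:
  assumes "D \<in> approximable_sets"
  shows "space M - D \<in> approximable_sets"
proof -
  \<comment> \<open>Off \<open>space M\<close> this function is 1, whereas the indicator of the
    complement is 0 there; the constant-sequence limit below bridges the difference.\<close>
  have f: "(\<lambda>x. 1 + (-1) * indicator D x) \<in> sq_closure M A"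
    using assms by (intro add_closure one_closure scale_closure) (auto simp: approximable_sets_def)
  have "(\<lambda>x. indicator (space M - D) x :: complex) \<in> sq_closure M A"
    by (rule closure_bounded_limit[where B = 1 and F = "\<lambda>_ x. 1 + (-1) * indicator D x"])
      (use f in \<open>auto simp: indicator_def\<close>)
  then show ?thesis using assms by (auto simp: approximable_sets_def)
qed

lemma approximable_INT:
  fixes D :: "nat \<Rightarrow> 'a set"
  assumes "\<And>n. D n \<in> approximable_sets"
  shows "(\<Inter>n. D n) \<in> approximable_sets"
proof -
  have fin: "(\<Inter>i\<le>n. D i) \<in> approximable_sets" for n
  proof (induction n)
    case (Suc n)
    then show ?case using approximable_Int[OF Suc assms[of "Suc n"]] by (simp add: atMost_Suc Int_commute)
  qed (use assms in simp)
  have "(\<lambda>x. indicator (\<Inter>n. D n) x :: complex) \<in> sq_closure M A"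
  proof (rule closure_bounded_limit[where B = 1 and F = "\<lambda>n. indicator (\<Inter>i\<le>n. D i)"])
    show "indicator (\<Inter>i\<le>n. D i) \<in> sq_closure M A" for n
      using fin by (simp add: approximable_sets_def)
    show "(\<lambda>n. indicator (\<Inter>i\<le>n. D i) x :: complex) \<longlonglongrightarrow> indicator (\<Inter>n. D n) x" for x
    proof (cases "x \<in> (\<Inter>n. D n)")
      case False
      then obtain k where k: "x \<notin> D k" by auto
      show ?thesis
        by (rule tendsto_eventually, rule eventually_sequentiallyI[of k]) (use k False in \<open>auto simp: indicator_def\<close>)
    qed (auto simp: indicator_def)
  qed (auto simp: indicator_def)
  then show ?thesis using assms by (auto simp: approximable_sets_def)
qed

lemma approximable_space: "space M \<in> approximable_sets"
proof -
  have "(\<lambda>x. indicator (space M) x :: complex) \<in> sq_closure M A"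
    by (rule closure_bounded_limit[where B = 1 and F = "\<lambda>_ _. 1"]) (use one_closure in auto)
  then show ?thesis by (auto simp: approximable_sets_def)
qed

text \<open>Multiplicativity of the closure gives binary intersections, so countable unions follow
  by De Morgan without passing through disjoint families.\<close>

lemma sigma_algebra_approximable: "sigma_algebra (space M) approximable_sets"
  unfolding sigma_algebra_iff2
proof (intro conjI ballI allI impI)
  show "approximable_sets \<subseteq> Pow (space M)"
    unfolding approximable_sets_def using sets.sets_into_space by blast
  show "{} \<in> approximable_sets" using approximable_compl[OF approximable_space] by simp
  fix D :: "nat \<Rightarrow> 'a set" assume D: "range D \<subseteq> approximable_sets"
  then have "space M - (\<Inter>n. space M - D n) \<in> approximable_sets"
    by (intro approximable_compl approximable_INT) auto
  moreover have "space M - (\<Inter>n. space M - D n) = (\<Union>n. D n)"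
    using D unfolding approximable_sets_def using sets.sets_into_space by blast
  ultimately show "(\<Union>n. D n) \<in> approximable_sets" by simp
qed (use approximable_compl in auto)

text \<open>Once the generators are approximable, all measurable indicators are; simple functions
  follow by linearity and a general \<open>h\<close> by dominated convergence. Only at the end are
  \<open>ennreal\<close> distances traded for the real L2 norm.\<close>

lemma dense_if_generators_approximable:
  assumes gens: "sets M = sigma_sets (space M) E" "E \<subseteq> approximable_sets"
  shows "L2_dense M A"
proof -
  have all: "D \<in> approximable_sets" if "D \<in> sets M" for D
    using that sigma_algebra.sigma_sets_subset[OF sigma_algebra_approximable gens(2)] gens(1) by auto
  have AL2: "a \<in> L2 M" if a: "a \<in> A" for a
  proof -
    obtain B where B: "AE x in M. norm (a x) \<le> B" using ess_bounded[OF a] by auto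
    have [measurable]: "a \<in> borel_measurable M" using a meas by auto
    have "AE x in M. norm ((norm (a x))\<^sup>2) \<le> B\<^sup>2"
      using B by eventually_elim (auto intro!: power_mono)
    then have "integrable M (\<lambda>x. (norm (a x))\<^sup>2)"
      by (intro integrable_const_bound[where B = "B\<^sup>2"]) auto
    then show ?thesis by (simp add: L2_def)
  qed
  have simple: "s \<in> sq_closure M A" if s: "simple_function M s" for s :: "'a \<Rightarrow> complex"
  proof -
    have f: "(\<lambda>x. \<Sum>y\<in>s ` space M. y * indicator (s -` {y} \<inter> space M) x) \<in> sq_closure M A"
      using s all by (intro sum_closure scale_closure)
        (auto simp: simple_function_def approximable_sets_def)
    have eq: "(\<Sum>y\<in>s ` space M. y * indicator (s -` {y} \<inter> space M) x) = s x" if "x \<in> space M" for x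
    proof -
      have "(\<Sum>y\<in>s ` space M. y * indicator (s -` {y} \<inter> space M) x) = (\<Sum>y\<in>s ` space M. if y = s x then s x else 0)"
        using that by (intro sum.cong) (auto simp: indicator_def)
      also have "\<dots> = s x" using s that by (simp add: simple_function_def)
      finally show ?thesis .
    qed
    have fin: "finite (norm ` s ` space M)" using s by (simp add: simple_function_def)
    show ?thesis
    proof (rule closure_bounded_limit[where B = "Max (norm ` s ` space M)", OF f])
      show "norm (\<Sum>y\<in>s ` space M. y * indicator (s -` {y} \<inter> space M) x) \<le> Max (norm ` s ` space M)"
        if "x \<in> space M" for x
        unfolding eq[OF that] using that by (intro Max_ge fin) auto
    qed (simp add: eq)
  qed
  have "\<exists>a\<in>A. L2_norm M (\<lambda>x. h x - a x) < e" if h: "h \<in> L2 M" and e: "e > 0" for h e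
  proof -
    have hm[measurable]: "h \<in> borel_measurable M" and hi: "integrable M (\<lambda>x. (norm (h x))\<^sup>2)"
      using h by (auto simp: L2_def)
    \<comment> \<open>The approximants satisfy \<open>norm (s i x) \<le> 2 * norm (h x)\<close>, so
      the error is at most \<open>3 * norm (h x)\<close>, which explains the majorant below.\<close>
    obtain s where s: "\<And>i. simple_function M (s i)"
        "\<And>x. x \<in> space M \<Longrightarrow> (\<lambda>i. s i x) \<longlonglongrightarrow> h x"
        "\<And>i x. x \<in> space M \<Longrightarrow> norm (s i x) \<le> 2 * norm (h x)"
      using borel_measurable_implies_sequence_metric[OF hm, of 0] by (auto simp: dist_norm) blast
    have [measurable]: "s i \<in> borel_measurable M" for i using s(1) borel_measurable_simple_function by auto
    have "(\<lambda>n. sqdist M h (s n)) \<longlonglongrightarrow> (\<integral>\<^sup>+x. 0 \<partial>M)"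
      unfolding sqdist_def
    proof (rule nn_integral_dominated_convergence[where w = "\<lambda>x. ennreal ((3 * norm (h x))\<^sup>2)"])
      show "AE x in M. ennreal ((norm (h x - s n x))\<^sup>2) \<le> ennreal ((3 * norm (h x))\<^sup>2)" for n
      proof (rule AE_I2)
        fix x assume "x \<in> space M"
        then have "norm (h x - s n x) \<le> 3 * norm (h x)"
          using norm_triangle_ineq4[of "h x" "s n x"] s(3)[of x n] by linarith
        then show "ennreal ((norm (h x - s n x))\<^sup>2) \<le> ennreal ((3 * norm (h x))\<^sup>2)"
          by (intro ennreal_leI power_mono) auto
      qed
      show "AE x in M. (\<lambda>n. ennreal ((norm (h x - s n x))\<^sup>2)) \<longlonglongrightarrow> 0"
      proof (rule AE_I2)
        fix x assume "x \<in> space M"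
        then have "(\<lambda>n. (norm (h x - s n x))\<^sup>2) \<longlonglongrightarrow> (norm (h x - h x))\<^sup>2"
          by (intro tendsto_intros s)
        then show "(\<lambda>n. ennreal ((norm (h x - s n x))\<^sup>2)) \<longlonglongrightarrow> 0"
          using tendsto_ennrealI by fastforce
      qed
      have "(\<integral>\<^sup>+ x. ennreal ((3 * norm (h x))\<^sup>2) \<partial>M) = 9 * (\<integral>\<^sup>+ x. ennreal ((norm (h x))\<^sup>2) \<partial>M)"
        by (simp add: power_mult_distrib ennreal_mult' nn_integral_cmult)
      then show "(\<integral>\<^sup>+ x. ennreal ((3 * norm (h x))\<^sup>2) \<partial>M) < \<infinity>"
        using hi by (simp add: integrable_iff_bounded ennreal_mult_less_top)
    qed measurable
    then have "h \<in> sq_closure M A"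
      using simple[OF s(1)] by (intro closure_limit[of h s]) auto
    then obtain a where a: "a \<in> A" "sqdist M h a < ennreal (e\<^sup>2)"
      using e by (auto simp: sq_closure_def dest!: spec[of _ "e\<^sup>2"])
    have [measurable]: "a \<in> borel_measurable M" using a meas by auto
    have "integral\<^sup>L M (\<lambda>x. (norm (h x - a x))\<^sup>2) = enn2real (sqdist M h a)"
      unfolding sqdist_def by (intro integral_eq_nn_integral) auto
    also have "\<dots> < e\<^sup>2"
      using a(2) e by (cases "sqdist M h a") (auto simp: ennreal_less_iff)
    finally show ?thesis
      using a(1) e by (intro bexI[of _ a]) (auto simp: L2_norm_def intro: real_less_lsqrt)
  qed
  then show ?thesis using AL2 by (auto simp: L2_dense_def)
qed

end

section \<open>Integrability of rapidly decreasing functions\<close>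

text \<open>For \<open>s > 0\<close> the half-open cube of edge \<open>1 / s\<close> with least
  corner \<open>k / s\<close>. Through the floor function each point names the index of its cell, so
  the cells of one scale form a partition.\<close>

definition cell :: "real \<Rightarrow> ('d \<Rightarrow> int) \<Rightarrow> (real ^ 'd) set" where
  "cell s k = {x. \<forall>j. \<lfloor>s * x $ j\<rfloor> = k j}"

text \<open>For \<open>s > 0\<close> the half-open box with all coordinates in
  \<open>[- n / s, n / s)\<close>.\<close>

definition window :: "real \<Rightarrow> nat \<Rightarrow> (real ^ 'd) set" where
  "window s n = {x. \<forall>j. \<lfloor>s * x $ j\<rfloor> \<in> {- int n..<int n}}"

definition window_index :: "nat \<Rightarrow> ('d::finite \<Rightarrow> int) set" where
  "window_index n = PiE UNIV (\<lambda>_. {- int n..<int n})"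

lemma finite_window_index: "finite (window_index n :: ('d::finite \<Rightarrow> int) set)"
  unfolding window_index_def by (intro finite_PiE) auto

lemma card_window_index: "card (window_index n :: ('d::finite \<Rightarrow> int) set) = (2 * n) ^ CARD('d)"
  unfolding window_index_def by (subst card_PiE) (auto simp: nat_mult_distrib)

lemma window_eq_UN: "window s n = (\<Union>k\<in>window_index n. cell s k)"
  by (fastforce simp: window_def cell_def window_index_def PiE_def extensional_def Pi_def)

lemma cell_sets[measurable]: "cell s k \<in> sets borel"
proof -
  have "(\<lambda>x::real^'d. \<lfloor>s * x $ j\<rfloor>) \<in> borel \<rightarrow>\<^sub>M count_space UNIV" for j
    by measurable
  then show ?thesis unfolding cell_def by measurable
qed

lemma window_sets[measurable]: "window s n \<in> sets borel"
  unfolding window_eq_UN using finite_window_index by (intro sets.finite_UN) auto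

lemma window_exhausts: "\<exists>n. x \<in> window s n"
proof -
  define n where "n = nat (\<Sum>j\<in>UNIV. \<bar>\<lfloor>s * x $ j\<rfloor>\<bar>) + 1"
  have "\<lfloor>s * x $ j\<rfloor> \<in> {- int n..<int n}" for j
  proof -
    have "\<bar>\<lfloor>s * x $ j\<rfloor>\<bar> \<le> (\<Sum>j\<in>UNIV. \<bar>\<lfloor>s * x $ j\<rfloor>\<bar>)"
      by (intro member_le_sum) auto
    then show ?thesis by (auto simp: n_def)
  qed
  then show ?thesis by (auto simp: window_def)
qed

lemma norm_ge_if_not_in_window:
  assumes "x \<notin> window s n" "s > 0"
  shows "real n / s \<le> norm x"
proof -
  obtain j where j: "\<lfloor>s * x $ j\<rfloor> \<notin> {- int n..<int n}" using assms by (auto simp: window_def)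
  then have "real n \<le> \<bar>s * x $ j\<bar>"
    by (simp add: not_le floor_less_iff le_floor_iff) linarith
  also have "\<dots> \<le> s * norm x" using component_le_norm_cart[of x j] assms(2) by (simp add: abs_mult)
  finally show ?thesis using assms(2) by (simp add: field_simps)
qed

text \<open>The common hypothesis for integrating rapidly decreasing functions: Lebesgue measure and
  the diffraction measure satisfy it at scale 1, the colour parts of a separated configuration with
  \<open>B = 1\<close> at every positive scale with \<open>1 / s < r\<close>.\<close>

definition cell_bounded :: "real \<Rightarrow> real \<Rightarrow> (real ^ 'd) measure \<Rightarrow> bool" where
  "cell_bounded s B \<nu> \<longleftrightarrow> sets \<nu> = sets borel \<and> (\<forall>k. emeasure \<nu> (cell s k) \<le> ennreal B)"

lemma cell_bounded_window:
  fixes \<nu> :: "(real ^ 'd) measure"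
  assumes "cell_bounded s B \<nu>" "B \<ge> 0"
  shows "emeasure \<nu> (window s n) \<le> ennreal ((2 * real n) ^ CARD('d) * B)"
proof -
  have sets: "sets \<nu> = sets borel" using assms by (simp add: cell_bounded_def)
  have "emeasure \<nu> (window s n) \<le> (\<Sum>k\<in>window_index n. emeasure \<nu> (cell s k))"
    unfolding window_eq_UN by (intro emeasure_subadditive_finite finite_window_index) (simp add: sets image_subset_iff)
  also have "\<dots> \<le> (\<Sum>k\<in>(window_index n :: ('d \<Rightarrow> int) set). ennreal B)"
    using assms by (intro sum_mono) (simp add: cell_bounded_def)
  also have "\<dots> = ennreal ((2 * real n) ^ CARD('d) * B)"
  proof -
    have "(of_nat ((2 * n) ^ CARD('d)) :: ennreal) = ennreal ((2 * real n) ^ CARD('d))"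
      by (subst ennreal_of_nat_eq_real_of_nat) simp
    then show ?thesis using assms(2) by (simp only: sum_constant card_window_index ennreal_mult'')
  qed
  finally show ?thesis .
qed

section \<open>Polynomial decay against bounded mass on cells\<close>

definition decay_const :: "real \<Rightarrow> nat \<Rightarrow> real" where
  "decay_const s d = 2 ^ d * max 1 s ^ (d + 2) * (\<Sum>n. 1 / (real (Suc n))\<^sup>2)"

lemma summable_inverse_Suc_squares: "summable (\<lambda>n. 1 / (real (Suc n))\<^sup>2)"
  using summable_Suc_iff[of "\<lambda>n. 1 / (real n)\<^sup>2"] inverse_power_summable[of 2, where 'a = real]
  by (simp add: divide_inverse)

text \<open>Cut the space into shells between consecutive windows and write d for the dimension. On
  the shell between windows n and n + 1 the function is of order (n + 1)^-(d + 2) and the mass of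
  order (n + 1)^d, so the contributions sum like inverse squares; the remaining factors make up
  \<open>decay_const\<close>.\<close>

lemma nn_integral_decay_le:
  fixes f :: "real ^ 'd \<Rightarrow> complex" and \<nu> :: "(real ^ 'd) measure"
  assumes nu: "cell_bounded s B \<nu>" "B \<ge> 0" and s: "s > 0"
    and D: "\<And>x. (1 + norm x) ^ (CARD('d) + 2) * norm (f x) \<le> D"
  shows "(\<integral>\<^sup>+x. ennreal (norm (f x)) \<partial>\<nu>) \<le> ennreal (D * B * decay_const s CARD('d))"
proof -
  let ?d = "CARD('d)"
  define q where "q = max 1 s"
  define c where "c n = D * (q / real (Suc n)) ^ (?d + 2)" for n
  have q: "q \<ge> 1" "q \<ge> s" by (auto simp: q_def)
  have sets: "sets \<nu> = sets borel" using nu by (simp add: cell_bounded_def)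
  have D0: "D \<ge> 0" by (rule order_trans[OF _ D[of 0]]) simp
  have c0: "c n \<ge> 0" for n using q D0 by (simp add: c_def)
  have pt: "norm (f x) \<le> c n" if "x \<notin> window s n" for x n
  proof -
    \<comment> \<open>Since \<open>q \<ge> s\<close> and \<open>q \<ge> 1\<close>, the single
      divisor \<open>q\<close> serves both the summand \<open>n\<close> and the summand 1.\<close>
    have "real (Suc n) / q \<le> 1 + real n / s"
    proof -
      have "real n / q \<le> real n / s" using q s by (intro divide_left_mono) auto
      moreover have "1 / q \<le> 1" using q by simp
      ultimately show ?thesis by (simp add: add_divide_distrib)
    qed
    also have "\<dots> \<le> 1 + norm x" using norm_ge_if_not_in_window[OF that s] by simp
    finally have "(real (Suc n) / q) ^ (?d + 2) \<le> (1 + norm x) ^ (?d + 2)"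
      using q by (intro power_mono) auto
    then have "(real (Suc n) / q) ^ (?d + 2) * norm (f x) \<le> D"
      using D[of x] by (meson mult_right_mono norm_ge_zero order_trans)
    moreover have "(real (Suc n) / q) ^ (?d + 2) > 0" using q by (intro zero_less_power) auto
    ultimately have "norm (f x) \<le> D / (real (Suc n) / q) ^ (?d + 2)"
      by (metis mult.commute pos_le_divide_eq)
    also have "\<dots> = c n" unfolding c_def by (simp only: power_divide divide_divide_eq_right times_divide_eq_right)
    finally show ?thesis .
  qed
  have "ennreal (norm (f x)) \<le> (\<Sum>n. ennreal (c n) * indicator (window s (Suc n)) x)" for x
  proof -
    \<comment> \<open>A transition between consecutive windows exists because the windows exhaust
      the space and \<open>window s 0\<close> is empty.\<close>
    obtain n where n: "x \<in> window s (Suc n)" "x \<notin> window s n"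
    proof -
      obtain n0 where "x \<in> window s n0" using window_exhausts by blast
      moreover have "x \<notin> window s 0" by (auto simp: window_def)
      ultimately show ?thesis using that
        by (induction n0) auto
    qed
    have "ennreal (norm (f x)) \<le> ennreal (c n) * indicator (window s (Suc n)) x"
      using pt[OF n(2)] n(1) by (simp add: ennreal_leI)
    also have "\<dots> \<le> (\<Sum>n. ennreal (c n) * indicator (window s (Suc n)) x)"
      using sum_le_suminf[of "\<lambda>n. ennreal (c n) * indicator (window s (Suc n)) x" "{n}"]
      by (simp del: sum_mult_indicator)
    finally show ?thesis .
  qed
  then have "(\<integral>\<^sup>+x. ennreal (norm (f x)) \<partial>\<nu>) \<le> (\<integral>\<^sup>+x. (\<Sum>n. ennreal (c n) * indicator (window s (Suc n)) x) \<partial>\<nu>)"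
    by (intro nn_integral_mono) auto
  also have "\<dots> = (\<Sum>n. ennreal (c n) * emeasure \<nu> (window s (Suc n)))"
    by (subst nn_integral_suminf) (simp_all add: sets nn_integral_cmult_indicator cong: measurable_cong_sets)
  also have "\<dots> \<le> (\<Sum>n. ennreal (D * B * (2 ^ ?d * q ^ (?d + 2)) * (1 / (real (Suc n))\<^sup>2)))"
  proof (intro suminf_le)
    fix n
    have "ennreal (c n) * emeasure \<nu> (window s (Suc n)) \<le> ennreal (c n) * ennreal ((2 * real (Suc n)) ^ ?d * B)"
      by (intro mult_left_mono cell_bounded_window nu) auto
    also have "\<dots> = ennreal (c n * ((2 * real (Suc n)) ^ ?d * B))"
      using c0 by (simp add: ennreal_mult')
    also have "c n * ((2 * real (Suc n)) ^ ?d * B) = D * B * (2 ^ ?d * q ^ (?d + 2)) * (1 / (real (Suc n))\<^sup>2)"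
      by (simp add: c_def power_divide power_mult_distrib power_add power2_eq_square del: of_nat_Suc)
    finally show "ennreal (c n) * emeasure \<nu> (window s (Suc n))
        \<le> ennreal (D * B * (2 ^ ?d * q ^ (?d + 2)) * (1 / (real (Suc n))\<^sup>2))" .
  qed auto
  also have "\<dots> = ennreal (\<Sum>n. D * B * (2 ^ ?d * q ^ (?d + 2)) * (1 / (real (Suc n))\<^sup>2))"
    using D0 nu q by (intro suminf_ennreal2 summable_mult summable_inverse_Suc_squares) auto
  also have "(\<Sum>n. D * B * (2 ^ ?d * q ^ (?d + 2)) * (1 / (real (Suc n))\<^sup>2)) = D * B * decay_const s ?d"
    by (subst suminf_mult[OF summable_inverse_Suc_squares]) (simp add: decay_const_def q_def mult.assoc)
  finally show ?thesis .
qed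

section \<open>Translation bounded measures\<close>

lemma cell_subset_translate:
  assumes "s > 0"
  shows "cell s k \<subseteq> (+) (\<chi> j. of_int (k j) / s) ` {x. \<forall>j. 0 \<le> x $ j \<and> x $ j < 1 / s}"
proof
  fix x assume x: "x \<in> cell s k"
  have "0 \<le> x $ j - of_int (k j) / s \<and> x $ j - of_int (k j) / s < 1 / s" for j
  proof -
    have "\<lfloor>s * x $ j\<rfloor> = k j" using x by (simp add: cell_def)
    then have "of_int (k j) \<le> s * x $ j" "s * x $ j < of_int (k j) + 1" by linarith+
    then have "of_int (k j) / s \<le> x $ j" "x $ j < (of_int (k j) + 1) / s"
      using assms by (simp_all add: pos_divide_le_eq pos_less_divide_eq mult.commute)
    then show ?thesis by (simp add: add_divide_distrib)
  qed
  then show "x \<in> (+) (\<chi> j. of_int (k j) / s) ` {x. \<forall>j. 0 \<le> x $ j \<and> x $ j < 1 / s}"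
    by (intro image_eqI[of _ _ "x - (\<chi> j. of_int (k j) / s)"]) auto
qed

text \<open>A unit cell fits into a translate of the closed unit cube, and the masses of these
  translates have a finite supremum.\<close>

lemma cell_bounded_translation_bounded:
  fixes \<nu> :: "(real ^ 'd) measure"
  assumes "sets \<nu> = sets borel" "translation_bounded \<nu>"
  obtains B where "B \<ge> 0" "cell_bounded 1 B \<nu>"
proof -
  define K :: "(real ^ 'd) set" where "K = cbox 0 (\<chi> j. 1)"
  have "(SUP a. emeasure \<nu> ((+) a ` K)) < \<infinity>"
    using assms(2) unfolding translation_bounded_def K_def by (metis compact_cbox)
  then obtain B where B: "(SUP a. emeasure \<nu> ((+) a ` K)) = ennreal B" "B \<ge> 0"
    by (cases "SUP a. emeasure \<nu> ((+) a ` K)") auto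
  have "emeasure \<nu> (cell 1 k) \<le> ennreal B" for k
  proof -
    define a :: "real ^ 'd" where "a = (\<chi> j. of_int (k j) / 1)"
    have "cell 1 k \<subseteq> (+) a ` K"
    proof -
      have "{x. \<forall>j. 0 \<le> x $ j \<and> x $ j < 1 / 1} \<subseteq> K"
        by (auto simp: K_def mem_box_cart less_imp_le)
      then show ?thesis
        using cell_subset_translate[of 1 k] unfolding a_def by (meson image_mono order_trans zero_less_one)
    qed
    moreover have "(+) a ` K \<in> sets \<nu>"
      unfolding assms(1) K_def by (intro borel_compact compact_translation compact_cbox)
    ultimately have "emeasure \<nu> (cell 1 k) \<le> emeasure \<nu> ((+) a ` K)"
      by (intro emeasure_mono) auto
    also have "\<dots> \<le> ennreal B" unfolding B(1)[symmetric] by (intro SUP_upper) auto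
    finally show ?thesis .
  qed
  then show thesis using that[OF B(2)] assms(1) by (simp add: cell_bounded_def)
qed

lemma lborel_translation_bounded: "translation_bounded (lborel :: (real ^ 'd) measure)"
  unfolding translation_bounded_def
proof (intro allI impI)
  fix K :: "(real ^ 'd) set" assume K: "compact K"
  have "emeasure lborel ((+) a ` K) = emeasure lborel K" for a
  proof -
    have "emeasure lborel ((+) a ` K) = emeasure (distr lborel borel ((+) a)) ((+) a ` K)"
      by (simp add: lborel_distr_plus)
    also have "\<dots> = emeasure lborel ((+) a -` ((+) a ` K))"
      using K by (subst emeasure_distr) (auto intro!: borel_compact compact_translation)
    also have "(+) a -` ((+) a ` K) = K" by auto
    finally show ?thesis .
  qed
  then show "(SUP a. emeasure lborel ((+) a ` K)) < \<infinity>"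
    using emeasure_compact_finite[OF K] by simp
qed

section \<open>Rapidly decreasing functions\<close>

text \<open>The decay half of the Schwartz condition for a single function; derivatives are taken
  care of by \<open>schwartz_coinduct\<close>.\<close>

definition rapid :: "(real ^ 'd \<Rightarrow> complex) \<Rightarrow> bool" where
  "rapid f \<longleftrightarrow> (\<forall>k::nat. \<exists>C. \<forall>x. norm x ^ k * norm (f x) \<le> C)"

lemma one_plus_power_le:
  fixes t :: real assumes "t \<ge> 0" shows "(1 + t) ^ k \<le> 2 ^ k * (1 + t ^ k)"
proof -
  have "(1 + t) ^ k \<le> (2 * max 1 t) ^ k" using assms by (intro power_mono) auto
  also have "\<dots> = 2 ^ k * (max 1 t) ^ k" by (simp add: power_mult_distrib)
  also have "max 1 t ^ k \<le> 1 + t ^ k" using assms by (auto simp: max_def)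
  finally show ?thesis by simp
qed

lemma rapid_one_plus:
  assumes "rapid f"
  shows "\<exists>C\<ge>0. \<forall>x. (1 + norm x) ^ k * norm (f x) \<le> C"
proof -
  obtain C0 Ck where C: "\<And>x. norm x ^ 0 * norm (f x) \<le> C0" "\<And>x. norm x ^ k * norm (f x) \<le> Ck"
    using assms unfolding rapid_def by metis
  have "(1 + norm x) ^ k * norm (f x) \<le> 2 ^ k * (C0 + Ck)" for x
  proof -
    have "(1 + norm x) ^ k * norm (f x) \<le> 2 ^ k * (1 + norm x ^ k) * norm (f x)"
      by (intro mult_right_mono one_plus_power_le) auto
    also have "\<dots> = 2 ^ k * (norm x ^ 0 * norm (f x) + norm x ^ k * norm (f x))"
      by (simp add: algebra_simps)
    also have "\<dots> \<le> 2 ^ k * (C0 + Ck)" using C[of x] by (intro mult_left_mono add_mono) auto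
    finally show ?thesis .
  qed
  moreover have "0 \<le> 2 ^ k * (C0 + Ck)"
    by (rule order_trans[OF _ calculation[of 0]]) simp
  ultimately show ?thesis by blast
qed

lemma rapid_if_one_plus:
  assumes "\<And>k. \<exists>C. \<forall>x. (1 + norm x) ^ k * norm (f x) \<le> C"
  shows "rapid f"
  unfolding rapid_def
proof
  fix k
  obtain C where C: "\<And>x. (1 + norm x) ^ k * norm (f x) \<le> C" using assms by blast
  have "norm x ^ k * norm (f x) \<le> (1 + norm x) ^ k * norm (f x)" for x
    by (intro mult_right_mono power_mono) auto
  then show "\<exists>C. \<forall>x. norm x ^ k * norm (f x) \<le> C" using C order_trans by blast
qed

lemma rapid_lincomb:
  assumes "rapid f" "rapid g"
  shows "rapid (\<lambda>x. a * f x + b * g x)"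
  unfolding rapid_def
proof
  fix k
  obtain C D where C: "\<And>x. norm x ^ k * norm (f x) \<le> C" "\<And>x. norm x ^ k * norm (g x) \<le> D"
    using assms unfolding rapid_def by metis
  have "norm x ^ k * norm (a * f x + b * g x) \<le> norm a * C + norm b * D" for x
  proof -
    have "norm x ^ k * norm (a * f x + b * g x) \<le> norm x ^ k * (norm a * norm (f x) + norm b * norm (g x))"
      by (intro mult_left_mono order_trans[OF norm_triangle_ineq]) (auto simp: norm_mult)
    also have "\<dots> = norm a * (norm x ^ k * norm (f x)) + norm b * (norm x ^ k * norm (g x))"
      by (simp add: algebra_simps)
    also have "\<dots> \<le> norm a * C + norm b * D" using C[of x] by (intro mult_left_mono add_mono) auto
    finally show ?thesis .
  qed
  then show "\<exists>C. \<forall>x. norm x ^ k * norm (a * f x + b * g x) \<le> C" by blast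
qed

lemma rapid_norm_mult:
  assumes "rapid f" "\<And>x. norm (g x) \<le> (1 + norm x) ^ n * norm (f x)"
  shows "rapid g"
proof (rule rapid_if_one_plus)
  fix k
  obtain C where C: "\<And>x. (1 + norm x) ^ (k + n) * norm (f x) \<le> C" using rapid_one_plus[OF assms(1)] by blast
  have "(1 + norm x) ^ k * norm (g x) \<le> (1 + norm x) ^ k * ((1 + norm x) ^ n * norm (f x))" for x
    by (intro mult_left_mono assms) auto
  then show "\<exists>C. \<forall>x. (1 + norm x) ^ k * norm (g x) \<le> C"
    using C by (simp add: power_add mult.assoc) (meson order_trans)
qed

lemma integrable_decay:
  fixes f :: "real ^ 'd \<Rightarrow> complex"
  assumes "cell_bounded s B \<nu>" "B \<ge> 0" "s > 0" "f \<in> borel_measurable borel"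
    "\<And>x. (1 + norm x) ^ (CARD('d) + 2) * norm (f x) \<le> D"
  shows "integrable \<nu> f"
proof -
  have [measurable_cong]: "sets \<nu> = sets borel" using assms by (simp add: cell_bounded_def)
  have "(\<integral>\<^sup>+x. ennreal (norm (f x)) \<partial>\<nu>) < \<infinity>"
    using nn_integral_decay_le[of s B \<nu> f D] assms by (metis ennreal_less_top infinity_ennreal_def le_less_trans)
  then show ?thesis using assms(4) by (intro integrableI_bounded) measurable
qed

lemma integrable_rapid:
  fixes f :: "real ^ 'd \<Rightarrow> complex"
  assumes "cell_bounded s B \<nu>" "B \<ge> 0" "s > 0" "f \<in> borel_measurable borel" "rapid f"
  shows "integrable \<nu> f"
  using rapid_one_plus[OF assms(5), of "CARD('d) + 2"] integrable_decay[OF assms(1-4)] by blast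

lemma integrable_lborel_rapid:
  fixes f :: "real ^ 'd \<Rightarrow> complex"
  assumes "f \<in> borel_measurable borel" "rapid f"
  shows "integrable lborel f"
  using cell_bounded_translation_bounded[OF _ lborel_translation_bounded] integrable_rapid assms
  by (metis sets_lborel zero_less_one)

text \<open>Supplies the majorant for dominated convergence, both for Lebesgue measure and for the
  colour parts of a configuration.\<close>

lemma integrable_weight:
  assumes "cell_bounded s B (\<nu> :: (real ^ 'd) measure)" "B \<ge> 0" "s > 0"
  shows "integrable \<nu> (\<lambda>x. 1 / (1 + norm x) ^ (CARD('d) + 2))"
proof -
  have p: "(1 + norm x) ^ n > 0" for x :: "real ^ 'd" and n
    by (simp add: add_pos_nonneg)
  have "integrable \<nu> (\<lambda>x. complex_of_real (1 / (1 + norm x) ^ (CARD('d) + 2)))"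
  proof (rule integrable_decay[OF assms, where D = 1])
    show "(1 + norm x) ^ (CARD('d) + 2) * norm (complex_of_real (1 / (1 + norm x) ^ (CARD('d) + 2))) \<le> 1"
      for x :: "real ^ 'd"
      using p[of x "CARD('d) + 2"] by (simp only: norm_of_real abs_of_pos zero_less_divide_1_iff) simp
  qed measurable
  then show ?thesis by (simp only: complex_of_real_integrable_eq)
qed

lemma integrable_lborel_weight: "integrable lborel (\<lambda>x :: real ^ 'd. 1 / (1 + norm x) ^ (CARD('d) + 2))"
  using cell_bounded_translation_bounded[OF _ lborel_translation_bounded] integrable_weight
  by (metis sets_lborel zero_less_one)

subsection \<open>Closure properties of the Schwartz space\<close>

lemma partial_deriv_eqI: "(f has_derivative D) (at x) \<Longrightarrow> partial_deriv j f x = D (axis j 1)"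
  by (metis frechet_derivative_at partial_deriv_def)

text \<open>A class of differentiable, rapidly decreasing functions that is stable under partial
  derivatives contains all iterated derivatives of its members. Later proofs only have to name such
  a class and differentiate once.\<close>

lemma schwartz_coinduct:
  assumes "f \<in> A"
    and "\<And>g x. g \<in> A \<Longrightarrow> g differentiable (at x)" "\<And>g. g \<in> A \<Longrightarrow> rapid g"
    and "\<And>g j. g \<in> A \<Longrightarrow> partial_deriv j g \<in> A"
  shows "f \<in> schwartz"
proof -
  have "iter_partial_deriv js f \<in> A" for js
    by (induction js) (use assms in \<open>auto simp: iter_partial_deriv_def\<close>)
  then show ?thesis using assms(2,3) by (auto simp: schwartz_def rapid_def)
qed

lemma schwartz_partial_deriv:
  assumes "f \<in> schwartz" shows "partial_deriv j f \<in> schwartz"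
proof -
  have "iter_partial_deriv js (partial_deriv j f) = iter_partial_deriv (js @ [j]) f" for js
    by (simp add: iter_partial_deriv_def)
  then show ?thesis using assms by (simp add: schwartz_def)
qed

lemma schwartz_differentiable: "f \<in> schwartz \<Longrightarrow> f differentiable (at x)"
  unfolding schwartz_def by (auto dest: spec[of _ "[]"] simp: iter_partial_deriv_def)

lemma schwartz_has_derivative: "f \<in> schwartz \<Longrightarrow> (f has_derivative frechet_derivative f (at x)) (at x)"
  using schwartz_differentiable frechet_derivative_works by blast

lemma schwartz_rapid: "f \<in> schwartz \<Longrightarrow> rapid f"
  unfolding schwartz_def rapid_def by (auto dest: spec[of _ "[]"] simp: iter_partial_deriv_def)

lemma schwartz_continuous: "f \<in> schwartz \<Longrightarrow> continuous_on UNIV f"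
  by (simp add: continuous_at_imp_continuous_on differentiable_imp_continuous_within schwartz_differentiable)

lemma schwartz_measurable: "f \<in> schwartz \<Longrightarrow> f \<in> borel_measurable borel"
  by (intro borel_measurable_continuous_onI schwartz_continuous)

lemma schwartz_integrable: "f \<in> schwartz \<Longrightarrow> integrable lborel f"
  by (intro integrable_lborel_rapid schwartz_measurable schwartz_rapid)

lemma schwartz_lincomb:
  fixes f g :: "real ^ 'd \<Rightarrow> complex"
  assumes "f \<in> schwartz" "g \<in> schwartz"
  shows "(\<lambda>x. a * f x + b * g x) \<in> schwartz"
proof -
  define A :: "(real ^ 'd \<Rightarrow> complex) set" where "A = {\<lambda>x. a * f x + b * g x | f g. f \<in> schwartz \<and> g \<in> schwartz}"
  have der: "((\<lambda>x. a * f x + b * g x) has_derivative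
      (\<lambda>h. a * frechet_derivative f (at x) h + b * frechet_derivative g (at x) h)) (at x)"
    if "f \<in> schwartz" "g \<in> schwartz" for f g :: "real ^ 'd \<Rightarrow> complex" and x
    by (intro derivative_intros schwartz_has_derivative that)
  show ?thesis
  proof (rule schwartz_coinduct[where A = A])
    show "h differentiable (at x)" if "h \<in> A" for h x
      using that unfolding A_def by (clarify, intro differentiableI[OF der])
    show "rapid h" if "h \<in> A" for h
      using that unfolding A_def by clarify (intro rapid_lincomb schwartz_rapid)
    show "partial_deriv j h \<in> A"
      if h: "h \<in> A" for h j
    proof -
      obtain f g where fg: "f \<in> schwartz" "g \<in> schwartz" "h = (\<lambda>x. a * f x + b * g x)" using h unfolding A_def by blast
      have "partial_deriv j h = (\<lambda>x. a * partial_deriv j f x + b * partial_deriv j g x)"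
        unfolding fg(3) using partial_deriv_eqI[OF der[OF fg(1,2)]] by (auto simp: partial_deriv_def)
      then show ?thesis using fg schwartz_partial_deriv unfolding A_def by blast
    qed
  qed (use assms A_def in blast)
qed

lemma schwartz_scale: "f \<in> schwartz \<Longrightarrow> (\<lambda>x. a * f x) \<in> schwartz"
  using schwartz_lincomb[of f f a 0] by simp

lemma schwartz_coordinate_mult:
  fixes f :: "real ^ 'd \<Rightarrow> complex"
  assumes "f \<in> schwartz"
  shows "(\<lambda>x. of_real (x $ i) * f x) \<in> schwartz"
proof -
  \<comment> \<open>The product rule leaves a term \<open>f\<close> without the coordinate factor,
    so the class carries a free Schwartz summand \<open>g\<close>.\<close>
  define A :: "(real ^ 'd \<Rightarrow> complex) set"
    where "A = {\<lambda>x. of_real (x $ i) * f x + g x | f g. f \<in> schwartz \<and> g \<in> schwartz}"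
  have der: "((\<lambda>x. of_real (x $ i) * f x + g x) has_derivative
      (\<lambda>h. (of_real (x $ i) * frechet_derivative f (at x) h + of_real (h $ i) * f x) + frechet_derivative g (at x) h)) (at x)"
    if "f \<in> schwartz" "g \<in> schwartz" for f g :: "real ^ 'd \<Rightarrow> complex" and x
    by (intro has_derivative_add has_derivative_mult schwartz_has_derivative that
        bounded_linear.has_derivative[OF bounded_linear_of_real]
        bounded_linear_imp_has_derivative bounded_linear_vec_nth)
  show ?thesis
  proof (rule schwartz_coinduct[where A = A])
    have A: "(\<lambda>x. of_real (x $ i) * f x + g x) \<in> A" if "f \<in> schwartz" "g \<in> schwartz" for f g
      using that unfolding A_def by auto
    show "(\<lambda>x. of_real (x $ i) * f x) \<in> A"
      using A[OF assms schwartz_scale[OF assms, of 0]] by simp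
    show "h differentiable (at x)" if "h \<in> A" for h x
      using that unfolding A_def by (clarify, intro differentiableI[OF der])
    show "rapid h" if h: "h \<in> A" for h
    proof -
      obtain f g where fg: "f \<in> schwartz" "g \<in> schwartz" "h = (\<lambda>x. of_real (x $ i) * f x + g x)"
        using h unfolding A_def by blast
      have "rapid (\<lambda>x. of_real (x $ i) * f x)"
      proof (rule rapid_norm_mult[OF schwartz_rapid[OF fg(1)], where n = 1])
        show "norm (of_real (x $ i) * f x) \<le> (1 + norm x) ^ 1 * norm (f x)" for x
          using component_le_norm_cart[of x i] by (auto simp: norm_mult intro!: mult_right_mono)
      qed
      then have "rapid (\<lambda>x. 1 * (of_real (x $ i) * f x) + 1 * g x)"
        by (intro rapid_lincomb schwartz_rapid[OF fg(2)])
      then show ?thesis using fg by simp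
    qed
    show "partial_deriv j h \<in> A" if h: "h \<in> A" for h j
    proof -
      obtain f g where fg: "f \<in> schwartz" "g \<in> schwartz" "h = (\<lambda>x. of_real (x $ i) * f x + g x)"
        using h unfolding A_def by blast
      have "partial_deriv j h = (\<lambda>x. of_real (x $ i) * partial_deriv j f x
          + (of_real (axis j 1 $ i) * f x + 1 * partial_deriv j g x))"
        unfolding fg(3) using partial_deriv_eqI[OF der[OF fg(1,2)]]
        by (auto simp: partial_deriv_def add.assoc)
      moreover have "(\<lambda>x. of_real (axis j 1 $ i) * f x + 1 * partial_deriv j g x) \<in> schwartz"
        by (intro schwartz_lincomb fg schwartz_partial_deriv)
      ultimately show ?thesis using A[OF schwartz_partial_deriv[OF fg(1)]] by simp
    qed
  qed
qed

lemma schwartz_reflect: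
  fixes f :: "real ^ 'd \<Rightarrow> complex"
  assumes "f \<in> schwartz"
  shows "(\<lambda>x. f (- x)) \<in> schwartz"
proof -
  define A :: "(real ^ 'd \<Rightarrow> complex) set" where "A = {\<lambda>x. f (- x) | f. f \<in> schwartz}"
  have der: "((\<lambda>x. f (- x)) has_derivative (\<lambda>h. frechet_derivative f (at (- x)) (- h))) (at x)"
    if "f \<in> schwartz" for f :: "real ^ 'd \<Rightarrow> complex" and x
    by (rule has_derivative_compose[OF _ schwartz_has_derivative[OF that], where f = uminus])
      (auto intro: derivative_eq_intros)
  show ?thesis
  proof (rule schwartz_coinduct[where A = A])
    show "h differentiable (at x)" if "h \<in> A" for h x
      using that unfolding A_def by (clarify, intro differentiableI[OF der])
    show "rapid h" if h: "h \<in> A" for h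
    proof -
      obtain f where f: "f \<in> schwartz" "h = (\<lambda>x. f (- x))" using h unfolding A_def by blast
      have "\<exists>C. \<forall>x. norm (- x) ^ k * norm (f (- x)) \<le> C" for k
        using schwartz_rapid[OF f(1)] unfolding rapid_def by blast
      then show ?thesis unfolding rapid_def f(2) by simp
    qed
    show "partial_deriv j h \<in> A" if h: "h \<in> A" for h j
    proof -
      obtain f where f: "f \<in> schwartz" "h = (\<lambda>x. f (- x))" using h unfolding A_def by blast
      have lin: "linear (frechet_derivative f (at x))" for x
        using linear_frechet_derivative schwartz_differentiable[OF f(1)] by blast
      have "partial_deriv j h = (\<lambda>x. (-1) * partial_deriv j f (- x))"
        unfolding f(2) using partial_deriv_eqI[OF der[OF f(1)]]
        by (auto simp: partial_deriv_def linear_neg[OF lin])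
      then show ?thesis unfolding A_def using schwartz_scale[OF schwartz_partial_deriv[OF f(1)], of "-1" j]
        by (intro CollectI exI[of _ "\<lambda>x. (-1) * partial_deriv j f x"]) auto
    qed
  qed (use assms A_def in blast)
qed

subsection \<open>Exponentials of polynomials\<close>

lemma real_polynomial_function_partial:
  fixes Q :: "real ^ 'd \<Rightarrow> real"
  assumes "real_polynomial_function Q"
  shows "\<exists>D. (\<forall>x. (Q has_derivative D x) (at x)) \<and> (\<forall>j. real_polynomial_function (\<lambda>x. D x (axis j 1)))"
  using assms
proof (induction rule: real_polynomial_function.induct)
  case (linear f)
  then show ?case
    by (intro exI[of _ "\<lambda>_. f"]) (auto intro: bounded_linear_imp_has_derivative)
next
  case (const c)
  then show ?case by (intro exI[of _ "\<lambda>_ _. 0"]) auto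
next
  case (add f g)
  then obtain D E where "\<forall>x. (f has_derivative D x) (at x)" "\<forall>j. real_polynomial_function (\<lambda>x. D x (axis j 1))"
      "\<forall>x. (g has_derivative E x) (at x)" "\<forall>j. real_polynomial_function (\<lambda>x. E x (axis j 1))" by blast
  then show ?case
    by (intro exI[of _ "\<lambda>x h. D x h + E x h"]) (auto intro!: has_derivative_add)
next
  case (mult f g)
  then obtain D E where "\<forall>x. (f has_derivative D x) (at x)" "\<forall>j. real_polynomial_function (\<lambda>x. D x (axis j 1))"
      "\<forall>x. (g has_derivative E x) (at x)" "\<forall>j. real_polynomial_function (\<lambda>x. E x (axis j 1))" by blast
  then show ?case using mult.hyps
    by (intro exI[of _ "\<lambda>x h. f x * E x h + D x h * g x"])
      (simp add: has_derivative_mult real_polynomial_function.intros(3) real_polynomial_function.intros(4))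
qed

lemma real_polynomial_function_growth:
  fixes Q :: "real ^ 'd \<Rightarrow> real"
  assumes "real_polynomial_function Q"
  shows "\<exists>C\<ge>0. \<exists>n. \<forall>x. \<bar>Q x\<bar> \<le> C * (1 + norm x) ^ n"
  using assms
proof (induction rule: real_polynomial_function.induct)
  case (linear f)
  then obtain K where K: "K \<ge> 0" "\<And>x. norm (f x) \<le> norm x * K"
    using bounded_linear.nonneg_bounded by blast
  have "\<bar>f x\<bar> \<le> K * (1 + norm x) ^ 1" for x
    using K(1) K(2)[of x] by (simp add: algebra_simps)
  then show ?case using K(1) by blast
next
  case (const c)
  show ?case by (rule exI[of _ "\<bar>c\<bar>"], intro conjI exI[of _ 0]) auto
next
  case (add f g)
  then obtain C D n k where C: "C \<ge> 0" "\<And>x. \<bar>f x\<bar> \<le> C * (1 + norm x) ^ n"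
      and D: "D \<ge> 0" "\<And>x. \<bar>g x\<bar> \<le> D * (1 + norm x) ^ k" by blast
  have "\<bar>f x + g x\<bar> \<le> (C + D) * (1 + norm x) ^ (n + k)" for x
  proof -
    have "\<bar>f x + g x\<bar> \<le> C * (1 + norm x) ^ n + D * (1 + norm x) ^ k"
      using C(2)[of x] D(2)[of x] by linarith
    also have "\<dots> \<le> C * (1 + norm x) ^ (n + k) + D * (1 + norm x) ^ (n + k)"
      using C D by (intro add_mono mult_left_mono power_increasing) auto
    finally show ?thesis by (simp add: algebra_simps)
  qed
  then show ?case using C(1) D(1) by (metis add_nonneg_nonneg)
next
  case (mult f g)
  then obtain C D n k where C: "C \<ge> 0" "\<And>x. \<bar>f x\<bar> \<le> C * (1 + norm x) ^ n"
      and D: "D \<ge> 0" "\<And>x. \<bar>g x\<bar> \<le> D * (1 + norm x) ^ k" by blast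
  have "\<bar>f x * g x\<bar> \<le> (C * D) * (1 + norm x) ^ (n + k)" for x
  proof -
    have "\<bar>f x * g x\<bar> \<le> (C * (1 + norm x) ^ n) * (D * (1 + norm x) ^ k)"
      unfolding abs_mult using C D by (intro mult_mono) auto
    then show ?thesis by (simp add: algebra_simps power_add)
  qed
  then show ?case using C(1) D(1) by (metis mult_nonneg_nonneg)
qed

lemma one_plus_power_le_exp_square:
  fixes a :: real assumes "a > 0"
  shows "\<exists>C\<ge>0. \<forall>t\<ge>0. (1 + t) ^ n \<le> C * exp (a * t\<^sup>2)"
proof (cases "n = 0")
  case True
  have "1 \<le> exp (a * t\<^sup>2)" for t using assms by simp
  then show ?thesis using True by (intro exI[of _ 1]) auto
next
  case False
  \<comment> \<open>With this \<open>b\<close> the \<open>n\<close>-th power of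
    \<open>exp (b * t\<^sup>2)\<close> is \<open>exp (a * t\<^sup>2)\<close>; \<open>c\<close>
    absorbs the constants in \<open>2 + t\<^sup>2 \<le> c * (1 + b * t\<^sup>2)\<close>.\<close>
  define b where "b = a / n"
  define c where "c = max 2 (1 / b)"
  have b: "b > 0" using assms False by (simp add: b_def)
  have "(1 + t) ^ n \<le> c ^ n * exp (a * t\<^sup>2)" if "t \<ge> 0" for t
  proof -
    have "2 * t \<le> 1 + t\<^sup>2" using sum_squares_bound[of t 1] by simp
    then have "1 + t \<le> 2 + t\<^sup>2" using that by linarith
    also have "\<dots> \<le> c * 1 + c * (b * t\<^sup>2)"
    proof (rule add_mono)
      have "1 * t\<^sup>2 \<le> (c * b) * t\<^sup>2"
        using b by (intro mult_right_mono) (auto simp: c_def le_max_iff_disj max_mult_distrib_right)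
      then show "t\<^sup>2 \<le> c * (b * t\<^sup>2)" by (simp add: mult.assoc)
    qed (simp add: c_def)
    also have "\<dots> = c * (1 + b * t\<^sup>2)" by (simp add: algebra_simps)
    also have "\<dots> \<le> c * exp (b * t\<^sup>2)"
      by (intro mult_left_mono exp_ge_add_one_self) (auto simp: c_def)
    finally have "(1 + t) ^ n \<le> (c * exp (b * t\<^sup>2)) ^ n" using that by (intro power_mono) auto
    also have "\<dots> = c ^ n * exp (a * t\<^sup>2)"
      using False by (simp add: power_mult_distrib b_def flip: exp_of_nat_mult)
    finally show ?thesis .
  qed
  then show ?thesis by (intro exI[of _ "c ^ n"]) (auto simp: c_def)
qed

text \<open>The products of \<open>exp (- P x)\<close> with polynomials are stable under
  differentiation, and the quadratic lower bound on \<open>P\<close> beats every polynomial. Both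
  the Gaussian and the approximants of cubes are of this form.\<close>

lemma exp_polynomial_schwartz:
  fixes P :: "real ^ 'd \<Rightarrow> real"
  assumes P: "real_polynomial_function P" and a: "a > 0" and low: "\<And>x. P x \<ge> a * (norm x)\<^sup>2 - b"
  shows "(\<lambda>x. of_real (exp (- P x))) \<in> schwartz"
proof -
  define A :: "(real ^ 'd \<Rightarrow> complex) set"
    where "A = {\<lambda>x. of_real (Q x * exp (- P x)) | Q. real_polynomial_function Q}"
  obtain DP where DP: "\<And>x. (P has_derivative DP x) (at x)"
      "\<And>j. real_polynomial_function (\<lambda>x. DP x (axis j 1))"
    using real_polynomial_function_partial[OF P] by blast
  have der_exp: "((\<lambda>x. exp (- P x)) has_derivative (\<lambda>h. exp (- P x) * (- DP x h))) (at x)" for x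
    by (rule derivative_eq_intros DP refl | simp add: mult.commute)+
  have der: "((\<lambda>x. complex_of_real (Q x * exp (- P x))) has_derivative
      (\<lambda>h. complex_of_real (Q x * (exp (- P x) * (- DP x h)) + D x h * exp (- P x)))) (at x)"
    if "\<And>x. (Q has_derivative D x) (at x)" for Q D x
    by (intro bounded_linear.has_derivative[OF bounded_linear_of_real] has_derivative_mult that
        der_exp)
  show ?thesis
  proof (rule schwartz_coinduct[where A = A])
    show "h differentiable (at x)" if hA: "h \<in> A" for h x
    proof -
      from hA have "\<exists>Q. h = (\<lambda>x. of_real (Q x * exp (- P x))) \<and> real_polynomial_function Q"
        unfolding A_def mem_Collect_eq .
      then obtain Q where Q: "h = (\<lambda>x. of_real (Q x * exp (- P x)))" "real_polynomial_function Q"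
        by (elim exE conjE)
      obtain D where D: "\<And>x. (Q has_derivative D x) (at x)"
        using real_polynomial_function_partial[OF Q(2)] by metis
      show ?thesis unfolding Q(1) by (rule differentiableI[OF der[OF D]])
    qed
    show "(\<lambda>x. of_real (exp (- P x))) \<in> A"
      unfolding A_def by (intro CollectI exI[of _ "\<lambda>_. 1"]) (simp add: real_polynomial_function.intros(2))
    show "rapid h" if "h \<in> A" for h
    proof (rule rapid_if_one_plus)
      fix k
      obtain Q where Q: "real_polynomial_function Q" "h = (\<lambda>x. of_real (Q x * exp (- P x)))"
        using \<open>h \<in> A\<close> unfolding A_def mem_Collect_eq by metis
      obtain C n where C: "C \<ge> 0" "\<And>x. \<bar>Q x\<bar> \<le> C * (1 + norm x) ^ n"
        using real_polynomial_function_growth[OF Q(1)] by metis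
      obtain D where D: "D \<ge> 0" "\<And>t. t \<ge> 0 \<Longrightarrow> (1 + t) ^ (k + n) \<le> D * exp (a * t\<^sup>2)"
        using one_plus_power_le_exp_square[OF a] by blast
      have "(1 + norm x) ^ k * norm (h x) \<le> C * D * exp b" for x
      proof -
        have "(1 + norm x) ^ k * norm (h x) = (1 + norm x) ^ k * (\<bar>Q x\<bar> * exp (- P x))"
          unfolding Q(2) norm_of_real by (simp add: abs_mult)
        also have "\<dots> \<le> (1 + norm x) ^ k * ((C * (1 + norm x) ^ n) * exp (b - a * (norm x)\<^sup>2))"
          using low[of x] C by (intro mult_left_mono mult_mono) auto
        also have "\<dots> = C * ((1 + norm x) ^ (k + n) * exp (b - a * (norm x)\<^sup>2))"
          by (simp add: power_add)
        also have "\<dots> \<le> C * ((D * exp (a * (norm x)\<^sup>2)) * exp (b - a * (norm x)\<^sup>2))"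
          using C D by (intro mult_left_mono mult_right_mono) auto
        also have "\<dots> = C * D * exp b" by (simp flip: exp_add)
        finally show ?thesis .
      qed
      then show "\<exists>C. \<forall>x. (1 + norm x) ^ k * norm (h x) \<le> C" by blast
    qed
    show "partial_deriv j h \<in> A" if hA: "h \<in> A" for h j
    proof -
      from hA have "\<exists>Q. h = (\<lambda>x. of_real (Q x * exp (- P x))) \<and> real_polynomial_function Q"
        unfolding A_def mem_Collect_eq .
      then obtain Q where Q: "h = (\<lambda>x. of_real (Q x * exp (- P x)))" "real_polynomial_function Q"
        by (elim exE conjE)
      obtain D where D: "\<And>x. (Q has_derivative D x) (at x)"
          "\<And>j. real_polynomial_function (\<lambda>x. D x (axis j 1))"
        using real_polynomial_function_partial[OF Q(2)] by metis
      have eq: "partial_deriv j h = (\<lambda>x. of_real ((Q x * (- DP x (axis j 1)) + D x (axis j 1)) * exp (- P x)))"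
        unfolding Q(1) partial_deriv_eqI[OF der[OF D(1)]] fun_eq_iff by (simp add: algebra_simps)
      have "real_polynomial_function (\<lambda>x. Q x * (- DP x (axis j 1)) + D x (axis j 1))"
        by (intro real_polynomial_function.intros(3) real_polynomial_function.intros(4) real_polynomial_function_minus Q(2) DP(2) D(2))
      then show ?thesis unfolding A_def eq mem_Collect_eq
        by (intro exI[of _ "\<lambda>x. Q x * (- DP x (axis j 1)) + D x (axis j 1)"] conjI) auto
    qed
  qed
qed

subsection \<open>Modulations and integration by parts\<close>

definition character :: "real ^ 'd \<Rightarrow> real ^ 'd \<Rightarrow> complex" where
  "character y x = exp (- 2 * of_real pi * \<i> * of_real (x \<bullet> y))"

lemma fourier_character: "fourier f y = (\<integral>x. character y x * f x \<partial>lborel)"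
  by (simp add: fourier_def character_def)

lemma norm_character [simp]: "norm (character y x) = 1"
  by (simp add: character_def)

lemma character_iexp: "character y x = iexp (- 2 * pi * (x \<bullet> y))"
  by (simp add: character_def mult_ac)

lemma character_add_left: "character (y + z) x = character y x * character z x"
  by (simp add: character_def inner_right_distrib distrib_left flip: exp_add)

lemma character_add_right: "character y (x + z) = character y x * character y z"
  by (simp add: character_def inner_left_distrib distrib_left flip: exp_add)

lemma character_commute: "character y x = character x y"
  by (simp add: character_def inner_commute)

lemma character_measurable [measurable]: "character y \<in> borel_measurable borel"
  unfolding character_def by measurable

lemma character_has_derivative:
  "((\<lambda>x. character y x) has_derivative
    (\<lambda>h. character y x * (- 2 * of_real pi * \<i> * of_real (h \<bullet> y)))) (at x)"
proof -
  have "((\<lambda>x. - 2 * of_real pi * \<i> * of_real (x \<bullet> y)) has_derivative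
      (\<lambda>h. - 2 * of_real pi * \<i> * complex_of_real (h \<bullet> y))) (at x)"
    by (intro has_derivative_mult_right bounded_linear.has_derivative[OF bounded_linear_of_real]
        has_derivative_inner_left has_derivative_ident)
  from has_derivative_compose[OF this DERIV_exp[unfolded has_field_derivative_def]]
  show ?thesis unfolding character_def .
qed

text \<open>Prepares integration by parts for Fourier integrals, where the derivative falls on the
  product of \<open>f\<close> with a character; hence the explicit formula besides the
  membership.\<close>

lemma schwartz_modulate:
  fixes f :: "real ^ 'd \<Rightarrow> complex"
  assumes "f \<in> schwartz"
  shows "(\<lambda>x. character y x * f x) \<in> schwartz"
    and "partial_deriv j (\<lambda>x. character y x * f x) =
      (\<lambda>x. character y x * ((- 2 * of_real pi * \<i> * of_real (y $ j)) * f x + 1 * partial_deriv j f x))"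
proof -
  define A :: "(real ^ 'd \<Rightarrow> complex) set" where "A = {\<lambda>x. character y x * f x | f. f \<in> schwartz}"
  have A_I: "(\<lambda>x. character y x * f x) \<in> A" if "f \<in> schwartz" for f
    using that by (auto simp: A_def)
  have der: "((\<lambda>x. character y x * f x) has_derivative
      (\<lambda>h. character y x * frechet_derivative f (at x) h
        + (character y x * (- 2 * of_real pi * \<i> * of_real (h \<bullet> y))) * f x)) (at x)"
    if "f \<in> schwartz" for f :: "real ^ 'd \<Rightarrow> complex" and x
    by (intro has_derivative_mult character_has_derivative schwartz_has_derivative that)
  have part: "partial_deriv j (\<lambda>x. character y x * f x) =
      (\<lambda>x. character y x * ((- 2 * of_real pi * \<i> * of_real (y $ j)) * f x + 1 * partial_deriv j f x))"
    if "f \<in> schwartz" for f j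
    using partial_deriv_eqI[OF der[OF that]]
    by (auto simp: partial_deriv_def algebra_simps inner_axis inner_commute)
  show "(\<lambda>x. character y x * f x) \<in> schwartz"
  proof (rule schwartz_coinduct[where A = A])
    show "h differentiable (at x)" if "h \<in> A" for h x
      using that unfolding A_def by (clarify, intro differentiableI[OF der])
    show "rapid h" if h: "h \<in> A" for h
    proof -
      obtain f where f: "f \<in> schwartz" "h = (\<lambda>x. character y x * f x)" using h unfolding A_def by blast
      show ?thesis
        by (rule rapid_norm_mult[OF schwartz_rapid[OF f(1)], where n = 0]) (simp add: f norm_mult)
    qed
    show "partial_deriv j h \<in> A" if h: "h \<in> A" for h j
    proof -
      obtain f where f: "f \<in> schwartz" "h = (\<lambda>x. character y x * f x)" using h unfolding A_def by blast
      show ?thesis unfolding f(2) part[OF f(1)]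
        by (rule A_I[OF schwartz_lincomb[OF f(1) schwartz_partial_deriv[OF f(1)]]])
    qed
  qed (use assms A_def in blast)
  show "partial_deriv j (\<lambda>x. character y x * f x) =
      (\<lambda>x. character y x * ((- 2 * of_real pi * \<i> * of_real (y $ j)) * f x + 1 * partial_deriv j f x))"
    by (rule part[OF assms])
qed

lemma integral_lborel_translate:
  fixes f :: "real ^ 'd \<Rightarrow> complex"
  assumes [measurable]: "f \<in> borel_measurable borel"
  shows "(\<integral>x. f (a + x) \<partial>lborel) = integral\<^sup>L lborel f"
proof -
  have "integral\<^sup>L lborel f = integral\<^sup>L (distr lborel borel ((+) a)) f" by (simp add: lborel_distr_plus)
  also have "\<dots> = (\<integral>x. f (a + x) \<partial>lborel)" by (subst integral_distr) auto
  finally show ?thesis by simp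
qed

lemma integrable_lborel_translate:
  fixes f :: "real ^ 'd \<Rightarrow> complex"
  assumes [measurable]: "f \<in> borel_measurable borel" and "integrable lborel f"
  shows "integrable lborel (\<lambda>x. f (a + x))"
proof -
  have "integrable (distr lborel borel ((+) a)) f" using assms by (simp add: lborel_distr_plus)
  then show ?thesis by (subst (asm) integrable_distr_eq) auto
qed

text \<open>Difference quotients in direction \<open>j\<close> have integral 0 by translation
  invariance of Lebesgue measure, and dominated convergence passes this on to the derivative. The
  majorant comes from the mean value inequality.\<close>

lemma integral_partial_deriv_eq_0:
  fixes f :: "real ^ 'd \<Rightarrow> complex"
  assumes f: "f \<in> schwartz"
  shows "(\<integral>x. partial_deriv j f x \<partial>lborel) = 0"
proof -
  define e :: "real ^ 'd" where "e = axis j 1"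
  define t where "t n = 1 / real (Suc n)" for n
  define G where "G n x = (f (t n *\<^sub>R e + x) - f x) /\<^sub>R t n" for n x
  have t: "0 < t n" "t n \<le> 1" for n by (auto simp: t_def)
  have e1: "norm e = 1" by (simp add: e_def)
  have [measurable]: "f \<in> borel_measurable borel" "partial_deriv j f \<in> borel_measurable borel"
    using schwartz_measurable schwartz_partial_deriv f by auto
  let ?K = "CARD('d) + 2"
  obtain C where C: "C \<ge> 0" "\<And>x. (1 + norm x) ^ ?K * norm (partial_deriv j f x) \<le> C"
    using rapid_one_plus[OF schwartz_rapid[OF schwartz_partial_deriv[OF f]]] by blast
  have pos: "(1 + norm x) ^ ?K > 0" for x :: "real ^ 'd" by (intro zero_less_power) (simp add: add_pos_nonneg)
  have bd: "norm (G n x) \<le> 2 ^ ?K * C * (1 / (1 + norm x) ^ ?K)" for n x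
  proof -
    define B where "B = 2 ^ ?K * C * (1 / (1 + norm x) ^ ?K)"
    have der: "((\<lambda>s. f (s *\<^sub>R e + x)) has_derivative (\<lambda>h. h *\<^sub>R partial_deriv j f (s *\<^sub>R e + x))) (at s within {0..t n})" for s
    proof -
      have "((\<lambda>s. f (s *\<^sub>R e + x)) has_derivative
          (\<lambda>h. frechet_derivative f (at (s *\<^sub>R e + x)) (h *\<^sub>R e))) (at s)"
        by (rule has_derivative_compose[OF _ schwartz_has_derivative[OF f], where f = "\<lambda>s. s *\<^sub>R e + x"])
          (auto intro!: derivative_eq_intros)
      moreover have "frechet_derivative f (at (s *\<^sub>R e + x)) (h *\<^sub>R e) = h *\<^sub>R partial_deriv j f (s *\<^sub>R e + x)" for h
        unfolding partial_deriv_def e_def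
        by (intro linear_cmul linear_frechet_derivative schwartz_differentiable f)
      ultimately show ?thesis by (simp add: has_derivative_at_withinI)
    qed
    \<comment> \<open>A shift by a vector of norm at most 1 changes \<open>1 + norm x\<close> by at
      most a factor 2, whence the power of 2 in \<open>B\<close>.\<close>
    have on: "onorm (\<lambda>h::real. h *\<^sub>R partial_deriv j f (s *\<^sub>R e + x)) \<le> B" if s: "s \<in> {0..t n}" for s
    proof -
      have "norm (s *\<^sub>R e) \<le> 1" using s t(2)[of n] by (auto simp: e1)
      then have "1 + norm x \<le> 2 * (1 + norm (s *\<^sub>R e + x))"
        using norm_triangle_ineq4[of "s *\<^sub>R e + x" "s *\<^sub>R e"] norm_ge_zero[of "s *\<^sub>R e + x"]
        unfolding add_diff_cancel_left' by argo
      then have "(1 + norm x) ^ ?K \<le> 2 ^ ?K * (1 + norm (s *\<^sub>R e + x)) ^ ?K"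
        unfolding power_mult_distrib[symmetric] by (rule power_mono) simp
      then have "(1 + norm x) ^ ?K * norm (partial_deriv j f (s *\<^sub>R e + x))
          \<le> 2 ^ ?K * ((1 + norm (s *\<^sub>R e + x)) ^ ?K * norm (partial_deriv j f (s *\<^sub>R e + x)))"
        unfolding mult.assoc[symmetric] by (rule mult_right_mono[OF _ norm_ge_zero])
      also have "\<dots> \<le> 2 ^ ?K * C" using C(2) by (intro mult_left_mono) auto
      finally have "norm (partial_deriv j f (s *\<^sub>R e + x)) \<le> B"
        unfolding B_def using pos[of x] by (simp add: pos_le_divide_eq mult.commute del: power_Suc power_add_numeral)
      then show ?thesis
        by (intro onorm_le) (simp add: mult.commute[of B] mult_left_mono)
    qed
    have "norm (f (t n *\<^sub>R e + x) - f (0 *\<^sub>R e + x)) \<le> B * norm (t n - 0)"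
      by (rule differentiable_bound[OF _ der on]) (use t[of n] in auto)
    then have "norm (G n x) \<le> B"
      using t(1)[of n] by (simp add: G_def divide_simps mult.commute)
    then show ?thesis by (simp add: B_def)
  qed
  have "(\<lambda>n. integral\<^sup>L lborel (G n)) \<longlonglongrightarrow> (\<integral>x. partial_deriv j f x \<partial>lborel)"
  proof (rule integral_dominated_convergence[where w = "\<lambda>x. 2 ^ ?K * C * (1 / (1 + norm x) ^ ?K)"])
    show "integrable lborel (\<lambda>x :: real ^ 'd. 2 ^ ?K * C * (1 / (1 + norm x) ^ ?K))"
      by (intro integrable_mult_right integrable_lborel_weight)
    show "AE x in lborel. (\<lambda>n. G n x) \<longlonglongrightarrow> partial_deriv j f x"
    proof (rule AE_I2)
      fix x
      have "((\<lambda>s. f (s *\<^sub>R e + x)) has_vector_derivative partial_deriv j f x) (at 0)"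
      proof -
        have "((\<lambda>s. f (s *\<^sub>R e + x)) has_derivative
            (\<lambda>h. frechet_derivative f (at (0 *\<^sub>R e + x)) (h *\<^sub>R e))) (at 0)"
          by (rule has_derivative_compose[OF _ schwartz_has_derivative[OF f], where f = "\<lambda>s. s *\<^sub>R e + x"])
            (auto intro!: derivative_eq_intros)
        moreover have "frechet_derivative f (at x) (h *\<^sub>R e) = h *\<^sub>R partial_deriv j f x" for h
          unfolding partial_deriv_def e_def
          by (intro linear_cmul linear_frechet_derivative schwartz_differentiable f)
        ultimately show ?thesis by (simp add: has_vector_derivative_def)
      qed
      then have "((\<lambda>s. (f (s *\<^sub>R e + x) - f x) /\<^sub>R s) \<longlongrightarrow> partial_deriv j f x) (at 0)"
      proof -
        assume "((\<lambda>s. f (s *\<^sub>R e + x)) has_vector_derivative partial_deriv j f x) (at 0)"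
        then have "((\<lambda>s. norm (f (s *\<^sub>R e + x) - f x - s *\<^sub>R partial_deriv j f x) / norm s) \<longlongrightarrow> 0) (at 0)"
          by (simp add: has_vector_derivative_def has_derivative_iff_norm)
        then have "((\<lambda>s. norm ((f (s *\<^sub>R e + x) - f x) /\<^sub>R s - partial_deriv j f x)) \<longlongrightarrow> 0) (at 0)"
        proof (rule Lim_transform_eventually)
          have "norm (f (s *\<^sub>R e + x) - f x - s *\<^sub>R partial_deriv j f x) / norm s
              = norm ((f (s *\<^sub>R e + x) - f x) /\<^sub>R s - partial_deriv j f x)" if "s \<noteq> 0" for s
          proof -
            have "(f (s *\<^sub>R e + x) - f x) /\<^sub>R s - partial_deriv j f x
                = (f (s *\<^sub>R e + x) - f x - s *\<^sub>R partial_deriv j f x) /\<^sub>R s"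
              using that by (simp add: scaleR_diff_right)
            then show ?thesis by (simp add: divide_inverse mult.commute)
          qed
          then show "\<forall>\<^sub>F s in at 0. norm (f (s *\<^sub>R e + x) - f x - s *\<^sub>R partial_deriv j f x) / norm s
              = norm ((f (s *\<^sub>R e + x) - f x) /\<^sub>R s - partial_deriv j f x)"
            by (simp add: eventually_at_filter)
        qed
        then show ?thesis by (simp add: tendsto_norm_zero_iff LIM_zero_cancel)
      qed
      moreover have "filterlim t (at 0) sequentially"
        unfolding filterlim_at using LIMSEQ_inverse_real_of_nat
        by (auto simp: t_def[abs_def] inverse_eq_divide)
      ultimately show "(\<lambda>n. G n x) \<longlonglongrightarrow> partial_deriv j f x"
        unfolding G_def by (rule filterlim_compose)
    qed
    show "G n \<in> borel_measurable lborel" for n unfolding G_def by measurable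
    show "AE x in lborel. norm (G n x) \<le> 2 ^ ?K * C * (1 / (1 + norm x) ^ ?K)" for n
      by (intro AE_I2 bd)
  qed measurable
  moreover have "integral\<^sup>L lborel (G n) = 0" for n
  proof -
    have "integral\<^sup>L lborel (G n) = ((\<integral>x. f (t n *\<^sub>R e + x) \<partial>lborel) - integral\<^sup>L lborel f) /\<^sub>R t n"
      unfolding G_def using schwartz_integrable[OF f] integrable_lborel_translate[of f]
      by (subst integral_scaleR_right, subst Bochner_Integration.integral_diff) auto
    then show ?thesis by (subst (asm) integral_lborel_translate) auto
  qed
  ultimately show ?thesis by (simp add: LIMSEQ_const_iff)
qed

subsection \<open>The Fourier transform on the Schwartz space\<close>

lemma integrable_character_mult:
  "integrable lborel f \<Longrightarrow> integrable lborel (\<lambda>x. character y x * f x)"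
  by (rule Bochner_Integration.integrable_bound[of _ f]) (auto simp: norm_mult)

lemma norm_fourier_le:
  assumes "integrable lborel f"
  shows "norm (fourier f y) \<le> (\<integral>x. norm (f x) \<partial>lborel)"
  unfolding fourier_character
  using integral_norm_bound[of lborel "\<lambda>x. character y x * f x"] by (simp add: norm_mult)

text \<open>The derivative of the product of \<open>f\<close> with a character has integral 0, and
  the product rule splits that integral into the two sides.\<close>

lemma fourier_partial_deriv:
  assumes f: "f \<in> schwartz"
  shows "fourier (partial_deriv j f) y = 2 * of_real pi * \<i> * of_real (y $ j) * fourier f y"
proof -
  define a where "a = - 2 * of_real pi * \<i> * complex_of_real (y $ j)"
  have i: "integrable lborel (\<lambda>x. a * (character y x * f x))"
      "integrable lborel (\<lambda>x. character y x * partial_deriv j f x)"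
    by (intro integrable_mult_right integrable_character_mult schwartz_integrable[OF f]
        schwartz_integrable[OF schwartz_partial_deriv[OF f]])+
  have "0 = (\<integral>x. partial_deriv j (\<lambda>x. character y x * f x) x \<partial>lborel)"
    using integral_partial_deriv_eq_0[OF schwartz_modulate(1)[OF f]] by simp
  also have "\<dots> = (\<integral>x. a * (character y x * f x) + character y x * partial_deriv j f x \<partial>lborel)"
    unfolding schwartz_modulate(2)[OF f] by (simp add: a_def algebra_simps)
  also have "\<dots> = a * fourier f y + fourier (partial_deriv j f) y"
    unfolding fourier_character using i by (subst Bochner_Integration.integral_add) auto
  finally show ?thesis by (simp add: a_def add_eq_0_iff2 eq_neg_iff_add_eq_0 add.commute)
qed

lemma character_approx:
  "norm (character h x - 1 - (- 2 * of_real pi * \<i> * of_real (x \<bullet> h))) \<le> 2 * pi\<^sup>2 * (norm x)\<^sup>2 * (norm h)\<^sup>2"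
proof -
  have eq: "(\<Sum>k\<le>1. (\<i> * complex_of_real t) ^ k / fact k) = 1 + \<i> * of_real t" for t
    by (simp add: atMost_Suc)
  have "norm (character h x - 1 - (- 2 * of_real pi * \<i> * of_real (x \<bullet> h)))
      = norm (iexp (- 2 * pi * (x \<bullet> h)) - (1 + \<i> * of_real (- 2 * pi * (x \<bullet> h))))"
    by (simp add: character_iexp algebra_simps)
  also have "\<dots> \<le> \<bar>- 2 * pi * (x \<bullet> h)\<bar> ^ Suc 1 / fact (Suc 1)"
    using iexp_approx1[of "- 2 * pi * (x \<bullet> h)" 1] unfolding eq .
  also have "\<dots> = 2 * pi\<^sup>2 * \<bar>x \<bullet> h\<bar>\<^sup>2"
    by (simp add: abs_mult power_mult_distrib power2_eq_square)
  also have "\<dots> \<le> 2 * pi\<^sup>2 * (norm x * norm h)\<^sup>2"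
    by (intro mult_left_mono power_mono Cauchy_Schwarz_ineq2) auto
  finally show ?thesis by (simp add: power_mult_distrib mult.assoc)
qed

text \<open>By \<open>character_approx\<close> the Taylor remainder of the character is at most
  \<open>2 * pi\<^sup>2 * (norm x)\<^sup>2 * (norm h)\<^sup>2\<close>, and
  \<open>(norm x)\<^sup>2\<close> times \<open>f\<close> is integrable. Hence the increment differs
  from its linear part by at most \<open>C * (norm h)\<^sup>2\<close>.\<close>

lemma fourier_has_derivative:
  fixes f :: "real ^ 'd \<Rightarrow> complex"
  assumes f: "f \<in> schwartz"
  shows "(fourier f has_derivative
    (\<lambda>h. \<Sum>j\<in>UNIV. of_real (h $ j) * fourier (\<lambda>x. (- 2 * of_real pi * \<i>) * (of_real (x $ j) * f x)) y)) (at y)"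
proof -
  define g where "g j = (\<lambda>x. (- 2 * of_real pi * \<i>) * (of_real (x $ j) * f x))" for j
  define C where "C = (\<integral>x. norm (of_real (2 * pi\<^sup>2 * (norm x)\<^sup>2) * f x) \<partial>lborel)"
  have gS: "g j \<in> schwartz" for j unfolding g_def by (intro schwartz_scale schwartz_coordinate_mult f)
  have [measurable]: "f \<in> borel_measurable borel" using f by (rule schwartz_measurable)
  have rap: "rapid (\<lambda>x. of_real ((norm x)\<^sup>2) * f x)"
    by (rule rapid_norm_mult[OF schwartz_rapid[OF f], where n = 2])
      (auto simp: norm_mult norm_power intro!: mult_right_mono power_mono)
  have "integrable lborel (\<lambda>x. of_real (2 * pi\<^sup>2) * (of_real ((norm x)\<^sup>2) * f x))"
    by (intro integrable_mult_right integrable_lborel_rapid rap) measurable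
  then have Ci: "integrable lborel (\<lambda>x. of_real (2 * pi\<^sup>2 * (norm x)\<^sup>2) * f x)"
    by (simp add: mult.assoc)
  have bound: "norm (fourier f z - fourier f y - (\<Sum>j\<in>UNIV. of_real ((z - y) $ j) * fourier (g j) y)) \<le> C * (norm (z - y))\<^sup>2" for z
  proof -
    define h where "h = z - y"
    define R where "R x = character h x - 1 - (- 2 * of_real pi * \<i> * of_real (x \<bullet> h))" for x
    have i1: "integrable lborel (\<lambda>x. character z x * f x)" "integrable lborel (\<lambda>x. character y x * f x)"
      "integrable lborel (\<lambda>x. of_real (h $ j) * (character y x * g j x))" for j
      by (intro integrable_mult_right integrable_character_mult schwartz_integrable[OF f]
          schwartz_integrable[OF gS])+
    have sum: "(\<Sum>j\<in>UNIV. of_real (h $ j) * (character y x * g j x))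
        = (- 2 * of_real pi * \<i> * of_real (x \<bullet> h)) * (character y x * f x)" for x
      by (simp add: g_def inner_vec_def sum_distrib_left sum_distrib_right algebra_simps)
    have "fourier f z - fourier f y - (\<Sum>j\<in>UNIV. of_real (h $ j) * fourier (g j) y)
        = (\<integral>x. character z x * f x - character y x * f x
             - (\<Sum>j\<in>UNIV. of_real (h $ j) * (character y x * g j x)) \<partial>lborel)"
      unfolding fourier_character
      by (subst Bochner_Integration.integral_diff, (intro Bochner_Integration.integrable_diff i1 Bochner_Integration.integrable_sum)+,
          subst Bochner_Integration.integral_diff, (intro i1)+, subst Bochner_Integration.integral_sum, (intro i1)+, simp)
    also have "\<dots> = (\<integral>x. R x * (character y x * f x) \<partial>lborel)"
    proof (intro Bochner_Integration.integral_cong refl)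
      fix x
      have "character z x = character y x * character h x"
        using character_add_left[of y h x] by (simp add: h_def)
      then show "character z x * f x - character y x * f x - (\<Sum>j\<in>UNIV. of_real (h $ j) * (character y x * g j x))
          = R x * (character y x * f x)"
        unfolding sum by (simp add: R_def algebra_simps)
    qed
    also have "norm \<dots> \<le> (\<integral>x. (norm h)\<^sup>2 * norm (of_real (2 * pi\<^sup>2 * (norm x)\<^sup>2) * f x) \<partial>lborel)"
    proof (rule Bochner_Integration.integral_norm_bound_integral)
      show "integrable lborel (\<lambda>x. (norm h)\<^sup>2 * norm (of_real (2 * pi\<^sup>2 * (norm x)\<^sup>2) * f x))"
        by (intro integrable_mult_right integrable_norm Ci)
      have le: "norm (R x * (character y x * f x)) \<le> (norm h)\<^sup>2 * norm (of_real (2 * pi\<^sup>2 * (norm x)\<^sup>2) * f x)" for x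
      proof -
        have "norm (R x * (character y x * f x)) = norm (R x) * norm (f x)" by (simp add: norm_mult)
        also have "\<dots> \<le> (2 * pi\<^sup>2 * (norm x)\<^sup>2 * (norm h)\<^sup>2) * norm (f x)"
          unfolding R_def by (intro mult_right_mono character_approx) auto
        also have "\<dots> = (norm h)\<^sup>2 * (\<bar>2 * pi\<^sup>2 * (norm x)\<^sup>2\<bar> * norm (f x))" by simp
        also have "\<dots> = (norm h)\<^sup>2 * norm (of_real (2 * pi\<^sup>2 * (norm x)\<^sup>2) * f x)"
          unfolding norm_mult norm_of_real ..
        finally show ?thesis .
      qed
      then show "norm (R x * (character y x * f x)) \<le> (norm h)\<^sup>2 * norm (of_real (2 * pi\<^sup>2 * (norm x)\<^sup>2) * f x)" for x .
      have [measurable]: "R \<in> borel_measurable borel" unfolding R_def by measurable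
      show "integrable lborel (\<lambda>x. R x * (character y x * f x))"
        by (rule Bochner_Integration.integrable_bound
            [OF \<open>integrable lborel (\<lambda>x. (norm h)\<^sup>2 * norm (of_real (2 * pi\<^sup>2 * (norm x)\<^sup>2) * f x))\<close>])
          (use le in \<open>auto simp del: norm_mult of_real_mult intro!: order_trans[OF le abs_ge_self]\<close>)
    qed
    also have "\<dots> = C * (norm h)\<^sup>2" by (simp add: C_def)
    finally show ?thesis by (simp add: h_def)
  qed
  show ?thesis unfolding g_def[symmetric]
  proof (rule has_derivativeI_sandwich[where e = 1 and H = "\<lambda>z. C * norm (z - y)"])
    show "bounded_linear (\<lambda>h. \<Sum>j\<in>UNIV. of_real (h $ j) * fourier (g j) y)"
      by (intro bounded_linear_sum bounded_linear_mult_const bounded_linear_compose[OF bounded_linear_of_real]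
          bounded_linear_vec_nth)
    show "norm (fourier f z - fourier f y - (\<Sum>j\<in>UNIV. of_real ((z - y) $ j) * fourier (g j) y)) / norm (z - y)
        \<le> C * norm (z - y)" if "z \<noteq> y" for z
    proof -
      have "norm (z - y) > 0" using that by simp
      then show ?thesis using bound[of z] by (simp only: pos_divide_le_eq power2_eq_square mult.assoc)
    qed
    have "((\<lambda>z. C * norm (z - y)) \<longlongrightarrow> C * norm (y - y)) (at y)"
      by (intro tendsto_intros)
    then show "((\<lambda>z. C * norm (z - y)) \<longlongrightarrow> 0) (at y)" by simp
  qed simp
qed

text \<open>Induction on the power: one factor \<open>norm y\<close> is bounded by the sum of the
  \<open>\<bar>y $ j\<bar>\<close>, and each of these is absorbed into the transform of
  \<open>partial_deriv j f\<close>, as \<open>2 * pi \<ge> 1\<close>.\<close>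

lemma rapid_fourier:
  fixes f :: "real ^ 'd \<Rightarrow> complex"
  assumes f: "f \<in> schwartz"
  shows "rapid (fourier f)"
proof -
  have "\<exists>C. \<forall>y. norm y ^ k * norm (fourier f y) \<le> C" for k
    using f
  proof (induction k arbitrary: f)
    case 0
    then show ?case using norm_fourier_le[OF schwartz_integrable] by auto
  next
    case (Suc k)
    have "\<forall>j. \<exists>C. \<forall>y. norm y ^ k * norm (fourier (partial_deriv j f) y) \<le> C"
      using Suc schwartz_partial_deriv by blast
    then obtain C where C: "\<And>j y. norm y ^ k * norm (fourier (partial_deriv j f) y) \<le> C j" by metis
    have "norm y ^ Suc k * norm (fourier f y) \<le> (\<Sum>j\<in>UNIV. C j)" for y
    proof -
      have "norm y ^ Suc k * norm (fourier f y) = norm y * (norm y ^ k * norm (fourier f y))"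
        by simp
      also have "\<dots> \<le> (\<Sum>j\<in>UNIV. \<bar>y $ j\<bar>) * (norm y ^ k * norm (fourier f y))"
        by (intro mult_right_mono norm_le_l1_cart) simp
      also have "\<dots> = (\<Sum>j\<in>UNIV. \<bar>y $ j\<bar> * (norm y ^ k * norm (fourier f y)))"
        by (simp add: sum_distrib_right)
      also have "\<dots> \<le> (\<Sum>j\<in>UNIV. C j)"
      proof (rule sum_mono)
        fix j
        have "1 * (\<bar>y $ j\<bar> * (norm y ^ k * norm (fourier f y))) \<le> (2 * pi) * (\<bar>y $ j\<bar> * (norm y ^ k * norm (fourier f y)))"
          using pi_ge_two by (intro mult_right_mono) auto
        also have "\<dots> = norm y ^ k * norm (fourier (partial_deriv j f) y)"
          unfolding fourier_partial_deriv[OF Suc.prems] by (simp add: norm_mult)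
        also have "\<dots> \<le> C j" by (rule C)
        finally show "\<bar>y $ j\<bar> * (norm y ^ k * norm (fourier f y)) \<le> C j" by simp
      qed
      finally show ?thesis .
    qed
    then show ?case by blast
  qed
  then show ?thesis by (simp add: rapid_def)
qed

text \<open>The image of the Schwartz space is itself a class stable under partial derivatives:
  differentiating a transform amounts to multiplying the transformed function by a coordinate and a
  constant.\<close>

lemma fourier_schwartz:
  fixes f :: "real ^ 'd \<Rightarrow> complex"
  assumes "f \<in> schwartz"
  shows "fourier f \<in> schwartz"
proof (rule schwartz_coinduct[where A = "fourier ` schwartz"])
  show "h differentiable (at x)" if "h \<in> fourier ` schwartz" for h :: "real ^ 'd \<Rightarrow> complex" and x
    using that fourier_has_derivative differentiableI by blast
  show "rapid h" if "h \<in> fourier ` schwartz" for h :: "real ^ 'd \<Rightarrow> complex"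
    using that rapid_fourier by blast
  show "partial_deriv j h \<in> fourier ` schwartz" if h: "h \<in> fourier ` schwartz" for h :: "real ^ 'd \<Rightarrow> complex" and j
  proof -
    obtain f where f: "f \<in> schwartz" "h = fourier f" using h by blast
    have "partial_deriv j h y = fourier (\<lambda>x. (- 2 * of_real pi * \<i>) * (of_real (x $ j) * f x)) y" for y
      unfolding f(2) partial_deriv_eqI[OF fourier_has_derivative[OF f(1)]]
      by (simp add: axis_def if_distrib[of complex_of_real] if_distrib[of "\<lambda>z. z * _"] cong: if_cong)
    then have "partial_deriv j h = fourier (\<lambda>x. (- 2 * of_real pi * \<i>) * (of_real (x $ j) * f x))" by auto
    then show ?thesis using schwartz_scale[OF schwartz_coordinate_mult[OF f(1)]] by blast
  qed
qed (use assms in blast)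

lemma fourier_measurable [measurable]:
  fixes f :: "real ^ 'd \<Rightarrow> complex"
  assumes [measurable]: "f \<in> borel_measurable borel"
  shows "fourier f \<in> borel_measurable borel"
proof -
  have "(\<lambda>y. \<integral>x. exp (- 2 * of_real pi * \<i> * of_real (x \<bullet> y)) * f x \<partial>lborel) \<in> borel_measurable borel"
    by measurable
  then show ?thesis by (simp add: fourier_def[abs_def])
qed

text \<open>Fubini for the kernel \<open>character y x\<close>, which is symmetric in its arguments.
  This duality yields the inversion formula and also the nonvanishing of its constant.\<close>

lemma integral_fourier_mult:
  fixes f g :: "real ^ 'd \<Rightarrow> complex"
  assumes f: "f \<in> borel_measurable borel" "integrable lborel f"
    and g: "g \<in> borel_measurable borel" "integrable lborel g"
  shows "(\<integral>y. fourier f y * g y \<partial>lborel) = (\<integral>x. f x * fourier g x \<partial>lborel)"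
proof -
  have [measurable]: "f \<in> borel_measurable borel" "g \<in> borel_measurable borel" using f g by auto
  have int: "integrable (lborel \<Otimes>\<^sub>M lborel) (\<lambda>(x, y). character y x * f x * g y)"
  proof (rule lborel_pair.Fubini_integrable)
    show "(\<lambda>(x, y). character y x * f x * g y) \<in> borel_measurable (lborel \<Otimes>\<^sub>M lborel)"
      unfolding character_def by measurable
    have "integrable lborel (\<lambda>x. norm (f x) * (\<integral>y. norm (g y) \<partial>lborel))"
      by (intro integrable_mult_left integrable_norm f)
    then show "integrable lborel (\<lambda>x. \<integral>y. norm (case (x, y) of (x, y) \<Rightarrow> character y x * f x * g y) \<partial>lborel)"
      by (simp add: norm_mult)
    have "integrable lborel (\<lambda>y. f x * (character x y * g y))" for x
      by (intro integrable_mult_right integrable_character_mult g)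
    then show "AE x in lborel. integrable lborel (\<lambda>y. case (x, y) of (x, y) \<Rightarrow> character y x * f x * g y)"
      by (simp add: character_commute mult_ac)
  qed
  have "(\<integral>y. fourier f y * g y \<partial>lborel) = (\<integral>y. (\<integral>x. character y x * f x * g y \<partial>lborel) \<partial>lborel)"
    by (simp add: fourier_character)
  also have "\<dots> = (\<integral>x. (\<integral>y. character y x * f x * g y \<partial>lborel) \<partial>lborel)"
    by (rule lborel_pair.Fubini_integral[OF int])
  also have "\<dots> = (\<integral>x. (\<integral>y. f x * (character x y * g y) \<partial>lborel) \<partial>lborel)"
    by (simp add: character_commute mult_ac)
  also have "\<dots> = (\<integral>x. f x * fourier g x \<partial>lborel)"
    by (simp add: fourier_character)
  finally show ?thesis .
qed

section \<open>Fourier inversion by Gaussian regularisation\<close>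

lemma integral_lborel_affine:
  fixes g :: "real ^ 'd \<Rightarrow> complex"
  assumes [measurable]: "g \<in> borel_measurable borel" and c: "c \<noteq> 0"
  shows "integral\<^sup>L lborel g = (\<bar>c\<bar> ^ CARD('d)) *\<^sub>R (\<integral>x. g (a + c *\<^sub>R x) \<partial>lborel)"
proof -
  have "integral\<^sup>L lborel g = integral\<^sup>L (density (distr lborel borel (\<lambda>x. a + c *\<^sub>R x)) (\<lambda>_. \<bar>c\<bar> ^ CARD('d))) g"
    using lborel_affine[OF c, of a] by simp
  also have "\<dots> = (\<integral>x. (\<bar>c\<bar> ^ CARD('d)) *\<^sub>R g x \<partial>distr lborel borel (\<lambda>x. a + c *\<^sub>R x))"
    by (subst integral_density) auto
  also have "\<dots> = (\<integral>x. (\<bar>c\<bar> ^ CARD('d)) *\<^sub>R g (a + c *\<^sub>R x) \<partial>lborel)"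
    by (subst integral_distr) auto
  finally show ?thesis by simp
qed

text \<open>Not normalised to be its own transform: the transform is never evaluated, which leaves
  an unevaluated constant in the inversion formula.\<close>

definition gaussian :: "real ^ 'd \<Rightarrow> complex" where
  "gaussian x = of_real (exp (- (norm x)\<^sup>2))"

lemma gaussian_schwartz: "(gaussian :: real ^ 'd \<Rightarrow> complex) \<in> schwartz"
proof -
  have "real_polynomial_function (\<lambda>x :: real ^ 'd. \<Sum>j\<in>UNIV. x $ j * x $ j)"
    by (intro real_polynomial_function_sum real_polynomial_function.intros bounded_linear_vec_nth) auto
  moreover have "(\<Sum>j\<in>UNIV. x $ j * x $ j) = (norm x)\<^sup>2" for x :: "real ^ 'd"
    by (simp add: power2_norm_eq_inner inner_vec_def)
  ultimately have "real_polynomial_function (\<lambda>x :: real ^ 'd. (norm x)\<^sup>2)" by simp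
  from exp_polynomial_schwartz[OF this, of 1 0] show ?thesis by (simp add: gaussian_def[abs_def])
qed

text \<open>The duality applied to \<open>f' z = f (x + e *\<^sub>R z)\<close> and the Gaussian,
  after rescaling \<open>y\<close> by \<open>e\<close>. As \<open>e\<close> tends to 0, the left
  side becomes a double transform, while on the right \<open>f (x + e *\<^sub>R z)\<close> tends to
  \<open>f x\<close>.\<close>

lemma fourier_inversion_regularized:
  fixes f :: "real ^ 'd \<Rightarrow> complex"
  assumes f: "f \<in> schwartz" and e: "e > 0"
  shows "(\<integral>y. character (- x) y * fourier f y * gaussian (e *\<^sub>R y) \<partial>lborel)
    = (\<integral>z. f (x + e *\<^sub>R z) * fourier gaussian z \<partial>lborel)"
proof -
  define f' where "f' z = f (x + e *\<^sub>R z)" for z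
  have [measurable]: "f \<in> borel_measurable borel" "(gaussian :: real ^ 'd \<Rightarrow> complex) \<in> borel_measurable borel"
    using f gaussian_schwartz by (auto intro: schwartz_measurable)
  have [measurable]: "f' \<in> borel_measurable borel" unfolding f'_def by measurable
  have f'i: "integrable lborel f'"
  proof -
    have "integrable (density (distr lborel borel (\<lambda>z. x + e *\<^sub>R z)) (\<lambda>_. \<bar>e\<bar> ^ CARD('d))) f"
      using lborel_affine[of e x] e schwartz_integrable[OF f] by simp
    then have "integrable lborel (\<lambda>z. (e ^ CARD('d)) *\<^sub>R f (x + e *\<^sub>R z))" using e
      by (simp add: integrable_density integrable_distr_eq)
    from integrable_scaleR_right[OF this, of "1 / e ^ CARD('d)"] show ?thesis using e
      by (simp add: f'_def[abs_def])
  qed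
  have F: "fourier f' y = (1 / e ^ CARD('d)) *\<^sub>R (character (- x) ((1 / e) *\<^sub>R y) * fourier f ((1 / e) *\<^sub>R y))" for y
  proof -
    have c: "character ((1 / e) *\<^sub>R y) (x + e *\<^sub>R z) = character x ((1 / e) *\<^sub>R y) * character y z" for z
    proof -
      have "character ((1 / e) *\<^sub>R y) (e *\<^sub>R z) = character y z" using e by (simp add: character_def)
      then show ?thesis by (simp only: character_add_right character_commute[of "(1 / e) *\<^sub>R y" x])
    qed
    have inv: "character (- x) u * character x u = 1" for u
      using character_add_left[of "- x" x u] by (simp add: character_def)
    have "fourier f ((1 / e) *\<^sub>R y) = (e ^ CARD('d)) *\<^sub>R (\<integral>z. character ((1 / e) *\<^sub>R y) (x + e *\<^sub>R z) * f (x + e *\<^sub>R z) \<partial>lborel)"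
      unfolding fourier_character using e by (subst integral_lborel_affine[where c = e and a = x]) auto
    also have "\<dots> = (e ^ CARD('d)) *\<^sub>R (character x ((1 / e) *\<^sub>R y) * fourier f' y)"
      unfolding c fourier_character f'_def by (simp add: mult.assoc)
    finally have "character (- x) ((1 / e) *\<^sub>R y) * fourier f ((1 / e) *\<^sub>R y) =
        (e ^ CARD('d)) *\<^sub>R ((character (- x) ((1 / e) *\<^sub>R y) * character x ((1 / e) *\<^sub>R y)) * fourier f' y)"
      by simp
    then show ?thesis using e by (simp add: inv)
  qed
  have "(\<integral>y. character (- x) y * fourier f y * gaussian (e *\<^sub>R y) \<partial>lborel)
      = (\<bar>1 / e\<bar> ^ CARD('d)) *\<^sub>R (\<integral>y. character (- x) (0 + (1 / e) *\<^sub>R y) * fourier f (0 + (1 / e) *\<^sub>R y) * gaussian (e *\<^sub>R (0 + (1 / e) *\<^sub>R y)) \<partial>lborel)"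
    using e by (intro integral_lborel_affine) auto
  also have "\<dots> = (\<integral>y. fourier f' y * gaussian y \<partial>lborel)"
    unfolding F using e by (simp add: power_divide)
  also have "\<dots> = (\<integral>z. f' z * fourier gaussian z \<partial>lborel)"
    by (intro integral_fourier_mult f'i schwartz_integrable gaussian_schwartz) measurable
  finally show ?thesis by (simp add: f'_def)
qed

text \<open>By the inversion theorem this is the value of the Gaussian at 0, namely 1; the proof
  establishes only that it is nonzero.\<close>

definition inversion_const :: "'d::finite itself \<Rightarrow> complex" where
  "inversion_const _ = (\<integral>z. fourier gaussian (z :: real ^ 'd) \<partial>lborel)"

lemma schwartz_bounded: "f \<in> schwartz \<Longrightarrow> \<exists>B. \<forall>x. norm (f x) \<le> B"
  using rapid_one_plus[OF schwartz_rapid, of f 0] by auto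

lemma fourier_inversion:
  fixes f :: "real ^ 'd \<Rightarrow> complex"
  assumes f: "f \<in> schwartz"
  shows "fourier (fourier f) (- x) = inversion_const TYPE('d) * f x"
proof -
  have [measurable]: "f \<in> borel_measurable borel" "(gaussian :: real ^ 'd \<Rightarrow> complex) \<in> borel_measurable borel"
    using f gaussian_schwartz by (auto intro: schwartz_measurable)
  define e where "e n = 1 / real (Suc n)" for n
  have e: "e n > 0" for n by (simp add: e_def)
  have e0: "e \<longlonglongrightarrow> 0"
    using LIMSEQ_inverse_real_of_nat by (simp add: e_def[abs_def] inverse_eq_divide)
  have int: "integrable lborel (\<lambda>y. norm (fourier f y))" "integrable lborel (\<lambda>y. norm (fourier (gaussian :: real ^ 'd \<Rightarrow> complex) y))"
    by (intro integrable_norm schwartz_integrable fourier_schwartz f gaussian_schwartz)+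
  obtain B where B: "\<And>x. norm (f x) \<le> B" using schwartz_bounded[OF f] by blast
  have cg: "isCont gaussian (y :: real ^ 'd)" for y
    using schwartz_continuous[OF gaussian_schwartz[where 'd = 'd]] by (simp add: continuous_on_eq_continuous_at)
  have cf: "isCont f y" for y
    using schwartz_continuous[OF f] by (simp add: continuous_on_eq_continuous_at)
  have "(\<lambda>n. \<integral>y. character (- x) y * fourier f y * gaussian (e n *\<^sub>R y) \<partial>lborel)
      \<longlonglongrightarrow> (\<integral>y. character (- x) y * fourier f y * gaussian (0 :: real ^ 'd) \<partial>lborel)"
  proof (rule integral_dominated_convergence[where w = "\<lambda>y. norm (fourier f y)"])
    show "AE y in lborel. (\<lambda>n. character (- x) y * fourier f y * gaussian (e n *\<^sub>R y))
        \<longlonglongrightarrow> character (- x) y * fourier f y * gaussian (0 :: real ^ 'd)"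
    proof (rule AE_I2)
      fix y :: "real ^ 'd"
      have "(\<lambda>n. e n *\<^sub>R y) \<longlonglongrightarrow> 0"
        using tendsto_scaleR[OF e0 tendsto_const, of y] by simp
      then have "(\<lambda>n. gaussian (e n *\<^sub>R y)) \<longlonglongrightarrow> gaussian (0 :: real ^ 'd)"
        by (rule isCont_tendsto_compose[OF cg])
      then show "(\<lambda>n. character (- x) y * fourier f y * gaussian (e n *\<^sub>R y))
        \<longlonglongrightarrow> character (- x) y * fourier f y * gaussian (0 :: real ^ 'd)"
        by (intro tendsto_mult tendsto_const)
    qed
    show "AE y in lborel. norm (character (- x) y * fourier f y * gaussian (e n *\<^sub>R y)) \<le> norm (fourier f y)" for n
      by (intro AE_I2) (simp add: norm_mult gaussian_def mult_left_le)
  qed (use int in measurable)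
  moreover have "(\<lambda>n. \<integral>z. f (x + e n *\<^sub>R z) * fourier gaussian z \<partial>lborel)
      \<longlonglongrightarrow> (\<integral>z. f x * fourier gaussian (z :: real ^ 'd) \<partial>lborel)"
  proof (rule integral_dominated_convergence[where w = "\<lambda>z :: real ^ 'd. B * norm (fourier gaussian z)"])
    show "AE z in lborel. (\<lambda>n. f (x + e n *\<^sub>R z) * fourier gaussian z) \<longlonglongrightarrow> f x * fourier gaussian z"
    proof (rule AE_I2)
      fix z :: "real ^ 'd"
      have "(\<lambda>n. x + e n *\<^sub>R z) \<longlonglongrightarrow> x"
        using tendsto_add[OF tendsto_const[of x] tendsto_scaleR[OF e0 tendsto_const, of z]] by simp
      then have "(\<lambda>n. f (x + e n *\<^sub>R z)) \<longlonglongrightarrow> f x"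
        by (rule isCont_tendsto_compose[OF cf])
      then show "(\<lambda>n. f (x + e n *\<^sub>R z) * fourier gaussian z) \<longlonglongrightarrow> f x * fourier gaussian z"
        by (intro tendsto_mult tendsto_const)
    qed
    show "AE z in lborel. norm (f (x + e n *\<^sub>R z) * fourier gaussian z) \<le> B * norm (fourier gaussian z)" for n
      by (intro AE_I2) (simp add: norm_mult mult_right_mono B)
    show "integrable lborel (\<lambda>z :: real ^ 'd. B * norm (fourier gaussian z))"
      by (intro integrable_mult_right int)
  qed measurable
  ultimately have "(\<integral>y. character (- x) y * fourier f y * gaussian (0 :: real ^ 'd) \<partial>lborel) = (\<integral>z. f x * fourier gaussian (z :: real ^ 'd) \<partial>lborel)"
    unfolding fourier_inversion_regularized[OF f e] by (rule LIMSEQ_unique)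
  then show ?thesis
    by (simp add: fourier_character[of "fourier f"] inversion_const_def gaussian_def mult.commute)
qed

text \<open>If the constant vanished, then \<open>fourier\<close> would be nilpotent, and Plancherel's identity would force
  \<open>fourier gaussian = 0\<close>.\<close>

lemma inversion_const_nonzero: "inversion_const TYPE('d::finite) \<noteq> 0"
proof
  assume c: "inversion_const TYPE('d) = 0"
  define g :: "real ^ 'd \<Rightarrow> complex" where "g = fourier gaussian"
  have gS: "g \<in> schwartz" unfolding g_def by (intro fourier_schwartz gaussian_schwartz)
  have [measurable]: "g \<in> borel_measurable borel" using gS by (rule schwartz_measurable)
  have gi: "integrable lborel g" using gS by (rule schwartz_integrable)
  have gb: "\<exists>B. \<forall>x. norm (g x) \<le> B" using gS by (rule schwartz_bounded)
  \<comment> \<open>Conjugation commutes with the transform up to a reflection, so the vanishing of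
    \<open>fourier g\<close> carries over to the conjugate.\<close>
  have Fg: "fourier (\<lambda>y. cnj (g y)) x = 0" for x
  proof -
    have "fourier (\<lambda>y. cnj (g y)) x = (\<integral>y. cnj (character (- x) y * g y) \<partial>lborel)"
      by (simp add: fourier_character character_def exp_cnj)
    also have "\<dots> = cnj (fourier g (- x))" unfolding fourier_character by (simp del: complex_cnj_mult)
    also have "\<dots> = 0" unfolding g_def fourier_inversion[OF gaussian_schwartz] c by simp
    finally show ?thesis .
  qed
  have ci: "integrable lborel (\<lambda>y. cnj (g y))" using gi by simp
  have cm: "(\<lambda>y. cnj (g y)) \<in> borel_measurable borel" using borel_measurable_integrable[OF ci] by simp
  have "(\<integral>y. g y * cnj (g y) \<partial>lborel) = (\<integral>y. gaussian y * fourier (\<lambda>y. cnj (g y)) y \<partial>lborel)"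
    using integral_fourier_mult[OF schwartz_measurable[OF gaussian_schwartz] schwartz_integrable[OF gaussian_schwartz] cm ci]
    by (simp add: g_def)
  then have "(\<integral>y. complex_of_real ((norm (g y))\<^sup>2) \<partial>lborel) = 0"
    unfolding Fg complex_norm_square by simp
  then have I0: "(\<integral>y. (norm (g y))\<^sup>2 \<partial>lborel) = 0" by (simp only: integral_complex_of_real of_real_eq_0_iff)
  obtain B where B: "\<And>x. norm (g x) \<le> B" using gb by blast
  have "integrable lborel (\<lambda>y. (norm (g y))\<^sup>2)"
  proof (rule Bochner_Integration.integrable_bound)
    show "integrable lborel (\<lambda>y. B * norm (g y))" by (intro integrable_mult_right integrable_norm gi)
    have "(norm (g y))\<^sup>2 \<le> B * norm (g y)" for y
      unfolding power2_eq_square using B by (rule mult_right_mono) simp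
    then show "AE y in lborel. norm ((norm (g y))\<^sup>2) \<le> norm (B * norm (g y))"
      by (auto intro!: AE_I2 order_trans[OF _ abs_ge_self])
  qed measurable
  then have "AE y in lborel. (norm (g y))\<^sup>2 = 0"
    using I0 by (subst (asm) integral_nonneg_eq_0_iff_AE) auto
  then have "AE y in lborel. g y = 0" by simp
  then have null: "{y. g y \<noteq> 0} \<in> null_sets lborel"
    by (subst (asm) AE_iff_null) auto
  have "open {y. g y \<noteq> 0}"
    by (intro open_Collect_neq schwartz_continuous gS continuous_on_const)
  then have "{y. g y \<noteq> 0} = {}"
    using null open_not_negligible negligible_iff_null_sets null_sets_completionI by blast
  \<comment> \<open>At 0 the character is 1, so \<open>g 0\<close> is the integral of a strictly
    positive function.\<close>
  then have "g 0 = 0" by blast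
  then have "(\<integral>x. complex_of_real (exp (- (norm (x :: real ^ 'd))\<^sup>2)) \<partial>lborel) = 0"
    by (simp add: g_def fourier_character character_def gaussian_def)
  then have "(\<integral>x. exp (- (norm (x :: real ^ 'd))\<^sup>2) \<partial>lborel) = 0"
    by (simp only: integral_complex_of_real of_real_eq_0_iff)
  moreover have "integrable lborel (\<lambda>x. exp (- (norm (x :: real ^ 'd))\<^sup>2))"
    using schwartz_integrable[OF gaussian_schwartz[where 'd = 'd]]
    by (simp only: gaussian_def[abs_def] complex_of_real_integrable_eq)
  ultimately have "AE x in lborel. exp (- (norm (x :: real ^ 'd))\<^sup>2) = 0"
    by (subst (asm) integral_nonneg_eq_0_iff_AE) auto
  then have "emeasure lborel (UNIV :: (real ^ 'd) set) = 0" by (simp add: AE_iff_null null_sets_def)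
  then show False by (simp add: emeasure_lborel_UNIV)
qed

text \<open>The preimage is the reflected transform divided by the inversion constant; the
  substitution of \<open>- x\<close> for \<open>x\<close> reduces the claim to
  \<open>fourier_inversion\<close>.\<close>

lemma fourier_surj_schwartz:
  fixes g :: "real ^ 'd \<Rightarrow> complex"
  assumes g: "g \<in> schwartz"
  shows "\<exists>h\<in>schwartz. fourier h = g"
proof
  define c where "c = inversion_const TYPE('d)"
  have c: "c \<noteq> 0" unfolding c_def by (rule inversion_const_nonzero)
  have [measurable]: "g \<in> borel_measurable borel" using g by (rule schwartz_measurable)
  show "(\<lambda>x. (1 / c) * fourier g (- x)) \<in> schwartz"
    by (intro schwartz_scale schwartz_reflect fourier_schwartz g)
  show "fourier (\<lambda>x. (1 / c) * fourier g (- x)) = g"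
  proof
    fix y
    have "c * fourier (\<lambda>x. (1 / c) * fourier g (- x)) y = (\<integral>x. character y x * fourier g (- x) \<partial>lborel)"
    proof -
      have "fourier (\<lambda>x. (1 / c) * fourier g (- x)) y = (\<integral>x. (1 / c) * (character y x * fourier g (- x)) \<partial>lborel)"
        unfolding fourier_character[of "\<lambda>x. (1 / c) * fourier g (- x)"]
        by (intro Bochner_Integration.integral_cong) (simp_all only: mult.left_commute)
      also have "\<dots> = (1 / c) * (\<integral>x. character y x * fourier g (- x) \<partial>lborel)"
        by (rule integral_mult_right_zero)
      finally show ?thesis using c by simp
    qed
    also have "\<dots> = (\<bar>-1\<bar> ^ CARD('d)) *\<^sub>R (\<integral>x. character y (0 + (-1) *\<^sub>R x) * fourier g (- (0 + (-1) *\<^sub>R x)) \<partial>lborel)"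
      by (intro integral_lborel_affine) auto
    also have "\<dots> = fourier (fourier g) (- y)"
      unfolding fourier_character[of "fourier g"] by (simp add: character_def)
    also have "\<dots> = c * g y" unfolding c_def by (rule fourier_inversion[OF g])
    finally show "fourier (\<lambda>x. (1 / c) * fourier g (- x)) y = g y" using c by simp
  qed
qed

section \<open>Coloured point measures\<close>

lemma space_point_measure: "l \<in> point_measures m \<Longrightarrow> space l = UNIV \<times> {1..m}"
  unfolding point_measures_def radon_measure_on_def coloured_space_def
  by (auto dest!: sets_eq_imp_space_eq simp: space_restrict_space)

lemma sets_point_measure:
  "l \<in> point_measures m \<Longrightarrow> sets l = sets (restrict_space borel (UNIV \<times> {1..m}))"
  by (simp add: point_measures_def radon_measure_on_def coloured_space_def)

lemma Times_nat_borel: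
  assumes "A \<in> sets borel"
  shows "A \<times> (I :: nat set) \<in> sets (borel :: ((real ^ 'd) \<times> nat) measure)"
  unfolding borel_prod[symmetric] by (intro pair_measureI assms borel_open) (rule discrete_topology_class.open_discrete)

lemma Times_sets_point_measure:
  assumes "l \<in> point_measures m" "A \<in> sets borel" "I \<subseteq> {1..m}"
  shows "A \<times> I \<in> sets l"
proof -
  have "UNIV \<times> {1..m} \<in> sets (borel :: ((real ^ 'd) \<times> nat) measure)" by (intro Times_nat_borel) auto
  then show ?thesis
    unfolding sets_point_measure[OF assms(1)] using assms Times_nat_borel
    by (subst sets_restrict_space_iff) auto
qed

lemma sets_colour_part [simp]: "sets (colour_part i l) = sets borel"
  by (simp add: colour_part_def)

lemma measurable_colour_part [simp]: "measurable (colour_part i l) N = measurable borel N"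
  by (intro measurable_cong_sets) auto

lemma measurable_fst_restrict:
  assumes "l \<in> point_measures m"
  shows "fst \<in> restrict_space l (UNIV \<times> {i}) \<rightarrow>\<^sub>M borel"
proof -
  have "fst \<in> restrict_space borel (UNIV \<times> {1..m}) \<rightarrow>\<^sub>M borel"
    by (intro measurable_restrict_space1 borel_measurable_continuous_onI continuous_intros)
  then show ?thesis
    by (intro measurable_restrict_space1) (simp cong: measurable_cong_sets add: sets_point_measure[OF assms])
qed

lemma slice_Int_space:
  "l \<in> point_measures m \<Longrightarrow> i \<in> {1..m} \<Longrightarrow> UNIV \<times> {i} \<inter> space l = UNIV \<times> {i}"
  by (auto simp: space_point_measure)

lemma emeasure_colour_part:
  assumes l: "l \<in> point_measures m" and i: "i \<in> {1..m}" and A: "A \<in> sets borel"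
  shows "emeasure (colour_part i l) A = emeasure l (A \<times> {i})"
proof -
  have "emeasure (colour_part i l) A = emeasure (restrict_space l (UNIV \<times> {i})) (fst -` A \<inter> space (restrict_space l (UNIV \<times> {i})))"
    unfolding colour_part_def by (intro emeasure_distr measurable_fst_restrict[OF l] A)
  also have "fst -` A \<inter> space (restrict_space l (UNIV \<times> {i})) = A \<times> {i}"
    using i by (auto simp: space_restrict_space space_point_measure[OF l])
  also have "emeasure (restrict_space l (UNIV \<times> {i})) (A \<times> {i}) = emeasure l (A \<times> {i})"
    using i Times_sets_point_measure[OF l, of UNIV "{i}"]
    by (intro emeasure_restrict_space) (auto simp: slice_Int_space[OF l i])
  finally show ?thesis .
qed

text \<open>The vague topology only sees integrals over the whole coloured space; extension by 0 to
  the other colours makes a single colour visible to it.\<close>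

lemma integral_colour_part:
  fixes h :: "real ^ 'd \<Rightarrow> complex"
  assumes l: "l \<in> point_measures m" and i: "i \<in> {1..m}" and h: "h \<in> borel_measurable borel"
  shows "integral\<^sup>L (colour_part i l) h = (\<integral>p. (if snd p = i then h (fst p) else 0) \<partial>l)"
proof -
  have "integral\<^sup>L (colour_part i l) h = (\<integral>p. h (fst p) \<partial>restrict_space l (UNIV \<times> {i}))"
    unfolding colour_part_def by (intro integral_distr measurable_fst_restrict[OF l] h)
  also have "\<dots> = (\<integral>p. indicator (UNIV \<times> {i}) p *\<^sub>R h (fst p) \<partial>l)"
    using i Times_sets_point_measure[OF l, of UNIV "{i}"]
    by (intro integral_restrict_space) (auto simp: slice_Int_space[OF l i])
  also have "\<dots> = (\<integral>p. (if snd p = i then h (fst p) else 0) \<partial>l)"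
    by (intro Bochner_Integration.integral_cong) (auto simp: indicator_def)
  finally show ?thesis .
qed

section \<open>Occupation of small cells in a separated configuration\<close>

lemma cell_eq_box:
  assumes "s > 0"
  shows "x \<in> cell s k \<longleftrightarrow> (\<forall>j. of_int (k j) / s \<le> x $ j \<and> x $ j < (of_int (k j) + 1) / s)"
proof -
  have "\<lfloor>s * x $ j\<rfloor> = k j \<longleftrightarrow> of_int (k j) / s \<le> x $ j \<and> x $ j < (of_int (k j) + 1) / s" for j
    using assms by (simp add: floor_eq_iff pos_divide_le_eq pos_less_divide_eq mult.commute)
  then show ?thesis by (simp add: cell_def)
qed

lemma bounded_cell: "s > 0 \<Longrightarrow> bounded (cell s k)"
proof -
  assume s: "s > 0"
  have "cell s k \<subseteq> cbox (\<chi> j. of_int (k j) / s) (\<chi> j. (of_int (k j) + 1) / s)"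
    using s by (auto simp: cell_eq_box mem_box_cart less_imp_le)
  then show ?thesis using bounded_cbox bounded_subset by blast
qed

text \<open>The translate is centred at the midpoint of the cell. The cell contains its lower faces,
  at coordinate distance \<open>1 / (2 * s)\<close> from the midpoint, while the cube is open; hence
  the strict inequality \<open>1 / s < r\<close>.\<close>

lemma cell_subset_cube:
  assumes "s > 0" "1 / s < r"
  shows "cell s k \<subseteq> (+) (\<chi> j. (of_int (k j) + 1 / 2) / s) ` cube r"
proof
  fix x assume x: "x \<in> cell s k"
  define a :: "real ^ 'a" where "a = (\<chi> j. (of_int (k j) + 1 / 2) / s)"
  have "\<bar>(x - a) $ j\<bar> < r / 2" for j
  proof -
    have "of_int (k j) / s \<le> x $ j" "x $ j < (of_int (k j) + 1) / s"
      using x assms(1) by (auto simp: cell_eq_box)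
    moreover have "a $ j = of_int (k j) / s + (1 / s) / 2" "(of_int (k j) + 1) / s = of_int (k j) / s + 1 / s"
      by (simp_all add: a_def add_divide_distrib)
    moreover have "\<bar>y - (b + u / 2)\<bar> < r / 2" if "b \<le> y" "y < b + u" "u < r" for b y u :: real
      using that unfolding abs_less_iff by argo
    ultimately show ?thesis using assms(2) by (simp only: vector_minus_component)
  qed
  then show "x \<in> (+) (\<chi> j. (of_int (k j) + 1 / 2) / s) ` cube r"
    unfolding a_def[symmetric] cube_def by (intro image_eqI[of _ _ "x - a"]) auto
qed

lemma cube_translate_borel: "(+) a ` cube r \<in> sets (borel :: (real ^ 'd) measure)"
proof -
  have "open (cube r :: (real ^ 'd) set)"
  proof -
    have "(cube r :: (real ^ 'd) set) = box (\<chi> j. - (r / 2)) (\<chi> j. r / 2)"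
      unfolding cube_def set_eq_iff mem_box_cart mem_Collect_eq abs_less_iff vec_lambda_beta
      by (auto simp only: minus_less_iff)
    then show ?thesis by (simp add: open_box)
  qed
  then show ?thesis by (intro borel_open open_translation)
qed

context
  fixes m :: nat and r s :: real and l :: "((real ^ 'd) \<times> nat) measure"
  assumes l: "l \<in> separated_point_measures m r" and s: "s > 0" "1 / s < r"
begin

lemma point_measure_if_separated: "l \<in> point_measures m"
  using l by (simp add: separated_point_measures_def)

lemma emeasure_cell_all_colours_le: "emeasure l (cell s k \<times> {1..m}) \<le> 1"
proof -
  define a :: "real ^ 'd" where "a = (\<chi> j. (of_int (k j) + 1 / 2) / s)"
  have "emeasure l (cell s k \<times> {1..m}) \<le> emeasure l ((+) a ` cube r \<times> {1..m})"
    using cell_subset_cube[OF s, of k] Times_sets_point_measure[OF point_measure_if_separated cube_translate_borel]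
    by (intro emeasure_mono) (auto simp: a_def)
  also have "\<dots> \<le> 1" using l by (simp add: separated_point_measures_def)
  finally show ?thesis .
qed

text \<open>Separation counts the points of all colours together. The bound on the sum, unlike one
  bound per colour, says that at most one colour occurs in a cell.\<close>

lemma emeasure_colour_cell_sum_le: "(\<Sum>i=1..m. emeasure (colour_part i l) (cell s k)) \<le> 1"
proof -
  have "(\<Sum>i=1..m. emeasure (colour_part i l) (cell s k)) = (\<Sum>i=1..m. emeasure l (cell s k \<times> {i}))"
    by (intro sum.cong refl emeasure_colour_part[OF point_measure_if_separated]) auto
  also have "\<dots> = emeasure l (\<Union>i\<in>{1..m}. cell s k \<times> {i})"
    using Times_sets_point_measure[OF point_measure_if_separated cell_sets]
    by (intro sum_emeasure) (auto simp: disjoint_family_on_def)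
  also have "(\<Union>i\<in>{1..m}. cell s k \<times> {i}) = cell s k \<times> {1..m}" by auto
  finally show ?thesis using emeasure_cell_all_colours_le by simp
qed

lemma colour_part_cell_bounded:
  assumes i: "i \<in> {1..m}"
  shows "cell_bounded s 1 (colour_part i l)"
proof -
  have "emeasure (colour_part i l) (cell s k) \<le> 1" for k
    using member_le_sum[of i "{1..m}" "\<lambda>i. emeasure (colour_part i l) (cell s k)"] i
      emeasure_colour_cell_sum_le[of k] by (meson finite_atLeastAtMost order_trans zero_le)
  then show ?thesis by (simp add: cell_bounded_def)
qed

text \<open>A cell has compact closure, so its mass is a natural number, and separation bounds it by
  1.\<close>

lemma measure_colour_cell_01:
  assumes i: "i \<in> {1..m}"
  shows "measure (colour_part i l) (cell s k) \<in> {0, 1}"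
proof -
  have "compact (closure (cell s k \<times> {i}))"
    using bounded_cell[OF s(1)] by (auto simp: closure_Times intro!: compact_Times)
  moreover have "cell s k \<times> {i} \<in> sets l"
    using i by (intro Times_sets_point_measure[OF point_measure_if_separated] cell_sets) auto
  ultimately obtain n :: nat where n: "emeasure l (cell s k \<times> {i}) = of_nat n"
    using point_measure_if_separated by (auto simp: point_measures_def)
  then have e: "emeasure (colour_part i l) (cell s k) = of_nat n"
    using emeasure_colour_part[OF point_measure_if_separated i cell_sets] by simp
  have "(of_nat n :: ennreal) \<le> of_nat 1"
    using colour_part_cell_bounded[OF i] unfolding cell_bounded_def e[symmetric] by simp
  then have "n \<le> 1" by (simp only: of_nat_le_iff)
  then show ?thesis using e by (auto simp: measure_def le_Suc_eq)
qed

lemma sum_measure_colour_cell_le: "(\<Sum>i=1..m. measure (colour_part i l) (cell s k)) \<le> 1"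
proof -
  have fin: "emeasure (colour_part i l) (cell s k) = ennreal (measure (colour_part i l) (cell s k))" if "i \<in> {1..m}" for i
    using colour_part_cell_bounded[OF that]
    by (intro emeasure_eq_ennreal_measure) (auto simp: cell_bounded_def top_unique dest: spec[of _ k])
  have "ennreal (\<Sum>i=1..m. measure (colour_part i l) (cell s k)) = (\<Sum>i=1..m. emeasure (colour_part i l) (cell s k))"
    by (simp add: fin flip: sum_ennreal)
  then show ?thesis using emeasure_colour_cell_sum_le[of k]
    by (metis ennreal_1 ennreal_le_iff zero_le_one)
qed

end

section \<open>Test functions on the coloured space, colour by colour\<close>

lemma Cc_colour:
  fixes h :: "real ^ 'd \<Rightarrow> complex"
  assumes h: "continuous_on UNIV h" and K: "compact K" "\<And>x. x \<notin> K \<Longrightarrow> h x = 0" and i: "i \<in> {1..m}"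
  shows "(\<lambda>p. if snd p = i then h (fst p) else 0) \<in> Cc (coloured_space m)"
proof -
  have disc: "continuous_on UNIV (\<lambda>j :: nat. of_bool (j = i) :: complex)"
    by (simp add: continuous_on_open_vimage discrete_topology_class.open_discrete)
  have "continuous_on UNIV (\<lambda>p :: (real ^ 'd) \<times> nat. (of_bool (snd p = i) :: complex) * h (fst p))"
    by (intro continuous_on_mult continuous_on_compose2[OF h] continuous_on_fst continuous_on_id
        continuous_on_compose2[OF disc] continuous_on_snd) auto
  also have "(\<lambda>p :: (real ^ 'd) \<times> nat. (of_bool (snd p = i) :: complex) * h (fst p)) = (\<lambda>p. if snd p = i then h (fst p) else 0)"
    by auto
  finally have "continuous_on (coloured_space m) (\<lambda>p :: (real ^ 'd) \<times> nat. if snd p = i then h (fst p) else 0)"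
    by (rule continuous_on_subset) simp
  moreover have "compact (K \<times> {i})" using K by (intro compact_Times) auto
  moreover have "K \<times> {i} \<subseteq> coloured_space m" using i by (auto simp: coloured_space_def)
  moreover have "\<forall>p\<in>coloured_space m - K \<times> {i}. (if snd p = i then h (fst p) else 0) = 0"
    using K(2) by (metis DiffD2 SigmaI prod.collapse singletonI)
  ultimately show ?thesis unfolding Cc_def by blast
qed

text \<open>Reduces vague test functions to one colour at a time; the finite mass of
  \<open>K\<close> and the bound on \<open>K\<close> supply the integrability behind the
  splitting.\<close>

lemma integral_Cc_eq_sum_colours:
  assumes l: "l \<in> point_measures m" and f: "f \<in> Cc (coloured_space m)"
  shows "integral\<^sup>L l f = (\<Sum>i=1..m. integral\<^sup>L (colour_part i l) (\<lambda>x. f (x, i)))"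
proof -
  have cont: "continuous_on (UNIV \<times> {1..m}) f" using f by (simp add: Cc_def coloured_space_def)
  from f have "\<exists>K. compact K \<and> K \<subseteq> UNIV \<times> {1..m} \<and> (\<forall>p\<in>UNIV \<times> {1..m} - K. f p = 0)"
    by (simp add: Cc_def coloured_space_def)
  then obtain K where K: "compact K" "K \<subseteq> UNIV \<times> {1..m}" "\<forall>p\<in>UNIV \<times> {1..m} - K. f p = 0"
    by (elim exE conjE)
  have fm: "f \<in> borel_measurable l"
    using borel_measurable_continuous_on_restrict[OF cont]
    by (simp cong: measurable_cong_sets add: sets_point_measure[OF l])
  have "bounded (f ` K)" using K cont by (meson compact_continuous_image compact_imp_bounded continuous_on_subset)
  then obtain B where B: "\<And>p. p \<in> K \<Longrightarrow> norm (f p) \<le> B" unfolding bounded_iff by blast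
  have Ks: "K \<in> sets l"
    unfolding sets_point_measure[OF l] using K Times_nat_borel[of UNIV "{1..m}"]
    by (subst sets_restrict_space_iff) (auto intro: borel_compact)
  have "emeasure l K < \<infinity>"
    using l K by (simp add: point_measures_def radon_measure_on_def coloured_space_def)
  then have fi: "integrable l f"
    using K B space_point_measure[OF l] by (intro integrableI_bounded_set[OF Ks fm]) (auto intro!: AE_I2)
  have m: "(\<lambda>x. f (x, i)) \<in> borel_measurable borel" if "i \<in> {1..m}" for i
    by (intro borel_measurable_continuous_onI continuous_on_compose2[OF cont] continuous_intros) (use that in auto)
  have ind: "UNIV \<times> {i} \<in> sets l" if "i \<in> {1..m}" for i
    using that by (intro Times_sets_point_measure[OF l]) auto
  have "integral\<^sup>L l f = (\<integral>p. (\<Sum>i=1..m. indicator (UNIV \<times> {i}) p *\<^sub>R f p) \<partial>l)"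
  proof (intro Bochner_Integration.integral_cong refl)
    fix p assume p: "p \<in> space l"
    have "(\<Sum>i=1..m. indicator (UNIV \<times> {i}) p *\<^sub>R f p) = (\<Sum>i=1..m. if i = snd p then f p else 0)"
      by (intro sum.cong) (auto simp: indicator_def mem_Times_iff)
    then show "f p = (\<Sum>i=1..m. indicator (UNIV \<times> {i}) p *\<^sub>R f p)"
      using p by (cases p) (auto simp: space_point_measure[OF l])
  qed
  also have "\<dots> = (\<Sum>i=1..m. (\<integral>p. indicator (UNIV \<times> {i}) p *\<^sub>R f p \<partial>l))"
    using ind by (intro Bochner_Integration.integral_sum integrable_mult_indicator fi) auto
  also have "\<dots> = (\<Sum>i=1..m. integral\<^sup>L (colour_part i l) (\<lambda>x. f (x, i)))"
  proof (intro sum.cong refl)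
    fix i assume i: "i \<in> {1..m}"
    show "(\<integral>p. indicator (UNIV \<times> {i}) p *\<^sub>R f p \<partial>l) = integral\<^sup>L (colour_part i l) (\<lambda>x. f (x, i))"
      unfolding integral_colour_part[OF l i m[OF i]]
      by (intro Bochner_Integration.integral_cong) (auto simp: indicator_def mem_Times_iff)
  qed
  finally show ?thesis .
qed

section \<open>Approximation of cubes and cells by Schwartz functions\<close>

text \<open>High even powers make the exponent tend to \<open>0\<close> inside the open cube of edge \<open>2 / c\<close> around \<open>z\<close> and to
  infinity outside it, including on its boundary.\<close>

definition bump_exponent :: "real \<Rightarrow> real ^ 'd \<Rightarrow> nat \<Rightarrow> real ^ 'd \<Rightarrow> real" where
  "bump_exponent c z n x = real (Suc n) * (\<Sum>j\<in>UNIV. (c * (x $ j - z $ j)) ^ (2 * Suc n))"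

definition bump :: "real \<Rightarrow> real ^ 'd \<Rightarrow> nat \<Rightarrow> real ^ 'd \<Rightarrow> complex" where
  "bump c z n x = of_real (exp (- bump_exponent c z n x))"

text \<open>From \<open>t\<^sup>2 - 1 \<le> t ^ (2 * Suc n)\<close>. The bound does not involve
  \<open>n\<close>, so it yields membership in the Schwartz space as well as one decay constant for
  all \<open>n\<close>.\<close>

lemma bump_exponent_lower:
  fixes z :: "real ^ 'd"
  shows "bump_exponent c z n x \<ge> (c\<^sup>2 / 2) * (norm x)\<^sup>2 - (c\<^sup>2 * (norm z)\<^sup>2 + real CARD('d))"
proof -
  have pw: "t\<^sup>2 - 1 \<le> t ^ (2 * Suc n)" for t :: real
  proof (cases "t\<^sup>2 \<ge> 1")
    case True
    then have "(t\<^sup>2) ^ 1 \<le> (t\<^sup>2) ^ Suc n" by (intro power_increasing) auto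
    then have "t\<^sup>2 \<le> t ^ (2 * Suc n)" by (simp only: power_mult power_one_right)
    then show ?thesis by linarith
  next
    case False
    have "0 \<le> (t\<^sup>2) ^ Suc n" by simp
    then have "0 \<le> t ^ (2 * Suc n)" by (simp only: power_mult)
    then show ?thesis using False by linarith
  qed
  have "norm x \<le> norm (x - z) + norm z" using norm_triangle_ineq[of "x - z" z] by simp
  then have "(norm x)\<^sup>2 \<le> (norm (x - z) + norm z)\<^sup>2" by (simp add: power_mono)
  also have "\<dots> \<le> 2 * (norm (x - z))\<^sup>2 + 2 * (norm z)\<^sup>2"
    using sum_squares_bound[of "norm (x - z)" "norm z"] by (simp add: power2_sum)
  finally have "c\<^sup>2 * ((norm x)\<^sup>2 / 2) \<le> c\<^sup>2 * ((norm (x - z))\<^sup>2 + (norm z)\<^sup>2)"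
    by (intro mult_left_mono) auto
  then have "(c\<^sup>2 / 2) * (norm x)\<^sup>2 - (c\<^sup>2 * (norm z)\<^sup>2 + real CARD('d)) \<le> c\<^sup>2 * (norm (x - z))\<^sup>2 - real CARD('d)"
    by (simp add: algebra_simps)
  also have "\<dots> = (\<Sum>j\<in>UNIV. (c * (x $ j - z $ j))\<^sup>2 - 1)"
    unfolding power2_norm_eq_inner inner_vec_def
    by (simp add: sum_subtractf sum_distrib_left power2_eq_square mult_ac)
  also have "\<dots> \<le> (\<Sum>j\<in>UNIV. (c * (x $ j - z $ j)) ^ (2 * Suc n))" by (intro sum_mono pw)
  also have "\<dots> \<le> bump_exponent c z n x"
  proof -
    have "0 \<le> (\<Sum>j\<in>UNIV. (c * (x $ j - z $ j)) ^ (2 * Suc n))" by (intro sum_nonneg zero_le_even_power) simp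
    then have "1 * (\<Sum>j\<in>UNIV. (c * (x $ j - z $ j)) ^ (2 * Suc n)) \<le> bump_exponent c z n x"
      unfolding bump_exponent_def by (intro mult_right_mono) auto
    then show ?thesis by simp
  qed
  finally show ?thesis .
qed

lemma bump_schwartz:
  fixes z :: "real ^ 'd"
  assumes "c > 0"
  shows "bump c z n \<in> schwartz"
proof -
  have lin: "real_polynomial_function (\<lambda>x :: real ^ 'd. c * (x $ j - z $ j))" for j
    by (intro real_polynomial_function.intros(4) real_polynomial_function.intros(2) real_polynomial_function_diff
        real_polynomial_function.intros(1) bounded_linear_vec_nth)
  have "real_polynomial_function (bump_exponent c z n :: real ^ 'd \<Rightarrow> real)"
    unfolding bump_exponent_def[abs_def]
    by (intro real_polynomial_function.intros(4) real_polynomial_function.intros(2) real_polynomial_function_sum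
        real_polynomial_function_power lin finite)
  then show ?thesis
    unfolding bump_def[abs_def] using assms
    by (intro exp_polynomial_schwartz[OF _ _ bump_exponent_lower]) auto
qed

lemma bump_decay:
  assumes "c > 0"
  shows "\<exists>D. \<forall>n x. (1 + norm x) ^ k * norm (bump c z n (x :: real ^ 'd)) \<le> D"
proof -
  define b where "b = c\<^sup>2 * (norm z)\<^sup>2 + real CARD('d)"
  have a: "c\<^sup>2 / 2 > 0" using assms by simp
  obtain C where C: "C \<ge> 0" "\<And>t. t \<ge> 0 \<Longrightarrow> (1 + t) ^ k \<le> C * exp (c\<^sup>2 / 2 * t\<^sup>2)"
    using one_plus_power_le_exp_square[OF a] by blast
  have "(1 + norm x) ^ k * norm (bump c z n x) \<le> C * exp b" for n and x :: "real ^ 'd"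
  proof -
    have "(1 + norm x) ^ k * norm (bump c z n x) \<le> (C * exp (c\<^sup>2 / 2 * (norm x)\<^sup>2)) * exp (b - c\<^sup>2 / 2 * (norm x)\<^sup>2)"
      using C bump_exponent_lower[of c x z n]
      by (intro mult_mono) (auto simp: bump_def b_def)
    also have "\<dots> = C * exp b" by (simp flip: exp_add)
    finally show ?thesis .
  qed
  then show ?thesis by blast
qed

text \<open>Inside the cube \<open>real (Suc n) * q ^ Suc n\<close> tends to 0 for each squared
  scaled coordinate \<open>q\<close>. Elsewhere some scaled coordinate has modulus at least 1 and
  contributes at least \<open>Suc n\<close>; on the boundary it is the prefactor alone that makes
  the exponent diverge.\<close>

lemma bump_limit:
  fixes x z :: "real ^ 'd"
  shows "(\<lambda>n. bump c z n x) \<longlonglongrightarrow> indicator {x. \<forall>j. \<bar>c * (x $ j - z $ j)\<bar> < 1} x"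
proof (cases "\<forall>j. \<bar>c * (x $ j - z $ j)\<bar> < 1")
  case True
  have "(\<lambda>n. bump_exponent c z n x) \<longlonglongrightarrow> (\<Sum>j\<in>(UNIV :: 'd set). 0)"
    unfolding bump_exponent_def sum_distrib_left
  proof (rule tendsto_sum)
    fix j
    have "\<bar>c * (x $ j - z $ j)\<bar>\<^sup>2 < 1\<^sup>2" using True by (intro power_strict_mono) auto
    then have "norm ((c * (x $ j - z $ j))\<^sup>2) < 1" by simp
    from LIMSEQ_Suc[OF powser_times_n_limit_0[OF this]]
    show "(\<lambda>n. real (Suc n) * (c * (x $ j - z $ j)) ^ (2 * Suc n)) \<longlonglongrightarrow> 0"
      by (simp only: power_mult)
  qed
  then have "(\<lambda>n. bump c z n x) \<longlonglongrightarrow> of_real (exp (- 0))"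
    unfolding bump_def by (intro tendsto_intros) simp
  then show ?thesis using True by simp
next
  case False
  then obtain j where j: "1 \<le> \<bar>c * (x $ j - z $ j)\<bar>" by (auto simp: not_less)
  have ge: "real n \<le> bump_exponent c z n x" for n
  proof -
    have "1 \<le> \<bar>c * (x $ j - z $ j)\<bar> ^ (2 * Suc n)" using j by (rule one_le_power)
    also have "\<dots> = (c * (x $ j - z $ j)) ^ (2 * Suc n)" by (rule power_even_abs) simp
    also have "\<dots> \<le> (\<Sum>j\<in>UNIV. (c * (x $ j - z $ j)) ^ (2 * Suc n))"
      by (intro member_le_sum zero_le_even_power) auto
    finally have "real (Suc n) * 1 \<le> bump_exponent c z n x"
      unfolding bump_exponent_def by (intro mult_left_mono) auto
    then show ?thesis by simp
  qed
  have "filterlim (\<lambda>n. bump_exponent c z n x) at_top sequentially"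
    by (rule filterlim_at_top_mono[OF filterlim_real_sequentially]) (simp add: ge)
  then have "(\<lambda>n. exp (- bump_exponent c z n x)) \<longlonglongrightarrow> 0"
    by (intro filterlim_compose[OF exp_at_bot] filterlim_compose[OF filterlim_uminus_at_bot_at_top])
  then have "(\<lambda>n. complex_of_real (exp (- bump_exponent c z n x))) \<longlonglongrightarrow> of_real 0"
    by (rule tendsto_of_real)
  moreover have "indicator {x. \<forall>j. \<bar>c * (x $ j - z $ j)\<bar> < 1} x = (0 :: complex)"
    using False by (simp add: indicator_def)
  ultimately show ?thesis by (simp only: bump_def of_real_0)
qed

text \<open>In each coordinate the open cube runs from \<open>k j / s - 1 / Suc n\<close> to
  \<open>(k j + 1) / s\<close>: the upper face stays fixed and excluded, the lower one approaches
  from outside and ends up included. Accordingly \<open>c n\<close> is 2 over the edge and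
  \<open>z n\<close> is the centre.\<close>

lemma cell_as_limit_of_cubes:
  fixes k :: "'d::finite \<Rightarrow> int"
  assumes s: "s > 0"
  defines "c \<equiv> \<lambda>n. 2 / (1 / s + 1 / real (Suc n))"
    and "z \<equiv> \<lambda>n. (\<chi> j. ((2 * of_int (k j) + 1) / s - 1 / real (Suc n)) / 2)"
  shows "c n > 0"
    and "x \<in> {x. \<forall>j. \<bar>c n * (x $ j - z n $ j)\<bar> < 1} \<longleftrightarrow>
      (\<forall>j. of_int (k j) / s - 1 / real (Suc n) < x $ j \<and> x $ j < (of_int (k j) + 1) / s)"
    and "(\<lambda>n. indicator {x. \<forall>j. \<bar>c n * (x $ j - z n $ j)\<bar> < 1} x :: complex) \<longlonglongrightarrow> indicator (cell s k) x"
proof -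
  have pos: "1 / s + 1 / real (Suc n) > 0" for n using s by (intro add_pos_pos) auto
  show "c n > 0" for n unfolding c_def using pos by simp
  have mem: "x \<in> {x. \<forall>j. \<bar>c n * (x $ j - z n $ j)\<bar> < 1} \<longleftrightarrow>
      (\<forall>j. of_int (k j) / s - 1 / real (Suc n) < x $ j \<and> x $ j < (of_int (k j) + 1) / s)" for n x
  proof -
    have "\<bar>c n * (x $ j - z n $ j)\<bar> < 1 \<longleftrightarrow>
        of_int (k j) / s - 1 / real (Suc n) < x $ j \<and> x $ j < (of_int (k j) + 1) / s" for j
    proof -
      define u where "u = 1 / s"
      define v where "v = 1 / real (Suc n)"
      define a where "a = of_int (k j) / s"
      have uv: "u + v > 0" using pos[of n] by (simp only: u_def v_def)
      have z: "z n $ j = a + (u - v) / 2" by (simp add: z_def a_def u_def v_def add_divide_distrib diff_divide_distrib)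
      have "\<bar>c n * (x $ j - z n $ j)\<bar> = \<bar>x $ j - (a + (u - v) / 2)\<bar> * (2 / (u + v))"
      proof -
        have "c n = 2 / (u + v)" by (simp only: c_def u_def v_def)
        then have "\<bar>c n\<bar> = 2 / (u + v)" using uv by simp
        then show ?thesis unfolding z abs_mult by (simp only: mult.commute)
      qed
      also have "\<dots> < 1 \<longleftrightarrow> \<bar>x $ j - (a + (u - v) / 2)\<bar> < (u + v) / 2"
      proof -
        have "t * (2 / (u + v)) < 1 \<longleftrightarrow> t < (u + v) / 2" for t
          using uv by (simp add: pos_divide_less_eq pos_less_divide_eq)
        then show ?thesis .
      qed
      also have "\<dots> \<longleftrightarrow> a - v < x $ j \<and> x $ j < a + u"
        unfolding abs_less_iff by argo
      finally show ?thesis by (simp add: a_def u_def v_def add_divide_distrib)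
    qed
    then show ?thesis by simp
  qed
  show "x \<in> {x. \<forall>j. \<bar>c n * (x $ j - z n $ j)\<bar> < 1} \<longleftrightarrow>
      (\<forall>j. of_int (k j) / s - 1 / real (Suc n) < x $ j \<and> x $ j < (of_int (k j) + 1) / s)"
    by (rule mem)
  show "(\<lambda>n. indicator {x. \<forall>j. \<bar>c n * (x $ j - z n $ j)\<bar> < 1} x :: complex) \<longlonglongrightarrow> indicator (cell s k) x"
  proof (cases "x \<in> cell s k")
    case True
    then have "\<forall>n. x \<in> {x. \<forall>j. \<bar>c n * (x $ j - z n $ j)\<bar> < 1}"
      unfolding mem cell_eq_box[OF s] by (smt (verit) divide_pos_pos of_nat_0_less_iff zero_less_Suc)
    then show ?thesis using True by simp
  next
    case False
    then obtain j where j: "x $ j < of_int (k j) / s \<or> (of_int (k j) + 1) / s \<le> x $ j"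
      unfolding cell_eq_box[OF s] by (meson not_less)
    have "\<forall>\<^sub>F n in sequentially. x \<notin> {x. \<forall>j. \<bar>c n * (x $ j - z n $ j)\<bar> < 1}"
    proof (cases "x $ j < of_int (k j) / s")
      case True
      have "\<forall>\<^sub>F n in sequentially. 1 / real (Suc n) < of_int (k j) / s - x $ j"
        using order_tendstoD(2)[OF LIMSEQ_inverse_real_of_nat, of "of_int (k j) / s - x $ j"] True
        by (simp add: inverse_eq_divide)
      then show ?thesis
      proof eventually_elim
        case (elim n)
        then have "\<not> of_int (k j) / s - 1 / real (Suc n) < x $ j" by argo
        then show ?case unfolding mem by blast
      qed
    next
      case False
      then have "\<not> x $ j < (of_int (k j) + 1) / s" using j by simp
      then show ?thesis unfolding mem by (intro always_eventually) blast
    qed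
    then have "\<forall>\<^sub>F n in sequentially. indicator {x. \<forall>j. \<bar>c n * (x $ j - z n $ j)\<bar> < 1} x = (0 :: complex)"
      by eventually_elim simp
    then show ?thesis using False by (simp add: tendsto_eventually)
  qed
qed

section \<open>Density of the algebra\<close>

text \<open>At scale \<open>2 / r\<close> cells have edge \<open>r / 2 < r\<close>, so each colour
  part has mass at most 1 on them; the bound is therefore uniform over all separated
  configurations.\<close>

lemma N_fun_bound:
  fixes h :: "real ^ 'd \<Rightarrow> complex"
  assumes l: "l \<in> separated_point_measures m r" and r: "r > 0" and h: "h \<in> borel_measurable borel"
    and D: "\<And>x. (1 + norm x) ^ (CARD('d) + 2) * norm (h x) \<le> D"
  shows "norm (N_fun m w h l) \<le> (\<Sum>i=1..m. \<bar>w i\<bar>) * (D * decay_const (2 / r) CARD('d))"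
proof -
  have half: "2 / r > 0" "1 / (2 / r) < r" using r by auto
  have D0: "0 \<le> D" by (rule order_trans[OF _ D[of 0]]) simp
  have dc: "0 \<le> decay_const (2 / r) CARD('d)"
    unfolding decay_const_def using summable_inverse_Suc_squares
    by (intro mult_nonneg_nonneg suminf_nonneg) auto
  have bd: "norm (integral\<^sup>L (colour_part i l) h) \<le> D * decay_const (2 / r) CARD('d)" if i: "i \<in> {1..m}" for i
  proof -
    have "integrable (colour_part i l) h"
      by (rule integrable_decay[OF colour_part_cell_bounded[OF l half i] _ half(1) h D]) simp
    from integral_norm_bound_ennreal[OF this]
    have "ennreal (norm (integral\<^sup>L (colour_part i l) h)) \<le> (\<integral>\<^sup>+x. ennreal (norm (h x)) \<partial>colour_part i l)" .
    also have "\<dots> \<le> ennreal (D * 1 * decay_const (2 / r) CARD('d))"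
      by (rule nn_integral_decay_le[OF colour_part_cell_bounded[OF l half i] _ half(1) D]) simp
    finally show ?thesis using D0 dc by simp
  qed
  have "norm (N_fun m w h l) \<le> (\<Sum>i=1..m. norm (of_real (w i) * integral\<^sup>L (colour_part i l) h))"
    unfolding N_fun_def by (rule norm_sum)
  also have "\<dots> \<le> (\<Sum>i=1..m. \<bar>w i\<bar> * (D * decay_const (2 / r) CARD('d)))"
    by (intro sum_mono) (simp add: norm_mult mult_left_mono bd)
  finally show ?thesis by (simp add: sum_distrib_right)
qed

text \<open>The embedding and the diffraction measure no longer appear: density relies on them only
  through \<open>schwartz_gen\<close> and the algebra conditions of
  \<open>function_algebra\<close>.\<close>

locale configuration_algebra = function_algebra M A
  for M :: "((real ^ 'd) \<times> nat) measure measure" and A +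
  fixes m :: nat and r :: real and w :: "nat \<Rightarrow> real"
  assumes r: "r > 0"
    and sep: "space M \<subseteq> separated_point_measures m r"
    and sets_M: "sets M = sigma_sets (space M) {space M \<inter> U | U. openin (vague_topology m) U}"
    and schwartz_gen: "f \<in> schwartz \<Longrightarrow> \<exists>a\<in>A. AE l in M. a l = N_fun m w f l"
    and inj: "inj_on w {1..m}" and nz: "\<And>i. i \<in> {1..m} \<Longrightarrow> w i \<noteq> 0"
begin

lemma sepD: "l \<in> space M \<Longrightarrow> l \<in> separated_point_measures m r"
  using sep by blast

lemma pmD: "l \<in> space M \<Longrightarrow> l \<in> point_measures m"
  using sep by (auto simp: separated_point_measures_def)

lemma half_r: "2 / r > 0" "1 / (2 / r) < r"
  using r by auto

lemma cell_bounded_colour: "l \<in> space M \<Longrightarrow> i \<in> {1..m} \<Longrightarrow> cell_bounded (2 / r) 1 (colour_part i l)"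
  using colour_part_cell_bounded[OF sepD half_r] .

section \<open>Linear functionals in the closure\<close>

lemma integral_Cc_measurable:
  assumes f: "f \<in> Cc (coloured_space m)"
  shows "(\<lambda>l. integral\<^sup>L l f) \<in> borel_measurable M"
proof (rule borel_measurableI)
  fix S :: "complex set" assume S: "open S"
  have "openin (vague_topology m) {l \<in> point_measures m. integral\<^sup>L l f \<in> S}"
    unfolding vague_topology_def using f S by (intro topology_generated_by_Basis) blast
  then have "space M \<inter> {l \<in> point_measures m. integral\<^sup>L l f \<in> S} \<in> sets M"
    unfolding sets_M by (intro sigma_sets.Basic) blast
  also have "space M \<inter> {l \<in> point_measures m. integral\<^sup>L l f \<in> S} = (\<lambda>l. integral\<^sup>L l f) -` S \<inter> space M"
    using pmD by auto
  finally show "(\<lambda>l. integral\<^sup>L l f) -` S \<inter> space M \<in> sets M" .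
qed

lemma decay_le_weight:
  assumes "(1 + norm x) ^ k * norm (y :: complex) \<le> D"
  shows "norm y \<le> D * (1 / (1 + norm (x :: real ^ 'd)) ^ k)"
proof -
  have "(1 + norm x) ^ k > 0" by (intro zero_less_power) (simp add: add_pos_nonneg)
  then show ?thesis using assms by (simp add: pos_le_divide_eq mult.commute)
qed

lemma colour_integral_limit:
  fixes h :: "real ^ 'd \<Rightarrow> complex"
  assumes l: "l \<in> space M" and i: "i \<in> {1..m}"
    and F: "\<And>n. F n \<in> borel_measurable borel" and h: "h \<in> borel_measurable borel"
    and lim: "\<And>x. (\<lambda>n. F n x) \<longlonglongrightarrow> h x"
    and D: "\<And>n x. (1 + norm x) ^ (CARD('d) + 2) * norm (F n x) \<le> D"
  shows "(\<lambda>n. integral\<^sup>L (colour_part i l) (F n)) \<longlonglongrightarrow> integral\<^sup>L (colour_part i l) h"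
proof (rule integral_dominated_convergence[where w = "\<lambda>x. D * (1 / (1 + norm x) ^ (CARD('d) + 2))"])
  show "integrable (colour_part i l) (\<lambda>x. D * (1 / (1 + norm x) ^ (CARD('d) + 2)))"
    by (intro integrable_mult_right integrable_weight[OF cell_bounded_colour[OF l i] _ half_r(1)]) simp
  show "AE x in colour_part i l. norm (F n x) \<le> D * (1 / (1 + norm x) ^ (CARD('d) + 2))" for n
    by (intro AE_I2 decay_le_weight D)
qed (use F h lim in auto)

text \<open>The sigma-algebra comes from integrals of compactly supported functions, so
  \<open>h\<close> is cut off continuously: \<open>F n\<close> agrees with \<open>h\<close> on the
  ball of radius \<open>n\<close> and vanishes outside that of radius \<open>n + 1\<close>.\<close>

lemma colour_integral_measurable:
  fixes h :: "real ^ 'd \<Rightarrow> complex"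
  assumes h: "h \<in> schwartz" and i: "i \<in> {1..m}"
  shows "(\<lambda>l. integral\<^sup>L (colour_part i l) h) \<in> borel_measurable M"
proof -
  define F where "F n x = of_real (max 0 (min 1 (real n + 1 - norm x))) * h x" for n and x :: "real ^ 'd"
  have Fc: "continuous_on UNIV (F n)" for n
    unfolding F_def[abs_def] by (intro continuous_intros schwartz_continuous h)
  have Fm: "F n \<in> borel_measurable borel" for n
    by (intro borel_measurable_continuous_onI Fc)
  have F0: "F n x = 0" if "x \<notin> cball 0 (real n + 1)" for n x
    using that by (simp add: F_def)
  have le: "norm (F n x) \<le> norm (h x)" for n x
    by (simp add: F_def norm_mult mult_left_le_one_le)
  obtain D where D: "\<And>x. (1 + norm x) ^ (CARD('d) + 2) * norm (h x) \<le> D"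
    using rapid_one_plus[OF schwartz_rapid[OF h]] by blast
  have DF: "(1 + norm x) ^ (CARD('d) + 2) * norm (F n x) \<le> D" for n x
    by (rule order_trans[OF mult_left_mono[OF le] D]) simp
  have lim: "(\<lambda>n. F n x) \<longlonglongrightarrow> h x" for x
  proof (rule tendsto_eventually)
    obtain N where N: "norm x \<le> real N" using real_arch_simple by blast
    show "\<forall>\<^sub>F n in sequentially. F n x = h x"
      using eventually_ge_at_top[of N] by eventually_elim (use N in \<open>simp add: F_def\<close>)
  qed
  show ?thesis
  proof (rule borel_measurable_LIMSEQ_metric)
    fix n
    have "(\<lambda>l. integral\<^sup>L l (\<lambda>p. if snd p = i then F n (fst p) else 0)) \<in> borel_measurable M"
      by (intro integral_Cc_measurable Cc_colour[OF Fc compact_cball F0 i])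
    then show "(\<lambda>l. integral\<^sup>L (colour_part i l) (F n)) \<in> borel_measurable M"
      by (rule measurable_cong[THEN iffD1, rotated]) (simp add: integral_colour_part[OF pmD i Fm])
  next
    fix l assume l: "l \<in> space M"
    show "(\<lambda>n. integral\<^sup>L (colour_part i l) (F n)) \<longlonglongrightarrow> integral\<^sup>L (colour_part i l) h"
      by (rule colour_integral_limit[OF l i Fm schwartz_measurable[OF h] lim DF])
  qed
qed

lemma N_schwartz_closure:
  assumes f: "f \<in> schwartz"
  shows "N_fun m w f \<in> sq_closure M A"
proof -
  have "N_fun m w f \<in> borel_measurable M"
    unfolding N_fun_def[abs_def]
    by (intro borel_measurable_sum borel_measurable_times borel_measurable_const colour_integral_measurable f)
  then show ?thesis using schwartz_gen[OF f] closure_AE_eq by blast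
qed

text \<open>The common constant \<open>D\<close> serves twice: it dominates the integrals over each
  single configuration, and it bounds the functionals uniformly over all configurations.\<close>

lemma N_closure_limit:
  fixes h :: "real ^ 'd \<Rightarrow> complex"
  assumes cl: "\<And>n. N_fun m w (F n) \<in> sq_closure M A"
    and F: "\<And>n. F n \<in> borel_measurable borel" and h: "h \<in> borel_measurable borel"
    and lim: "\<And>x. (\<lambda>n. F n x) \<longlonglongrightarrow> h x"
    and D: "\<And>n x. (1 + norm x) ^ (CARD('d) + 2) * norm (F n x) \<le> D"
  shows "N_fun m w h \<in> sq_closure M A"
proof (rule closure_bounded_limit[OF cl])
  show "(\<lambda>n. N_fun m w (F n) l) \<longlonglongrightarrow> N_fun m w h l" if "l \<in> space M" for l
    unfolding N_fun_def
    by (intro tendsto_sum tendsto_mult tendsto_const colour_integral_limit[OF that _ F h lim D])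
  show "norm (N_fun m w (F n) l) \<le> (\<Sum>i=1..m. \<bar>w i\<bar>) * (D * decay_const (2 / r) CARD('d))"
    if "l \<in> space M" for n l
    by (rule N_fun_bound[OF sepD[OF that] r F D])
qed

lemma N_cube_closure:
  assumes c: "c > 0"
  shows "N_fun m w (indicator {x. \<forall>j. \<bar>c * (x $ j - z $ j)\<bar> < 1}) \<in> sq_closure M A"
proof -
  obtain D where D: "\<And>n x. (1 + norm x) ^ (CARD('d) + 2) * norm (bump c z n (x :: real ^ 'd)) \<le> D"
    using bump_decay[OF c] by blast
  have m: "bump c z n \<in> borel_measurable borel" for n
    by (intro schwartz_measurable bump_schwartz c)
  have hm: "(indicator {x. \<forall>j. \<bar>c * (x $ j - z $ j)\<bar> < 1} :: real ^ 'd \<Rightarrow> complex) \<in> borel_measurable borel"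
    by (rule borel_measurable_LIMSEQ_metric[OF m bump_limit])
  show ?thesis
    by (rule N_closure_limit[OF N_schwartz_closure[OF bump_schwartz[OF c]] m hm bump_limit D])
qed

lemma N_cell_closure:
  assumes s: "s > 0"
  shows "N_fun m w (indicator (cell s k)) \<in> sq_closure M A"
proof -
  define c where "c n = 2 / (1 / s + 1 / real (Suc n))" for n
  define z where "z n = (\<chi> j. ((2 * of_int (k j) + 1) / s - 1 / real (Suc n)) / 2)" for n
  define Q where "Q n = {x. \<forall>j. \<bar>c n * (x $ j - z n $ j)\<bar> < 1}" for n
  have cpos: "c n > 0" for n
    unfolding c_def by (rule cell_as_limit_of_cubes(1)[OF s])
  have Qmem: "x \<in> Q n \<longleftrightarrow> (\<forall>j. of_int (k j) / s - 1 / real (Suc n) < x $ j \<and> x $ j < (of_int (k j) + 1) / s)" for n x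
    unfolding Q_def c_def z_def by (rule cell_as_limit_of_cubes(2)[OF s])
  have Qlim: "(\<lambda>n. indicator (Q n) x :: complex) \<longlonglongrightarrow> indicator (cell s k) x" for x
    unfolding Q_def c_def z_def by (rule cell_as_limit_of_cubes(3)[OF s])
  \<comment> \<open>All cubes lie in one box, since the lower faces are displaced by at most 1; this
    provides the common decay constant.\<close>
  have sub: "Q n \<subseteq> cbox (\<chi> j. of_int (k j) / s - 1) (\<chi> j. (of_int (k j) + 1) / s)" for n
  proof
    fix x assume "x \<in> Q n"
    then have "of_int (k j) / s - 1 / real (Suc n) < x $ j \<and> x $ j < (of_int (k j) + 1) / s" for j
      unfolding Qmem by blast
    moreover have "1 / real (Suc n) \<le> 1" by simp
    ultimately show "x \<in> cbox (\<chi> j. of_int (k j) / s - 1) (\<chi> j. (of_int (k j) + 1) / s)"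
      unfolding mem_box_cart vec_lambda_beta by (smt (verit))
  qed
  obtain R where R: "\<And>x. x \<in> cbox (\<chi> j. of_int (k j) / s - 1) (\<chi> j. (of_int (k j) + 1) / s) \<Longrightarrow> norm x \<le> R"
    using bounded_cbox unfolding bounded_iff by blast
  have "open (Q n)" for n
  proof -
    have "Q n = box (\<chi> j. of_int (k j) / s - 1 / real (Suc n)) (\<chi> j. (of_int (k j) + 1) / s)"
      unfolding set_eq_iff Qmem mem_box_cart vec_lambda_beta by blast
    then show ?thesis by (simp add: open_box)
  qed
  then have m: "(indicator (Q n) :: real ^ 'd \<Rightarrow> complex) \<in> borel_measurable borel" for n
    by (intro borel_measurable_indicator borel_open)
  show ?thesis
  proof (rule N_closure_limit[OF _ m _ Qlim, where D = "(1 + \<bar>R\<bar>) ^ (CARD('d) + 2)"])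
    show "N_fun m w (indicator (Q n)) \<in> sq_closure M A" for n
      unfolding Q_def by (rule N_cube_closure[OF cpos])
    show "(indicator (cell s k) :: real ^ 'd \<Rightarrow> complex) \<in> borel_measurable borel"
      by (intro borel_measurable_indicator cell_sets)
    show "(1 + norm x) ^ (CARD('d) + 2) * norm (indicator (Q n) x :: complex) \<le> (1 + \<bar>R\<bar>) ^ (CARD('d) + 2)" for n x
    proof (cases "x \<in> Q n")
      case True
      then have "norm x \<le> \<bar>R\<bar>" using R sub by (meson abs_ge_self order_trans subsetD)
      then have "(1 + norm x) ^ (CARD('d) + 2) \<le> (1 + \<bar>R\<bar>) ^ (CARD('d) + 2)" by (intro power_mono) auto
      then show ?thesis using True by simp
    qed simp
  qed
qed

section \<open>Occupation events\<close>

definition occupied :: "real \<Rightarrow> nat \<times> ('d \<Rightarrow> int) \<Rightarrow> ((real ^ 'd) \<times> nat) measure set" where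
  "occupied s p = {l \<in> space M. measure (colour_part (fst p) l) (cell s (snd p)) = 1}"

text \<open>A small cell contains at most one point, so \<open>N_fun\<close> of its indicator takes the value \<open>w i\<close> exactly
  if that point has colour \<open>i\<close>; Lagrange interpolation at the possible values isolates this event.\<close>

lemma occupied_approximable:
  assumes i: "i \<in> {1..m}" and s: "s > 0" "1 / s < r"
  shows "occupied s (i, k) \<in> approximable_sets"
proof -
  define h where "h = N_fun m w (indicator (cell s k))"
  \<comment> \<open>The possible values of \<open>h\<close> other than \<open>w i\<close>: an empty
    cell gives 0, a point of another colour its weight. They become the zeros of the interpolation
    polynomial.\<close>
  define V where "V = insert 0 (w ` ({1..m} - {i}))"
  have h: "h \<in> sq_closure M A" unfolding h_def by (rule N_cell_closure[OF s(1)])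
  have [measurable]: "h \<in> borel_measurable M" using h by (rule closure_meas)
  have fin: "emeasure (colour_part j l) (cell s k) < \<infinity>" if "l \<in> space M" "j \<in> {1..m}" for j l
    using colour_part_cell_bounded[OF sepD[OF that(1)] s that(2)] unfolding cell_bounded_def
    by (metis ennreal_less_top infinity_ennreal_def le_less_trans)
  have hval: "h l = of_real (\<Sum>j=1..m. w j * measure (colour_part j l) (cell s k))" if "l \<in> space M" for l
    unfolding h_def N_fun_def of_real_sum
  proof (intro sum.cong refl)
    fix j assume j: "j \<in> {1..m}"
    have "integral\<^sup>L (colour_part j l) (indicator (cell s k) :: _ \<Rightarrow> complex) = of_real (measure (colour_part j l) (cell s k))"
    proof -
      have "has_bochner_integral (colour_part j l) (\<lambda>x. indicator (cell s k) x *\<^sub>R (1 :: complex))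
          (measure (colour_part j l) (cell s k) *\<^sub>R 1)"
        by (rule has_bochner_integral_indicator[OF _ fin[OF that j]]) simp
      moreover have "(\<lambda>x. indicator (cell s k) x *\<^sub>R (1 :: complex)) = indicator (cell s k)"
        by (auto simp: indicator_def)
      ultimately show ?thesis by (simp add: has_bochner_integral_integral_eq scaleR_conv_of_real)
    qed
    then show "complex_of_real (w j) * integral\<^sup>L (colour_part j l) (indicator (cell s k)) = of_real (w j * measure (colour_part j l) (cell s k))"
      by simp
  qed
  have cases: "(h l = of_real (w i) \<and> l \<in> occupied s (i, k)) \<or> (\<exists>v\<in>V. h l = of_real v \<and> l \<notin> occupied s (i, k))"
    if l: "l \<in> space M" for l
  proof (cases "\<exists>j\<in>{1..m}. measure (colour_part j l) (cell s k) = 1")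
    case True
    then obtain j where j: "j \<in> {1..m}" "measure (colour_part j l) (cell s k) = 1" by blast
    have z: "measure (colour_part j' l) (cell s k) = 0" if "j' \<in> {1..m}" "j' \<noteq> j" for j'
    proof -
      \<comment> \<open>Colour \<open>j\<close> already uses up the total mass 1 allowed in a
        cell.\<close>
      have "(\<Sum>a\<in>{j, j'}. measure (colour_part a l) (cell s k)) \<le> (\<Sum>a=1..m. measure (colour_part a l) (cell s k))"
        using j that by (intro sum_mono2) auto
      then have "measure (colour_part j' l) (cell s k) \<le> 0"
        using sum_measure_colour_cell_le[OF sepD[OF l] s, of k] j that by simp
      then show ?thesis by (simp add: measure_le_0_iff)
    qed
    have "(\<Sum>a=1..m. w a * measure (colour_part a l) (cell s k)) = (\<Sum>a=1..m. if a = j then w j else 0)"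
      using j z by (intro sum.cong) auto
    then have hl: "h l = of_real (w j)" using j hval[OF l] by simp
    show ?thesis
    proof (cases "j = i")
      case True
      then show ?thesis using hl j l by (simp add: occupied_def)
    next
      case False
      then show ?thesis using hl j z[OF i] l by (auto simp: occupied_def V_def)
    qed
  next
    case False
    then have z: "measure (colour_part j l) (cell s k) = 0" if "j \<in> {1..m}" for j
      using measure_colour_cell_01[OF sepD[OF l] s that, of k] that by blast
    then have "h l = of_real 0" using hval[OF l] by simp
    moreover have "0 \<in> V" by (simp add: V_def)
    moreover have "l \<notin> occupied s (i, k)" using z[OF i] by (simp add: occupied_def)
    ultimately show ?thesis by (intro disjI2 bexI[of _ 0] conjI)
  qed
  have wV: "w i \<notin> V"
  proof
    assume "w i \<in> V"
    then obtain j where "j \<in> {1..m}" "j \<noteq> i" "w i = w j" using nz[OF i] unfolding V_def by blast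
    then show False using inj_onD[OF inj _ i] by metis
  qed
  have finV: "finite V" by (simp add: V_def)
  have pr: "(\<Prod>v\<in>V. of_real (1 / (w i - v)) * (h l + of_real (- v))) = (indicator (occupied s (i, k)) l :: complex)"
    if l: "l \<in> space M" for l
    using cases[OF l]
  proof (elim disjE conjE bexE)
    assume h: "h l = of_real (w i)" "l \<in> occupied s (i, k)"
    have "(\<Prod>v\<in>V. of_real (1 / (w i - v)) * (h l + of_real (- v))) = (\<Prod>v\<in>V. (1 :: complex))"
    proof (intro prod.cong refl)
      fix v assume "v \<in> V"
      then have "w i - v \<noteq> 0" using wV by auto
      then have "1 / (w i - v) * (w i + - v) = 1" by simp
      then show "of_real (1 / (w i - v)) * (h l + of_real (- v)) = (1 :: complex)"
        unfolding h by (metis of_real_1 of_real_add of_real_mult)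
    qed
    then show ?thesis using h by simp
  next
    fix v assume h: "v \<in> V" "h l = of_real v" "l \<notin> occupied s (i, k)"
    then have "\<exists>v\<in>V. of_real (1 / (w i - v)) * (h l + of_real (- v)) = (0 :: complex)" by (intro bexI[of _ v]) auto
    then have "(\<Prod>v\<in>V. of_real (1 / (w i - v)) * (h l + of_real (- v))) = (0 :: complex)"
      using finV by (simp add: prod_zero_iff)
    then show ?thesis using h by simp
  qed
  define W where "W = \<bar>w i\<bar> + (\<Sum>v\<in>V. \<bar>v\<bar>)"
  have hb: "norm (h l) \<le> W" if "l \<in> space M" for l
  proof -
    have "\<bar>v\<bar> \<le> (\<Sum>v\<in>V. \<bar>v\<bar>)" if "v \<in> V" for v
      using that finV by (intro member_le_sum) auto
    moreover have "0 \<le> (\<Sum>v\<in>V. \<bar>v\<bar>)" by (simp add: sum_nonneg)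
    ultimately show ?thesis using cases[OF that] by (fastforce simp: W_def)
  qed
  have fac: "(\<lambda>l. of_real (1 / (w i - v)) * (h l + of_real (- v))) \<in> sq_closure M A" for v
  proof -
    have "(\<lambda>l. of_real (- v) * 1) \<in> sq_closure M A" by (rule scale_closure[OF one_closure])
    then have "(\<lambda>l. of_real (- v)) \<in> sq_closure M A" by simp
    then show ?thesis by (rule scale_closure[OF add_closure[OF h]])
  qed
  have "(\<lambda>l. \<Prod>v\<in>V. of_real (1 / (w i - v)) * (h l + of_real (- v))) \<in> sq_closure M A"
  proof (rule prod_closure[OF finV fac])
    show "norm (of_real (1 / (w i - v)) * (h l + of_real (- v))) \<le> \<bar>1 / (w i - v)\<bar> * (W + \<bar>v\<bar>)"
      if "l \<in> space M" for v l
    proof -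
      have "norm (h l + of_real (- v)) \<le> W + \<bar>v\<bar>"
        using norm_triangle_ineq[of "h l" "of_real (- v)"] hb[OF that] by simp
      then show ?thesis unfolding norm_mult norm_of_real by (rule mult_left_mono) simp
    qed
  qed
  from closure_bounded_limit[of "\<lambda>_ l. \<Prod>v\<in>V. of_real (1 / (w i - v)) * (h l + of_real (- v))"
      "indicator (occupied s (i, k))" 1, OF this]
  have "(indicator (occupied s (i, k)) :: _ \<Rightarrow> complex) \<in> sq_closure M A"
    using pr by (auto split: split_indicator)
  moreover have "occupied s (i, k) \<in> sets M"
  proof -
    \<comment> \<open>Measurability is read off from \<open>h\<close>: the event is its level set at
      \<open>w i\<close>.\<close>
    have "{l \<in> space M. h l = of_real (w i)} \<in> sets M" by measurable
    also have "{l \<in> space M. h l = of_real (w i)} = occupied s (i, k)"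
    proof -
      have "h l = of_real (w i) \<longleftrightarrow> l \<in> occupied s (i, k)" if "l \<in> space M" for l
        using cases[OF that] wV by (metis of_real_eq_iff)
      then show ?thesis by (auto simp: occupied_def)
    qed
    finally show ?thesis .
  qed
  ultimately show ?thesis by (simp add: approximable_sets_def)
qed

end

section \<open>Occupancy patterns and the vague topology\<close>

context configuration_algebra
begin

text \<open>Cells of edge \<open>1 / n\<close> filling the box with coordinates in
  \<open>[- n, n)\<close>: with index bound \<open>n * n\<close> both resolution and range improve
  with \<open>n\<close>, while each pattern stays finite.\<close>

definition occupancy :: "nat \<Rightarrow> ((real ^ 'd) \<times> nat) measure \<Rightarrow> (nat \<times> ('d \<Rightarrow> int)) set" where
  "occupancy n l = {p \<in> {1..m} \<times> window_index (n * n). l \<in> occupied (real n) p}"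

lemma occupancy_approximable:
  assumes n: "0 < n" "1 / real n < r"
  shows "{l \<in> space M. occupancy n l = T} \<in> approximable_sets"
proof -
  interpret S: sigma_algebra "space M" approximable_sets by (rule sigma_algebra_approximable)
  define I where "I = {1..m} \<times> (window_index (n * n) :: ('d \<Rightarrow> int) set)"
  have fin: "finite I" unfolding I_def by (simp add: finite_window_index)
  show ?thesis
  proof (cases "T \<subseteq> I")
    case True
    have "{l \<in> space M. l \<in> occupied (real n) p \<longleftrightarrow> p \<in> T} \<in> approximable_sets" if "p \<in> I" for p
    proof -
      have o: "occupied (real n) p \<in> approximable_sets"
        using that n occupied_approximable[of "fst p" "real n" "snd p"] by (auto simp: I_def)
      show ?thesis
      proof (cases "p \<in> T")
        case True
        then have "{l \<in> space M. l \<in> occupied (real n) p \<longleftrightarrow> p \<in> T} = occupied (real n) p"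
          by (auto simp: occupied_def)
        then show ?thesis using o by simp
      next
        case False
        then have "{l \<in> space M. l \<in> occupied (real n) p \<longleftrightarrow> p \<in> T} = space M - occupied (real n) p" by auto
        then show ?thesis using approximable_compl[OF o] by simp
      qed
    qed
    then have "{l \<in> space M. \<forall>p\<in>I. l \<in> occupied (real n) p \<longleftrightarrow> p \<in> T} \<in> approximable_sets"
      using fin by (intro S.sets_Collect_finite_All)
    also have "{l \<in> space M. \<forall>p\<in>I. l \<in> occupied (real n) p \<longleftrightarrow> p \<in> T} = {l \<in> space M. occupancy n l = T}"
      using True unfolding occupancy_def I_def[symmetric] by blast
    finally show ?thesis .
  next
    case False
    then have "{l \<in> space M. occupancy n l = T} = {}"
      unfolding occupancy_def I_def[symmetric] by blast
    then show ?thesis by (simp only: S.empty_sets)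
  qed
qed

lemma integral_step_function:
  fixes c :: "('d \<Rightarrow> int) \<Rightarrow> complex"
  assumes l: "l \<in> space M" and i: "i \<in> {1..m}" and n: "0 < n" "1 / real n < r" and I: "finite I"
  shows "integrable (colour_part i l) (\<lambda>x. \<Sum>k\<in>I. indicator (cell (real n) k) x *\<^sub>R c k)"
    and "(\<integral>x. (\<Sum>k\<in>I. indicator (cell (real n) k) x *\<^sub>R c k) \<partial>colour_part i l)
      = (\<Sum>k\<in>I. measure (colour_part i l) (cell (real n) k) *\<^sub>R c k)"
proof -
  have cb: "cell_bounded (real n) 1 (colour_part i l)"
    using n by (intro colour_part_cell_bounded[OF sepD[OF l] _ _ i]) auto
  have "has_bochner_integral (colour_part i l) (\<lambda>x. indicator (cell (real n) k) x *\<^sub>R c k)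
      (measure (colour_part i l) (cell (real n) k) *\<^sub>R c k)" for k
  proof (rule has_bochner_integral_indicator)
    show "emeasure (colour_part i l) (cell (real n) k) < \<infinity>"
      using cb unfolding cell_bounded_def by (metis ennreal_less_top infinity_ennreal_def le_less_trans)
  qed simp
  then have "has_bochner_integral (colour_part i l) (\<lambda>x. \<Sum>k\<in>I. indicator (cell (real n) k) x *\<^sub>R c k)
      (\<Sum>k\<in>I. measure (colour_part i l) (cell (real n) k) *\<^sub>R c k)"
    by (intro has_bochner_integral_sum)
  then show "integrable (colour_part i l) (\<lambda>x. \<Sum>k\<in>I. indicator (cell (real n) k) x *\<^sub>R c k)"
    and "(\<integral>x. (\<Sum>k\<in>I. indicator (cell (real n) k) x *\<^sub>R c k) \<partial>colour_part i l)
      = (\<Sum>k\<in>I. measure (colour_part i l) (cell (real n) k) *\<^sub>R c k)"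
    by (auto simp: has_bochner_integral_iff)
qed

text \<open>Replacing \<open>F\<close> by its values at the corners of the cells gives an integral that only depends on the
  occupied cells, with an error that is uniform in the configuration.\<close>

lemma colour_integral_locally_determined:
  fixes F :: "real ^ 'd \<Rightarrow> complex"
  assumes F: "continuous_on UNIV F" and K: "compact K" "\<And>x. x \<notin> K \<Longrightarrow> F x = 0"
    and i: "i \<in> {1..m}" and e: "e > 0"
  shows "\<forall>\<^sub>F n in sequentially. \<forall>l\<in>space M. \<forall>l'\<in>space M. occupancy n l' = occupancy n l \<longrightarrow>
    norm (integral\<^sup>L (colour_part i l) F - integral\<^sup>L (colour_part i l') F) < e"
proof -
  obtain R0 where "\<forall>x\<in>K. norm x \<le> R0" using compact_imp_bounded[OF K(1)] unfolding bounded_iff by blast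
  define R where "R = max R0 0"
  have F0: "F x = 0" if "norm x > R" for x
    using that \<open>\<forall>x\<in>K. norm x \<le> R0\<close> K(2)[of x] by (force simp: R_def)
  have R: "R \<ge> 0" by (simp add: R_def)
  \<comment> \<open>The window at the fixed scale \<open>2 / r\<close> covers the support with a
    margin of 1. Its mass bound \<open>B\<close> depends neither on \<open>n\<close> nor on the
    configuration.\<close>
  obtain N1 :: nat where N1: "2 / r * (R + 1) < real N1" using reals_Archimedean2 by blast
  define W :: "(real ^ 'd) set" where "W = window (2 / r) N1"
  have W: "x \<in> W" if "norm x \<le> R + 1" for x
  proof -
    have "\<lfloor>2 / r * x $ j\<rfloor> \<in> {- int N1..<int N1}" for j
    proof -
      have "\<bar>2 / r * x $ j\<bar> \<le> 2 / r * (R + 1)"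
        unfolding abs_mult using half_r(1) component_le_norm_cart[of x j] that
        by (intro mult_mono) auto
      then have "- real N1 \<le> 2 / r * x $ j" "2 / r * x $ j < real N1" using N1 unfolding abs_le_iff by argo+
      then show ?thesis by (simp add: le_floor_iff floor_less_iff)
    qed
    then show ?thesis by (simp add: W_def window_def)
  qed
  define B where "B = (2 * real N1) ^ CARD('d) * 1"
  have B: "B \<ge> 0" by (simp add: B_def)
  have emW: "emeasure (colour_part i l) W \<le> ennreal B" if "l \<in> space M" for l
    unfolding W_def B_def by (rule cell_bounded_window[OF cell_bounded_colour[OF that i]]) simp
  \<comment> \<open>Each of the two configurations contributes an error \<open>e' * B\<close>; the
    \<open>+ 1\<close> avoids division by 0 and keeps the final inequality strict.\<close>
  define e' where "e' = e / (2 * (B + 1))"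
  have e': "e' > 0" using e B by (simp add: e'_def)
  have "uniformly_continuous_on (cball 0 (R + 2)) F"
    by (intro compact_uniformly_continuous continuous_on_subset[OF F] compact_cball) simp
  then obtain d0 where d0: "d0 > 0"
      "\<And>x y. x \<in> cball 0 (R + 2) \<Longrightarrow> y \<in> cball 0 (R + 2) \<Longrightarrow> dist y x < d0 \<Longrightarrow> dist (F y) (F x) < e'"
    using e' unfolding uniformly_continuous_on_def by blast
  define d where "d = min d0 1"
  have d: "d > 0" "d \<le> 1" "d \<le> d0" using d0 by (auto simp: d_def)
  \<comment> \<open>The error is carried by \<open>W\<close>: if \<open>norm x > R + 1\<close>, both
    points lie outside the ball of radius \<open>R\<close>, where \<open>F\<close> vanishes.\<close>
  have Fd: "norm (F x - F y) \<le> e' * indicator W x" if xy: "norm (x - y) < d" for x y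
  proof (cases "norm x \<le> R + 1")
    case True
    then have "norm y \<le> R + 2" using xy d norm_triangle_ineq3[of x y] by linarith
    then have "dist (F x) (F y) < e'" using True xy d by (intro d0(2)) (auto simp: dist_norm)
    then show ?thesis using W[OF True] by (simp add: dist_norm)
  next
    case False
    then have "norm y > R" using xy d norm_triangle_ineq3[of x y] by linarith
    then show ?thesis using False e' F0[of x] F0[of y] by simp
  qed
  have Fm: "F \<in> borel_measurable borel" by (rule borel_measurable_continuous_onI[OF F])
  \<comment> \<open>\<open>CARD('d) / n\<close> bounds the distance from a point to the corner of
    its cell, estimated coordinatewise in the l1 norm.\<close>
  have "filterlim (\<lambda>n. real CARD('d) / real n) (nhds 0) sequentially" by (rule lim_const_over_n)
  then have "\<forall>\<^sub>F n in sequentially. real CARD('d) / real n < d" using d(1) by (rule order_tendstoD)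
  moreover have "\<forall>\<^sub>F n in sequentially. 1 / real n < r"
    using r by (intro order_tendstoD(2)[OF lim_const_over_n]) auto
  moreover have "\<forall>\<^sub>F n in sequentially. R + 1 < real n"
    using filterlim_real_sequentially by (simp add: filterlim_at_top_dense)
  ultimately show ?thesis
  proof eventually_elim
    case (elim n)
    have n: "0 < n" using elim(3) R by (cases n) auto
    define corner :: "('d \<Rightarrow> int) \<Rightarrow> real ^ 'd" where "corner k = (\<chi> j. of_int (k j) / real n)" for k
    define I :: "('d \<Rightarrow> int) set" where "I = window_index (n * n)"
    define g where "g x = (\<Sum>k\<in>I. indicator (cell (real n) k) x *\<^sub>R F (corner k))" for x
    have fI: "finite I" unfolding I_def by (rule finite_window_index)
    have close: "norm (F x - g x) \<le> e' * indicator W x" for x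
    proof (cases "x \<in> window (real n) (n * n)")
      case True
      define k where "k j = \<lfloor>real n * x $ j\<rfloor>" for j
      have k: "k \<in> I" using True by (auto simp: k_def I_def window_def window_index_def)
      have ck: "x \<in> cell (real n) k' \<longleftrightarrow> k' = k" for k' by (auto simp: cell_def k_def fun_eq_iff)
      have "g x = (\<Sum>k'\<in>I. if k' = k then F (corner k) else 0)"
        unfolding g_def by (intro sum.cong) (auto simp: indicator_def ck)
      also have "\<dots> = F (corner k)" using k fI by simp
      finally have gx: "g x = F (corner k)" .
      have "norm (x - corner k) \<le> (\<Sum>j\<in>UNIV. \<bar>(x - corner k) $ j\<bar>)" by (rule norm_le_l1_cart)
      also have "\<dots> \<le> (\<Sum>j\<in>(UNIV :: 'd set). 1 / real n)"
      proof (rule sum_mono)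
        fix j
        have "of_int (k j) / real n \<le> x $ j \<and> x $ j < (of_int (k j) + 1) / real n"
          using ck[of k] n cell_eq_box[of "real n" x k] by simp
        then show "\<bar>(x - corner k) $ j\<bar> \<le> 1 / real n"
          by (simp add: corner_def add_divide_distrib)
      qed
      also have "\<dots> = real CARD('d) / real n" by simp
      finally have "norm (x - corner k) < d" using elim(1) by linarith
      then show ?thesis unfolding gx by (rule Fd)
    next
      case False
      \<comment> \<open>Outside the window the norm is at least \<open>n\<close>, beyond the support
        of \<open>F\<close>, and no cell with index in \<open>I\<close> contains
        \<open>x\<close>.\<close>
      then have "real (n * n) / real n \<le> norm x" using n by (intro norm_ge_if_not_in_window) auto
      then have "real n \<le> norm x" using n by simp
      then have "F x = 0" using elim(3) by (intro F0) simp
      moreover have "g x = 0"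
        unfolding g_def using False by (intro sum.neutral) (auto simp: window_eq_UN I_def)
      ultimately show ?thesis using e' by simp
    qed
    have err: "norm (integral\<^sup>L (colour_part i l) F - integral\<^sup>L (colour_part i l) g) \<le> e' * B"
      if l: "l \<in> space M" for l
    proof -
      have fin: "emeasure (colour_part i l) W < \<infinity>"
        using emW[OF l] by (metis ennreal_less_top infinity_ennreal_def le_less_trans)
      have Wi: "integrable (colour_part i l) (\<lambda>x. e' * indicator W x)"
        using fin by (intro integrable_mult_right) (simp add: W_def)
      have gi: "integrable (colour_part i l) g"
        unfolding g_def[abs_def] by (rule integral_step_function(1)[OF l i n elim(2) fI])
      have di: "integrable (colour_part i l) (\<lambda>x. F x - g x)"
      proof (rule Bochner_Integration.integrable_bound[OF Wi])
        show "(\<lambda>x. F x - g x) \<in> borel_measurable (colour_part i l)"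
          using borel_measurable_integrable[OF gi] Fm by (intro borel_measurable_diff) auto
        show "AE x in colour_part i l. norm (F x - g x) \<le> norm (e' * indicator W x)"
          using close by (intro AE_I2 order_trans[OF close]) simp
      qed
      from Bochner_Integration.integrable_add[OF di gi] have Fi: "integrable (colour_part i l) F" by simp
      have "norm (integral\<^sup>L (colour_part i l) F - integral\<^sup>L (colour_part i l) g)
          = norm (\<integral>x. F x - g x \<partial>colour_part i l)"
        by (simp add: Bochner_Integration.integral_diff[OF Fi gi])
      also have "\<dots> \<le> (\<integral>x. e' * indicator W x \<partial>colour_part i l)"
        by (rule Bochner_Integration.integral_norm_bound_integral[OF di Wi close])
      also have "\<dots> = e' * measure (colour_part i l) W"
        by (simp add: W_def)
      also have "\<dots> \<le> e' * B"
        using emW[OF l] e' B by (intro mult_left_mono) (auto simp: measure_def enn2real_leI)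
      finally show ?thesis .
    qed
    show ?case
    proof (intro ballI impI)
      fix l l' assume l: "l \<in> space M" "l' \<in> space M" and occ: "occupancy n l' = occupancy n l"
      have "measure (colour_part i l) (cell (real n) k) = measure (colour_part i l') (cell (real n) k)" if "k \<in> I" for k
      proof -
        have n1: "real n > 0" using n by simp
        have "(i, k) \<in> occupancy n l \<longleftrightarrow> (i, k) \<in> occupancy n l'" using occ by simp
        then have "measure (colour_part i l) (cell (real n) k) = 1 \<longleftrightarrow> measure (colour_part i l') (cell (real n) k) = 1"
          using that i l by (simp add: occupancy_def occupied_def I_def)
        then show ?thesis
          using measure_colour_cell_01[OF sepD[OF l(1)] n1 elim(2) i, of k]
            measure_colour_cell_01[OF sepD[OF l(2)] n1 elim(2) i, of k] by auto
      qed
      then have "integral\<^sup>L (colour_part i l) g = integral\<^sup>L (colour_part i l') g"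
        unfolding g_def integral_step_function(2)[OF l(1) i n elim(2) fI] integral_step_function(2)[OF l(2) i n elim(2) fI]
        by (intro sum.cong) auto
      then have "norm (integral\<^sup>L (colour_part i l) F - integral\<^sup>L (colour_part i l') F)
          = norm ((integral\<^sup>L (colour_part i l) F - integral\<^sup>L (colour_part i l) g)
             - (integral\<^sup>L (colour_part i l') F - integral\<^sup>L (colour_part i l') g))"
        by simp
      also have "\<dots> \<le> e' * B + e' * B"
        by (rule order_trans[OF norm_triangle_ineq4 add_mono[OF err[OF l(1)] err[OF l(2)]]])
      also have "\<dots> < 2 * e' * (B + 1)" using e' by (simp add: algebra_simps)
      also have "\<dots> = e" using B by (simp add: e'_def divide_simps)
      finally show "norm (integral\<^sup>L (colour_part i l) F - integral\<^sup>L (colour_part i l') F) < e" .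
    qed
  qed
qed

lemma integral_Cc_locally_determined:
  assumes f: "f \<in> Cc (coloured_space m)" and e: "e > 0"
  shows "\<forall>\<^sub>F n in sequentially. \<forall>l\<in>space M. \<forall>l'\<in>space M. occupancy n l' = occupancy n l \<longrightarrow>
    norm (integral\<^sup>L l f - integral\<^sup>L l' f) < e"
proof -
  \<comment> \<open>\<open>Suc m\<close> makes the sum of \<open>m\<close> errors strictly smaller
    than \<open>e\<close>.\<close>
  define e' where "e' = e / real (Suc m)"
  have e': "e' > 0" using e by (simp add: e'_def)
  have cont: "continuous_on (UNIV \<times> {1..m}) f" using f by (simp add: Cc_def coloured_space_def)
  from f have "\<exists>K. compact K \<and> K \<subseteq> UNIV \<times> {1..m} \<and> (\<forall>p\<in>UNIV \<times> {1..m} - K. f p = 0)"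
    by (simp add: Cc_def coloured_space_def)
  then obtain K where K: "compact K" "K \<subseteq> UNIV \<times> {1..m}" "\<forall>p\<in>UNIV \<times> {1..m} - K. f p = 0"
    by (elim exE conjE)
  have "\<forall>\<^sub>F n in sequentially. \<forall>i\<in>{1..m}. \<forall>l\<in>space M. \<forall>l'\<in>space M. occupancy n l' = occupancy n l \<longrightarrow>
      norm (integral\<^sup>L (colour_part i l) (\<lambda>x. f (x, i)) - integral\<^sup>L (colour_part i l') (\<lambda>x. f (x, i))) < e'"
  proof (rule eventually_ball_finite)
    show "\<forall>i\<in>{1..m}. \<forall>\<^sub>F n in sequentially. \<forall>l\<in>space M. \<forall>l'\<in>space M. occupancy n l' = occupancy n l \<longrightarrow>
      norm (integral\<^sup>L (colour_part i l) (\<lambda>x. f (x, i)) - integral\<^sup>L (colour_part i l') (\<lambda>x. f (x, i))) < e'"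
    proof
      fix i assume i: "i \<in> {1..m}"
      show "\<forall>\<^sub>F n in sequentially. \<forall>l\<in>space M. \<forall>l'\<in>space M. occupancy n l' = occupancy n l \<longrightarrow>
        norm (integral\<^sup>L (colour_part i l) (\<lambda>x. f (x, i)) - integral\<^sup>L (colour_part i l') (\<lambda>x. f (x, i))) < e'"
      proof (rule colour_integral_locally_determined[OF _ _ _ i e'])
        show "continuous_on UNIV (\<lambda>x. f (x, i))"
          by (intro continuous_on_compose2[OF cont] continuous_intros) (use i in auto)
        show "compact (fst ` K)" using K(1) by (intro compact_continuous_image continuous_intros)
        show "f (x, i) = 0" if "x \<notin> fst ` K" for x
          using that K(3) i by (force simp: image_iff)
      qed
    qed
  qed simp
  then show ?thesis
  proof eventually_elim
    case (elim n)
    show ?case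
    proof (intro ballI impI)
      fix l l' assume l: "l \<in> space M" "l' \<in> space M" and occ: "occupancy n l' = occupancy n l"
      have "norm (integral\<^sup>L l f - integral\<^sup>L l' f)
          = norm (\<Sum>i=1..m. integral\<^sup>L (colour_part i l) (\<lambda>x. f (x, i)) - integral\<^sup>L (colour_part i l') (\<lambda>x. f (x, i)))"
        by (simp add: integral_Cc_eq_sum_colours[OF pmD f] l sum_subtractf)
      also have "\<dots> \<le> (\<Sum>i=1..m. e')"
        using elim l occ by (intro sum_norm_le) (meson less_imp_le)
      also have "\<dots> < e"
        using e by (simp add: e'_def divide_simps)
      finally show "norm (integral\<^sup>L l f - integral\<^sup>L l' f) < e" .
    qed
  qed
qed

text \<open>Stated for all large \<open>n\<close> and not for some \<open>n\<close>: grids of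
  different scales need not refine one another, and for intersections the induction needs an
  \<open>n\<close> that works for both sets.\<close>

lemma vague_open_locally_determined:
  assumes U: "openin (vague_topology m) U" and l: "l \<in> space M \<inter> U"
  shows "\<forall>\<^sub>F n in sequentially. \<forall>l'\<in>space M. occupancy n l' = occupancy n l \<longrightarrow> l' \<in> U"
proof -
  have "generate_topology_on {{l \<in> point_measures m. integral\<^sup>L l f \<in> V} | f V. f \<in> Cc (coloured_space m) \<and> open V} U"
    using U by (simp add: vague_topology_def openin_topology_generated_by_iff)
  then show ?thesis using l
  proof (induction rule: generate_topology_on.induct)
    case (Int a b)
    then have "\<forall>\<^sub>F n in sequentially. \<forall>l'\<in>space M. occupancy n l' = occupancy n l \<longrightarrow> l' \<in> a"
      "\<forall>\<^sub>F n in sequentially. \<forall>l'\<in>space M. occupancy n l' = occupancy n l \<longrightarrow> l' \<in> b" by auto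
    then show ?case by eventually_elim blast
  next
    case (UN \<K>)
    then obtain k where k: "k \<in> \<K>" "l \<in> k" by blast
    then have "\<forall>\<^sub>F n in sequentially. \<forall>l'\<in>space M. occupancy n l' = occupancy n l \<longrightarrow> l' \<in> k" using UN by blast
    then show ?case by eventually_elim (use k in blast)
  next
    case (Basis s)
    then obtain f V where s: "s = {l \<in> point_measures m. integral\<^sup>L l f \<in> V}" "f \<in> Cc (coloured_space m)" "open V"
      by blast
    then have "integral\<^sup>L l f \<in> V" using Basis by simp
    then obtain e where e: "e > 0" "\<And>z. dist z (integral\<^sup>L l f) < e \<Longrightarrow> z \<in> V"
      using s(3) unfolding open_dist by blast
    from integral_Cc_locally_determined[OF s(2) e(1)] show ?case
    proof eventually_elim
      case (elim n)
      show ?case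
      proof (intro ballI impI)
        fix l' assume l': "l' \<in> space M" "occupancy n l' = occupancy n l"
        then have "norm (integral\<^sup>L l f - integral\<^sup>L l' f) < e" using elim Basis.prems by blast
        then show "l' \<in> s" using e(2)[of "integral\<^sup>L l' f"] pmD[OF l'(1)] by (simp add: s dist_norm norm_minus_commute)
      qed
    qed
  qed auto
qed

text \<open>For each \<open>n\<close> there are finitely many patterns, hence countably many pairs
  \<open>(n, T)\<close>. Their level sets act like a countable base on \<open>space M\<close>,
  although they need not be open.\<close>

lemma vague_open_approximable:
  assumes U: "openin (vague_topology m) U"
  shows "space M \<inter> U \<in> approximable_sets"
proof -
  interpret S: sigma_algebra "space M" approximable_sets by (rule sigma_algebra_approximable)
  define C where "C = {(n, T). T \<subseteq> {1..m} \<times> (window_index (n * n) :: ('d \<Rightarrow> int) set) \<and> 0 < n \<and> 1 / real n < r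
    \<and> {l \<in> space M. occupancy n l = T} \<subseteq> U}"
  have "countable (SIGMA n:UNIV. Pow ({1..m} \<times> (window_index (n * n) :: ('d \<Rightarrow> int) set)))"
    by (rule countable_SIGMA[OF countableI_type countable_finite]) (simp add: finite_window_index)
  then have C: "countable C" by (rule countable_subset[rotated]) (auto simp: C_def)
  have "(\<Union>c\<in>C. {l \<in> space M. occupancy (fst c) l = snd c}) \<in> approximable_sets"
    using C by (intro S.countable_UN') (auto simp: C_def intro!: occupancy_approximable)
  also have "(\<Union>c\<in>C. {l \<in> space M. occupancy (fst c) l = snd c}) = space M \<inter> U"
  proof (intro equalityI subsetI)
    fix l assume l: "l \<in> space M \<inter> U"
    have "\<forall>\<^sub>F n in sequentially. 1 / real n < r"
      using r by (intro order_tendstoD(2)[OF lim_const_over_n]) auto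
    with vague_open_locally_determined[OF U l] eventually_gt_at_top[of 0]
    have "\<forall>\<^sub>F n in sequentially. (n, occupancy n l) \<in> C"
      by eventually_elim (auto simp: C_def occupancy_def)
    then obtain n where "(n, occupancy n l) \<in> C" using eventually_happens'[OF sequentially_bot] by blast
    then show "l \<in> (\<Union>c\<in>C. {l \<in> space M. occupancy (fst c) l = snd c})"
      using l by (intro UN_I[of "(n, occupancy n l)"]) auto
  qed (auto simp: C_def)
  finally show ?thesis .
qed

lemma L2_dense_algebra: "L2_dense M A"
proof (rule dense_if_generators_approximable[OF sets_M])
  show "{space M \<inter> U | U. openin (vague_topology m) U} \<subseteq> approximable_sets"
    by clarify (rule vague_open_approximable)
qed

end

section \<open>The process on its support\<close>

theorem theorem4:
  fixes m :: nat
    and \<mu> :: "((real ^ 'd) \<times> nat) measure measure"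
    and w :: "nat \<Rightarrow> real"
    and \<nu> :: "(real ^ 'd) measure"
    and \<theta> :: "(real ^ 'd \<Rightarrow> complex) \<Rightarrow> ((real ^ 'd) \<times> nat) measure \<Rightarrow> complex"
  assumes "1 \<le> m"
    and "ud_ergodic_point_process m \<mu>"
    and "positive_intensities m \<mu>"
    and "diffraction_measure m \<mu> w \<nu>"
    and "diffraction_embedding m \<mu> w \<nu> \<theta>"
    and "inj_on w {1..m}"
    and "\<forall>i\<in>{1..m}. w i \<noteq> 0"
  shows "L2_dense (on_support m \<mu>) (generated_algebra (insert (\<lambda>_. 1) (\<theta> ` schwartz)))"
proof -
  define M where "M = on_support m \<mu>"
  define A where "A = generated_algebra (insert (\<lambda>_. 1) (\<theta> ` schwartz))"
  define X where "X = process_support m \<mu>"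
  interpret prob_space \<mu> using assms(2) by (simp add: ud_ergodic_point_process_def)
  obtain r where r: "r > 0" and closed: "closedin (vague_topology m) X" and X: "X \<subseteq> separated_point_measures m r"
    using assms(2) unfolding ud_ergodic_point_process_def X_def by blast
  have top: "topspace (vague_topology m :: ((real ^ 'd) \<times> nat) measure topology) = space \<mu>"
    and sets_\<mu>: "sets \<mu> = sigma_sets (topspace (vague_topology m)) {U. openin (vague_topology m) U}"
  proof -
    have sub: "{U. openin (vague_topology m) U} \<subseteq> Pow (topspace (vague_topology m :: ((real ^ 'd) \<times> nat) measure topology))"
      by (auto dest: openin_subset)
    have eq: "sets \<mu> = sets (borel_of_topology (vague_topology m))"
      using assms(2) by (simp add: ud_ergodic_point_process_def)
    show "sets \<mu> = sigma_sets (topspace (vague_topology m)) {U. openin (vague_topology m) U}"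
      using sub by (simp add: eq borel_of_topology_def)
    show "topspace (vague_topology m :: ((real ^ 'd) \<times> nat) measure topology) = space \<mu>"
      using sub sets_eq_imp_space_eq[OF eq] by (simp add: borel_of_topology_def)
  qed
  have Xsub: "X \<subseteq> topspace (vague_topology m)" using closed by (rule closedin_subset)
  \<comment> \<open>The support is closed and hence measurable, so restriction to it yields a finite
    measure whose sigma-algebra is the trace.\<close>
  have Xs: "X \<in> sets \<mu>"
  proof -
    have "topspace (vague_topology m) - X \<in> sets \<mu>"
      unfolding sets_\<mu> using closed by (intro sigma_sets.Basic) (auto simp: closedin_def)
    then have "space \<mu> - (topspace (vague_topology m) - X) \<in> sets \<mu>" by (rule sets.compl_sets)
    also have "space \<mu> - (topspace (vague_topology m) - X) = X" using Xsub top by auto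
    finally show ?thesis .
  qed
  have spM: "space M = X"
    unfolding M_def on_support_def X_def[symmetric] using Xsub top by (auto simp: space_restrict_space)
  have setsM: "sets M = sigma_sets (space M) {space M \<inter> U | U. openin (vague_topology m) U}"
  proof -
    have "sets M = (\<inter>) X ` sets \<mu>"
      unfolding M_def on_support_def X_def[symmetric] by (simp add: sets_restrict_space)
    also have "\<dots> = sigma_sets X ((\<inter>) X ` {U. openin (vague_topology m) U})"
      using Xs Xsub unfolding sets_\<mu> by (rule sigma_sets_Int)
    also have "(\<inter>) X ` {U. openin (vague_topology m) U} = {X \<inter> U | U. openin (vague_topology m) U}" by blast
    finally show ?thesis by (simp add: spM)
  qed
  interpret M: finite_measure M
    unfolding M_def on_support_def X_def[symmetric]
    using finite_measure_axioms Xs by (rule finite_measure_restrict_space)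
  obtain B where B: "B \<ge> 0" "cell_bounded 1 B \<nu>"
    using assms(4) cell_bounded_translation_bounded unfolding diffraction_measure_def by blast
  \<comment> \<open>The embedding is specified only on L2 of the diffraction measure, so Schwartz
    functions have to be placed there before measurability of \<open>\<theta> f\<close> is
    available.\<close>
  have L2\<nu>: "f \<in> L2 \<nu>" if f: "f \<in> schwartz" for f
  proof -
    have fm: "f \<in> borel_measurable borel" using f by (rule schwartz_measurable)
    have s: "sets \<nu> = sets borel" using B(2) by (simp add: cell_bounded_def)
    obtain C where C: "\<And>x. norm (f x) \<le> C" using schwartz_bounded[OF f] by blast
    have fi: "integrable \<nu> f"
      by (rule integrable_rapid[OF B(2,1) _ fm schwartz_rapid[OF f]]) simp
    have "integrable \<nu> (\<lambda>x. (norm (f x))\<^sup>2)"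
    proof (rule Bochner_Integration.integrable_bound)
      show "integrable \<nu> (\<lambda>x. C * norm (f x))" by (intro integrable_mult_right integrable_norm fi)
      show "(\<lambda>x. (norm (f x))\<^sup>2) \<in> borel_measurable \<nu>"
        using borel_measurable_integrable[OF fi] by measurable
      have "(norm (f x))\<^sup>2 \<le> C * norm (f x)" for x
        unfolding power2_eq_square by (intro mult_right_mono C) simp
      then show "AE x in \<nu>. norm ((norm (f x))\<^sup>2) \<le> norm (C * norm (f x))"
        by (auto intro!: AE_I2 order_trans[OF _ abs_ge_self])
    qed
    then show ?thesis using borel_measurable_integrable[OF fi] by (simp add: L2_def)
  qed
  have \<theta>L2: "\<theta> f \<in> L2 M" if "f \<in> schwartz" for f
    using assms(5) L2\<nu>[OF that] by (simp add: diffraction_embedding_def L2_isometric_embedding_def M_def)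
  have \<theta>N: "AE l in M. \<theta> (fourier f) l = N_fun m w f l" if "f \<in> schwartz" for f
    using assms(5) that unfolding M_def diffraction_embedding_def by blast
  have \<theta>b: "\<exists>B. AE l in M. norm (\<theta> g l) \<le> B" if g: "g \<in> schwartz" for g
  proof -
    \<comment> \<open>An arbitrary generator \<open>\<theta> g\<close> has no formula of its own;
      writing \<open>g\<close> as a transform identifies it almost everywhere with a bounded
      functional \<open>N_fun m w f\<close>.\<close>
    obtain f where f: "f \<in> schwartz" "fourier f = g" using fourier_surj_schwartz[OF g] by blast
    obtain D where D: "\<And>x. (1 + norm x) ^ (CARD('d) + 2) * norm (f x) \<le> D"
      using rapid_one_plus[OF schwartz_rapid[OF f(1)]] by blast
    have "norm (N_fun m w f l) \<le> (\<Sum>i=1..m. \<bar>w i\<bar>) * (D * decay_const (2 / r) CARD('d))" if "l \<in> space M" for l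
      using that X unfolding spM by (intro N_fun_bound[OF _ r schwartz_measurable[OF f(1)] D]) blast
    then have "AE l in M. norm (N_fun m w f l) \<le> (\<Sum>i=1..m. \<bar>w i\<bar>) * (D * decay_const (2 / r) CARD('d))"
      by (rule AE_I2)
    with \<theta>N[OF f(1)] have "AE l in M. norm (\<theta> g l) \<le> (\<Sum>i=1..m. \<bar>w i\<bar>) * (D * decay_const (2 / r) CARD('d))"
      by eventually_elim (simp add: f(2))
    then show ?thesis by blast
  qed
  have A: "a \<in> borel_measurable M \<and> (\<exists>B. AE l in M. norm (a l) \<le> B)" if "a \<in> A" for a
    using that unfolding A_def
  proof (induction rule: generated_algebra.induct)
    case (gen g)
    show ?case
    proof (cases "g = (\<lambda>_. 1)")
      case True
      then show ?thesis by (auto intro!: exI[of _ 1])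
    next
      case False
      then show ?thesis using gen \<theta>L2 \<theta>b by (auto simp: L2_def)
    qed
  next
    case (add f g)
    then obtain B C where "AE l in M. norm (f l) \<le> B" "AE l in M. norm (g l) \<le> C" by blast
    then have "AE l in M. norm (f l + g l) \<le> B + C"
      by eventually_elim (meson add_mono norm_triangle_ineq order_trans)
    then show ?case using add by (auto intro: borel_measurable_add)
  next
    case (scale f c)
    then obtain B where "AE l in M. norm (f l) \<le> B" by blast
    then have "AE l in M. norm (c * f l) \<le> norm c * B"
      by eventually_elim (simp add: norm_mult mult_left_mono)
    then show ?case using scale by (auto intro: borel_measurable_times)
  next
    case (mult f g)
    then obtain B C where "AE l in M. norm (f l) \<le> B" "AE l in M. norm (g l) \<le> C" by blast
    then have "AE l in M. norm (f l * g l) \<le> B * C"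
    proof eventually_elim
      case (elim l)
      then have "0 \<le> B" using norm_ge_zero order_trans by blast
      then show ?case using elim unfolding norm_mult by (intro mult_mono) auto
    qed
    then show ?case using mult by (auto intro: borel_measurable_times)
  qed
  interpret configuration_algebra M A m r w
  proof
    show "\<exists>a\<in>A. AE l in M. a l = N_fun m w f l" if f: "f \<in> schwartz" for f
    proof
      \<comment> \<open>The opposite direction: transforms of Schwartz functions are Schwartz, so
        the functional of any Schwartz \<open>f\<close> is realised by a generator.\<close>
      show "\<theta> (fourier f) \<in> A"
        unfolding A_def using fourier_schwartz[OF f] by (intro generated_algebra.gen) blast
    qed (rule \<theta>N[OF f])
    show "(\<lambda>_. 1) \<in> A" unfolding A_def by (intro generated_algebra.gen) blast
    show "(\<lambda>l. f l + g l) \<in> A" if "f \<in> A" "g \<in> A" for f g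
      using that unfolding A_def by (rule generated_algebra.add)
    show "(\<lambda>l. c * f l) \<in> A" if "f \<in> A" for f c
      using that unfolding A_def by (rule generated_algebra.scale)
    show "(\<lambda>l. f l * g l) \<in> A" if "f \<in> A" "g \<in> A" for f g
      using that unfolding A_def by (rule generated_algebra.mult)
    show "f \<in> borel_measurable M" "\<exists>B. AE l in M. norm (f l) \<le> B" if "f \<in> A" for f
      using A[OF that] by auto
    show "space M \<subseteq> separated_point_measures m r" using X spM by simp
    show "w i \<noteq> 0" if "i \<in> {1..m}" for i using assms(7) that by blast
  qed (rule r setsM assms(6))+
  show ?thesis using L2_dense_algebra by (simp add: M_def A_def)
qed

end
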